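(* Let $\nu>0$ and $T>0$. Let $h$ be a real distribution from $\mathbb{R}^3$ to $\mathbb{R}^3$ satisfying $$\nabla\times h=\Lambda h,\qquad \nabla\cdot h=0,\qquad |\widehat h|=1.$$ Let $u$ be a smooth solution on $[0,T)\times\mathbb{R}^3$ of the incompressible Navier-Stokes equations $$\partial_t u+u\cdot\nabla u+\nabla p=\nu\Delta u,\qquad \nabla\cdot u=0,$$ which is self-dual, i.e. $u_-(t,x)=-u_+(t,-x)$, where $u_\pm=\frac12\left(u\pm\Lambda^{-1}\nabla\times u\right)$, and write $u_+(t,x)=v(t,x)*h(x)$ with $v$ a real scalar function of $(t,x)$. Then $v$ satisfies the single scalar equation $$ v_t-\nu\Delta v=\sum_{i=1}^3 h_i^r*\left[\left(v*h-v^r*h^r\right)\times\left(v*\Lambda h+v^r*\Lambda h^r\right)\right]_i,\qquad t\in[0,T),\ x\in\mathbb{R}^3, $$ where $v^r(t,x)=v(t,-x)$ and $h^r(x)=h(-x)$.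
   Context: $\Lambda=\sqrt{-\Delta}$ is the Fourier multiplier with symbol $|\xi|$ on $\mathbb{R}^3$; $\widehat{\cdot}$ is the Fourier transform in $x$ and $*$ is convolution in $x$, normalized so that $\widehat{f*g}=\widehat f\,\widehat g$ and $\widehat{\partial_j f}=\sqrt{-1}\,\xi_j\widehat f$. The condition $|\widehat h|=1$ means that $\widehat h$ is a measurable $\mathbb{C}^3$-valued function of Euclidean (Hermitian) norm $1$ for almost every $\xi$; convolution with a component of $h$ (or $h^r$) is thus the Fourier multiplier with the corresponding bounded symbol. A subscript $i$ on a vector denotes its $i$-th component and $\times$ is the cross product in $\mathbb{R}^3$. Smooth solutions are understood to satisfy $u\in C([0,T);H^s(\mathbb{R}^3))$ for every $s\ge0$. *)

theory Defs
  imports "HOL-Analysis.Analysis"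
begin

type_synonym R3 = "real ^ 3"

section \<open>Classical derivatives in the space variable\<close>

definition pd :: "3 \<Rightarrow> (R3 \<Rightarrow> 'b::real_normed_vector) \<Rightarrow> R3 \<Rightarrow> 'b" where
  "pd j f x = vector_derivative (\<lambda>s. f (x + s *\<^sub>R axis j 1)) (at 0)"

definition pds :: "3 list \<Rightarrow> (R3 \<Rightarrow> 'b::real_normed_vector) \<Rightarrow> R3 \<Rightarrow> 'b" where
  "pds js f = foldr pd js f"

definition laplacian :: "(R3 \<Rightarrow> 'b::real_normed_vector) \<Rightarrow> R3 \<Rightarrow> 'b" where
  "laplacian f x = (\<Sum>j\<in>UNIV. pd j (pd j f) x)"

definition grad :: "(R3 \<Rightarrow> real) \<Rightarrow> R3 \<Rightarrow> R3" where
  "grad f x = (\<chi> j. pd j f x)"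

definition curl :: "(R3 \<Rightarrow> complex ^ 3) \<Rightarrow> R3 \<Rightarrow> complex ^ 3" where
  "curl w x = vector
     [pd 2 w x $ 3 - pd 3 w x $ 2,
      pd 3 w x $ 1 - pd 1 w x $ 3,
      pd 1 w x $ 2 - pd 2 w x $ 1]"

definition ccross :: "complex ^ 3 \<Rightarrow> complex ^ 3 \<Rightarrow> complex ^ 3" where
  "ccross a b = vector
     [a $ 2 * b $ 3 - a $ 3 * b $ 2,
      a $ 3 * b $ 1 - a $ 1 * b $ 3,
      a $ 1 * b $ 2 - a $ 2 * b $ 1]"

section \<open>Schwartz functions and tempered distributions\<close>

definition schwartz :: "(R3 \<Rightarrow> complex) \<Rightarrow> bool" where
  "schwartz \<phi> \<longleftrightarrow>
     (\<forall>js x. pds js \<phi> differentiable (at x)) \<and>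
     (\<forall>js N. bounded (range (\<lambda>x. (1 + norm x) ^ N *\<^sub>R pds js \<phi> x)))"

text \<open>A scalar distribution is a functional on test functions, of which only the values on
  Schwartz functions matter. Continuity is the bound by a single Schwartz seminorm; \<open>B\<close> ranges
  over the upper bounds of that seminorm of \<open>\<phi>\<close>.\<close>

definition tempered_distribution :: "((R3 \<Rightarrow> complex) \<Rightarrow> complex) \<Rightarrow> bool" where
  "tempered_distribution S \<longleftrightarrow>
     (\<forall>\<phi> \<psi>. schwartz \<phi> \<longrightarrow> schwartz \<psi> \<longrightarrow> S (\<lambda>x. \<phi> x + \<psi> x) = S \<phi> + S \<psi>) \<and>
     (\<forall>c \<phi>. schwartz \<phi> \<longrightarrow> S (\<lambda>x. c * \<phi> x) = c * S \<phi>) \<and>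
     (\<exists>C N. \<forall>\<phi> B. schwartz \<phi> \<longrightarrow>
        (\<forall>js x. length js \<le> N \<longrightarrow> (1 + norm x) ^ N * norm (pds js \<phi> x) \<le> B) \<longrightarrow>
        norm (S \<phi>) \<le> C * B)"

definition real_distribution :: "((R3 \<Rightarrow> complex) \<Rightarrow> complex) \<Rightarrow> bool" where
  "real_distribution S \<longleftrightarrow> (\<forall>\<phi>. schwartz \<phi> \<longrightarrow> (\<forall>x. \<phi> x \<in> \<real>) \<longrightarrow> S \<phi> \<in> \<real>)"

definition temperate_function :: "(R3 \<Rightarrow> complex) \<Rightarrow> bool" where
  "temperate_function f \<longleftrightarrow>
     f \<in> borel_measurable lborel \<and>
     (\<forall>\<phi>. schwartz \<phi> \<longrightarrow> integrable lborel (\<lambda>x. f x * \<phi> x))"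

definition distribution_of :: "(R3 \<Rightarrow> complex) \<Rightarrow> (R3 \<Rightarrow> complex) \<Rightarrow> complex" where
  "distribution_of f \<phi> = (LINT x|lborel. f x * \<phi> x)"

definition component :: "3 \<Rightarrow> ('a \<Rightarrow> complex ^ 3) \<Rightarrow> 'a \<Rightarrow> complex" where
  "component i F a = F a $ i"

text \<open>Derivative and reflection of (vector-valued) distributions, dual to
  \<open>\<integral> (\<partial>\<^sub>j f) \<phi> = - \<integral> f (\<partial>\<^sub>j \<phi>)\<close> and \<open>\<integral> f(-x) \<phi>(x) = \<integral> f(x) \<phi>(-x)\<close>.\<close>

definition dist_pd :: "3 \<Rightarrow> ((R3 \<Rightarrow> complex) \<Rightarrow> complex ^ 3) \<Rightarrow> (R3 \<Rightarrow> complex) \<Rightarrow> complex ^ 3" where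
  "dist_pd j S \<phi> = - S (pd j \<phi>)"

definition dist_div :: "((R3 \<Rightarrow> complex) \<Rightarrow> complex ^ 3) \<Rightarrow> (R3 \<Rightarrow> complex) \<Rightarrow> complex" where
  "dist_div S \<phi> = (\<Sum>j\<in>UNIV. dist_pd j S \<phi> $ j)"

definition dist_curl :: "((R3 \<Rightarrow> complex) \<Rightarrow> complex ^ 3) \<Rightarrow> (R3 \<Rightarrow> complex) \<Rightarrow> complex ^ 3" where
  "dist_curl S \<phi> = vector
     [dist_pd 2 S \<phi> $ 3 - dist_pd 3 S \<phi> $ 2,
      dist_pd 3 S \<phi> $ 1 - dist_pd 1 S \<phi> $ 3,
      dist_pd 1 S \<phi> $ 2 - dist_pd 2 S \<phi> $ 1]"

definition dist_reflect :: "((R3 \<Rightarrow> complex) \<Rightarrow> complex ^ 3) \<Rightarrow> (R3 \<Rightarrow> complex) \<Rightarrow> complex ^ 3" where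
  "dist_reflect S \<phi> = S (\<lambda>x. \<phi> (- x))"

section \<open>Fourier transform\<close>

definition ft :: "(R3 \<Rightarrow> complex) \<Rightarrow> R3 \<Rightarrow> complex" where
  "ft \<phi> \<xi> = (LINT x|lborel. cis (- (x \<bullet> \<xi>)) * \<phi> x)"

definition inv_ft :: "(R3 \<Rightarrow> complex) \<Rightarrow> R3 \<Rightarrow> complex" where
  "inv_ft \<phi> x = (LINT \<xi>|lborel. cis (x \<bullet> \<xi>) * \<phi> \<xi>) / (2 * pi) ^ 3"

text \<open>The Fourier transform of the distribution \<open>S\<close>, defined by duality, is the function \<open>F\<close>.
  Such an \<open>F\<close> is unique up to null sets.\<close>

definition is_fourier :: "((R3 \<Rightarrow> complex) \<Rightarrow> complex) \<Rightarrow> (R3 \<Rightarrow> complex) \<Rightarrow> bool" where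
  "is_fourier S F \<longleftrightarrow>
     temperate_function F \<and> (\<forall>\<phi>. schwartz \<phi> \<longrightarrow> S (ft \<phi>) = distribution_of F \<phi>)"

definition has_fourier :: "((R3 \<Rightarrow> complex) \<Rightarrow> complex) \<Rightarrow> bool" where
  "has_fourier S \<longleftrightarrow> (\<exists>F. is_fourier S F)"

definition fourier :: "((R3 \<Rightarrow> complex) \<Rightarrow> complex) \<Rightarrow> R3 \<Rightarrow> complex" where
  "fourier S = (SOME F. is_fourier S F)"

section \<open>Fourier multipliers\<close>

text \<open>\<open>\<Lambda>S\<close> is the distribution with Fourier transform \<open>|\<xi>| \<cdot> fourier S\<close>, for \<open>S\<close> whose Fourier
  transform is a function.\<close>

definition dist_Lambda :: "((R3 \<Rightarrow> complex) \<Rightarrow> complex ^ 3) \<Rightarrow> (R3 \<Rightarrow> complex) \<Rightarrow> complex ^ 3" where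
  "dist_Lambda S \<phi> =
     (\<chi> i. distribution_of (\<lambda>\<xi>. norm \<xi> * fourier (component i S) \<xi>) (inv_ft \<phi>))"

text \<open>\<open>g = m(D) f\<close> as tempered functions. The functional version \<open>multiplier\<close> picks the
  continuous representative, which is unique if it exists.\<close>

definition is_multiplier :: "(R3 \<Rightarrow> complex) \<Rightarrow> (R3 \<Rightarrow> complex) \<Rightarrow> (R3 \<Rightarrow> complex) \<Rightarrow> bool" where
  "is_multiplier m f g \<longleftrightarrow>
     temperate_function f \<and> has_fourier (distribution_of f) \<and> temperate_function g \<and>
     is_fourier (distribution_of g) (\<lambda>\<xi>. m \<xi> * fourier (distribution_of f) \<xi>)"

definition multiplier :: "(R3 \<Rightarrow> complex) \<Rightarrow> (R3 \<Rightarrow> complex) \<Rightarrow> R3 \<Rightarrow> complex" where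
  "multiplier m f = (THE g. continuous_on UNIV g \<and> is_multiplier m f g)"

text \<open>Convolution of a function with a distribution whose Fourier transform is a function.\<close>

definition is_conv ::
    "(R3 \<Rightarrow> complex) \<Rightarrow> ((R3 \<Rightarrow> complex) \<Rightarrow> complex) \<Rightarrow> (R3 \<Rightarrow> complex) \<Rightarrow> bool" where
  "is_conv f S g \<longleftrightarrow> has_fourier S \<and> is_multiplier (fourier S) f g"

definition conv :: "(R3 \<Rightarrow> complex) \<Rightarrow> ((R3 \<Rightarrow> complex) \<Rightarrow> complex) \<Rightarrow> R3 \<Rightarrow> complex" where
  "conv f S = multiplier (fourier S) f"

definition vconv ::
    "(R3 \<Rightarrow> complex) \<Rightarrow> ((R3 \<Rightarrow> complex) \<Rightarrow> complex ^ 3) \<Rightarrow> R3 \<Rightarrow> complex ^ 3" where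
  "vconv f S x = (\<chi> i. conv f (component i S) x)"

text \<open>The multiplier \<open>1 / |\<xi>|\<close> takes the value 0 at the origin, a null set.\<close>

definition Lambda_inv :: "(R3 \<Rightarrow> complex ^ 3) \<Rightarrow> R3 \<Rightarrow> complex ^ 3" where
  "Lambda_inv w x = (\<chi> i. multiplier (\<lambda>\<xi>. 1 / norm \<xi>) (component i w) x)"

section \<open>Sobolev spaces\<close>

definition sobolev :: "real \<Rightarrow> (R3 \<Rightarrow> complex) \<Rightarrow> bool" where
  "sobolev s f \<longleftrightarrow>
     temperate_function f \<and> has_fourier (distribution_of f) \<and>
     integrable lborel
       (\<lambda>\<xi>. (1 + (norm \<xi>)\<^sup>2) powr s * (norm (fourier (distribution_of f) \<xi>))\<^sup>2)"

definition sobolev_norm :: "real \<Rightarrow> (R3 \<Rightarrow> complex) \<Rightarrow> real" where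
  "sobolev_norm s f = sqrt
     (LINT \<xi>|lborel. (1 + (norm \<xi>)\<^sup>2) powr s * (norm (fourier (distribution_of f) \<xi>))\<^sup>2)"

definition continuous_in_sobolev :: "real \<Rightarrow> real \<Rightarrow> (real \<Rightarrow> R3 \<Rightarrow> complex) \<Rightarrow> bool" where
  "continuous_in_sobolev T s f \<longleftrightarrow>
     (\<forall>t\<in>{0..<T}. sobolev s (f t) \<and>
        ((\<lambda>\<tau>. sobolev_norm s (\<lambda>x. f \<tau> x - f t x)) \<longlongrightarrow> 0) (at t within {0..<T}))"

section \<open>Smooth solutions of the Navier--Stokes equations on \<open>[0,T)\<close>\<close>

text \<open>Time derivatives are one-sided at \<open>t = 0\<close>.\<close>

definition time_deriv :: "real \<Rightarrow> (real \<Rightarrow> R3 \<Rightarrow> 'b::real_normed_vector) \<Rightarrow> real \<Rightarrow> R3 \<Rightarrow> 'b" where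
  "time_deriv T f t x = vector_derivative (\<lambda>\<tau>. f \<tau> x) (at t within {0..<T})"

text \<open>Iterated space-time derivatives: \<open>None\<close> is \<open>\<partial>\<^sub>t\<close> and \<open>Some j\<close> is \<open>\<partial>\<^sub>j\<close>.\<close>

primrec st_deriv ::
    "real \<Rightarrow> 3 option list \<Rightarrow> (real \<Rightarrow> R3 \<Rightarrow> 'b::real_normed_vector) \<Rightarrow> real \<Rightarrow> R3 \<Rightarrow> 'b" where
  "st_deriv T [] f = f"
| "st_deriv T (d # ds) f =
     (case d of None \<Rightarrow> time_deriv T (st_deriv T ds f)
              | Some j \<Rightarrow> (\<lambda>t. pd j (st_deriv T ds f t)))"

definition smooth_spacetime :: "real \<Rightarrow> (real \<Rightarrow> R3 \<Rightarrow> 'b::real_normed_vector) \<Rightarrow> bool" where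
  "smooth_spacetime T f \<longleftrightarrow>
     (\<forall>ds. continuous_on ({0..<T} \<times> UNIV) (\<lambda>(t, x). st_deriv T ds f t x) \<and>
        (\<forall>t\<in>{0..<T}. \<forall>x.
           (\<lambda>\<tau>. st_deriv T ds f \<tau> x) differentiable (at t within {0..<T}) \<and>
           st_deriv T ds f t differentiable (at x)))"

definition complexify :: "(R3 \<Rightarrow> R3) \<Rightarrow> R3 \<Rightarrow> complex ^ 3" where
  "complexify w x = (\<chi> i. complex_of_real (w x $ i))"

text \<open>For the pressure only \<open>\<nabla>p(t,\<cdot>)\<close> has to exist: by the equation it is as smooth as \<open>u\<close>.\<close>

definition smooth_NS_solution ::
    "real \<Rightarrow> real \<Rightarrow> (real \<Rightarrow> R3 \<Rightarrow> R3) \<Rightarrow> (real \<Rightarrow> R3 \<Rightarrow> real) \<Rightarrow> bool" where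
  "smooth_NS_solution \<nu> T u p \<longleftrightarrow>
     smooth_spacetime T u \<and>
     (\<forall>s\<ge>0. \<forall>i. continuous_in_sobolev T s (\<lambda>t. component i (complexify (u t)))) \<and>
     (\<forall>t\<in>{0..<T}. \<forall>x.
        p t differentiable (at x) \<and>
        time_deriv T u t x + (\<Sum>j\<in>UNIV. (u t x $ j) *\<^sub>R pd j (u t) x) + grad (p t) x
          = \<nu> *\<^sub>R laplacian (u t) x \<and>
        (\<Sum>j\<in>UNIV. pd j (u t) x $ j) = 0)"

definition u_plus :: "(R3 \<Rightarrow> R3) \<Rightarrow> R3 \<Rightarrow> complex ^ 3" where
  "u_plus w x = (1 / 2) *\<^sub>R (complexify w x + Lambda_inv (curl (complexify w)) x)"

definition u_minus :: "(R3 \<Rightarrow> R3) \<Rightarrow> R3 \<Rightarrow> complex ^ 3" where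
  "u_minus w x = (1 / 2) *\<^sub>R (complexify w x - Lambda_inv (curl (complexify w)) x)"

end

theory Submission
  imports "HOL-Probability.Characteristic_Functions" "HOL-Probability.Sinc_Integral" Defs
begin

text \<open>Write \<open>H\<close>, \<open>U\<close> and \<open>Y\<close> for the Fourier transforms of \<open>h\<close>, \<open>u\<close> and \<open>v\<close>. The hypotheses on \<open>h\<close> say that
  almost everywhere \<open>\<xi> \<cdot> H = 0\<close>, \<open>i \<xi> \<times> H = |\<xi>| H\<close>, \<open>H(-\<xi>) = cnj H(\<xi>)\<close> and \<open>|H| = 1\<close> (\<open>symbol_exists\<close>).
  Since \<open>i \<xi> \<times>\<close> is self-adjoint, taking the inner product of \<open>U\<^sub>+ = Y H\<close> with \<open>H\<close> yields
  \<open>Y = cnj H \<cdot> U\<close> (\<open>profile_fourier\<close>), so \<open>v\<close> inherits the regularity of \<open>u\<close>. Self-duality gives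
  \<open>U = Y H - Y(-\<xi>) H(-\<xi>)\<close>, and multiplication of the two helical parts by \<open>\<plusminus>|\<xi>|\<close> turns this into
  the transform of \<open>curl u\<close>. Hence the two factors of the cross product in the claim are \<open>u\<close> and \<open>curl u\<close>,
  and convolution with \<open>h\<^sup>r\<close> followed by summation is the inner product with \<open>H\<close>.

  In the form \<open>u\<^sub>t + \<nabla>q = \<nu> \<Delta>u + u \<times> curl u\<close> with \<open>q = p + |u|\<^sup>2 / 2\<close>, the inner product with \<open>H\<close> removes \<open>\<nabla>q\<close>, because
  \<open>\<xi> \<cdot> cnj H = 0\<close>, and what remains is the claim. Two points need an argument, because the solution is
  smooth only pointwise and continuous in time with values in Sobolev spaces. First, \<open>\<nabla>q(t)\<close> may grow at
  infinity, so it has no Fourier transform to begin with. But its integral over a time interval is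
  the difference of bounded functions, and a bounded gradient of a function of at most linear growth is
  weakly curl free (\<open>gradient_time_integral\<close>, \<open>weak_curl_free\<close>). Second, \<open>H\<close> is only measurable, whereas the
  weak identity so obtained involves Schwartz functions of the frequency; it is extended to bounded
  measurable symbols by a monotone class argument (\<open>functional_eq_0\<close>, \<open>defect_div_free\<close>). The result is that
  \<open>\<Sum>\<^sub>k \<integral> m\<^sub>k U\<^sub>k(t) d\<xi>\<close> is differentiable in \<open>t\<close> for bounded divergence free symbols \<open>m\<close> (\<open>evolution\<close>), and
  \<open>m\<^sub>k = e\<^sup>i\<^sup>x\<^sup>\<xi> cnj H\<^sub>k\<close> gives the time derivative of \<open>v(t,x)\<close>.

  Everything takes place in the algebra of functions with integrable Fourier transform: the Sobolev
  bounds make \<open>(1 + |\<xi>|)\<^sup>2 U(t)\<close> a continuous curve in \<open>L\<^sup>1\<close> (\<open>sobolev_L1_cont\<close>), and such functions are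
  recovered pointwise by the inversion integral, which follows from the inversion formula for
  Schwartz functions by duality (\<open>inv_ft_ft\<close>, \<open>is_fourier_inv_ft\<close>, \<open>inv_ft_unique\<close>).\<close>

section \<open>Affine changes of variables\<close>

lemma
  fixes f :: "'a::euclidean_space \<Rightarrow> 'b::{banach, second_countable_topology}"
  assumes c: "c \<noteq> 0" and f [measurable]: "f \<in> borel_measurable borel"
  shows integrable_affine_iff: "integrable lborel (\<lambda>x. f (t + c *\<^sub>R x)) \<longleftrightarrow> integrable lborel f"
    and integral_affine: "\<bar>c\<bar> ^ DIM('a) *\<^sub>R (LINT x|lborel. f (t + c *\<^sub>R x)) = (LINT x|lborel. f x)"
proof -
  let ?D = "distr lborel borel (\<lambda>x::'a. t + c *\<^sub>R x)"
  have L: "lborel = density ?D (\<lambda>_. ennreal (\<bar>c\<bar> ^ DIM('a)))"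
    using lborel_affine[OF c, of t] by (simp add: ennreal_power)
  have "integrable lborel f \<longleftrightarrow> integrable ?D (\<lambda>x. \<bar>c\<bar> ^ DIM('a) *\<^sub>R f x)"
    by (subst L, subst integrable_density) auto
  also have "\<dots> \<longleftrightarrow> integrable ?D f"   proof
    assume "integrable ?D (\<lambda>x. \<bar>c\<bar> ^ DIM('a) *\<^sub>R f x)"
    then have "integrable ?D (\<lambda>x. inverse (\<bar>c\<bar> ^ DIM('a)) *\<^sub>R (\<bar>c\<bar> ^ DIM('a) *\<^sub>R f x))"
      by (rule integrable_scaleR_right)
    then show "integrable ?D f" using c by simp
  qed simp
  also have "\<dots> \<longleftrightarrow> integrable lborel (\<lambda>x. f (t + c *\<^sub>R x))"
    by (rule integrable_distr_eq) auto
  finally show "integrable lborel (\<lambda>x. f (t + c *\<^sub>R x)) \<longleftrightarrow> integrable lborel f" by simp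
  have "(LINT x|lborel. f x) = (LINT x|?D. \<bar>c\<bar> ^ DIM('a) *\<^sub>R f x)"
    by (subst (1) L, subst integral_density) auto
  also have "\<dots> = \<bar>c\<bar> ^ DIM('a) *\<^sub>R (LINT x|?D. f x)" by simp
  also have "(LINT x|?D. f x) = (LINT x|lborel. f (t + c *\<^sub>R x))"
    by (rule integral_distr) auto
  finally show "\<bar>c\<bar> ^ DIM('a) *\<^sub>R (LINT x|lborel. f (t + c *\<^sub>R x)) = (LINT x|lborel. f x)" by simp
qed

lemma
  fixes f :: "'a::euclidean_space \<Rightarrow> 'b::{banach, second_countable_topology}"
  assumes f: "f \<in> borel_measurable borel"
  shows integrable_shift_iff: "integrable lborel (\<lambda>x. f (x + t)) \<longleftrightarrow> integrable lborel f"
    and integral_shift: "(LINT x|lborel. f (x + t)) = (LINT x|lborel. f x)"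
    and integrable_refl_iff: "integrable lborel (\<lambda>x. f (- x)) \<longleftrightarrow> integrable lborel f"
    and integral_refl: "(LINT x|lborel. f (- x)) = (LINT x|lborel. f x)"
  using integrable_affine_iff[of 1 f t] integral_affine[of 1 f t]
    integrable_affine_iff[of "-1" f 0] integral_affine[of "-1" f 0] f
  by (simp_all add: add.commute)

lemma AE_refl:
  fixes P :: "'a::euclidean_space \<Rightarrow> bool"
  assumes "AE x in lborel. P x"
  shows "AE x in lborel. P (- x)"
proof -
  obtain N where N: "N \<in> null_sets lborel" "{x. \<not> P x} \<subseteq> N"
    using assms by (auto simp: eventually_ae_filter)
  have 1: "distr lborel borel (\<lambda>x::'a. - x) = lborel"
    using lborel_affine[of "-1" "0::'a"] by (simp add: density_1)
  have "AE x in distr lborel borel (\<lambda>x::'a. - x). x \<notin> N"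
    unfolding 1 using N by (simp add: AE_not_in)
  then have "AE x in lborel. - x \<notin> N"
    by (subst (asm) AE_distr_iff) (use N in \<open>auto dest!: null_setsD2\<close>)
  then show ?thesis using N(2) by (auto elim!: eventually_mono)
qed

section \<open>Decay weights\<close>

lemma
  fixes f :: "'a::euclidean_space \<Rightarrow> real \<Rightarrow> 'b::{real_normed_field,banach,second_countable_topology}"
  assumes "\<And>b. b \<in> Basis \<Longrightarrow> integrable lborel (f b)"
  shows integrable_prod_Basis: "integrable lborel (\<lambda>x::'a. \<Prod>b\<in>Basis. f b (x \<bullet> b))"
    and integral_prod_Basis: "(LINT x|lborel. (\<Prod>b\<in>Basis. f b (x \<bullet> b))) = (\<Prod>b\<in>Basis. LINT r|lborel. f b r)"
proof -
  interpret product_sigma_finite "\<lambda>_::'a. lborel::real measure" ..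
  let ?P = "\<Pi>\<^sub>M b\<in>(Basis::'a set). (lborel::real measure)"
  have L: "(lborel :: 'a measure) = distr ?P borel (\<lambda>g. \<Sum>b\<in>Basis. g b *\<^sub>R b)"
    by (rule lborel_eq)
  have [measurable]: "f b \<in> borel_measurable borel" if "b \<in> Basis" for b
    using borel_measurable_integrable[OF assms[OF that]] by simp
  have m [measurable]: "(\<lambda>x::'a. \<Prod>b\<in>Basis. f b (x \<bullet> b)) \<in> borel_measurable borel"
    by measurable
  have m2 [measurable]: "(\<lambda>g. \<Sum>b\<in>Basis. g b *\<^sub>R b) \<in> ?P \<rightarrow>\<^sub>M (borel :: 'a measure)"
    by measurable
  have e: "(\<Prod>b\<in>Basis. f b ((\<Sum>b\<in>Basis. g b *\<^sub>R b) \<bullet> b)) = (\<Prod>b\<in>Basis. f b (g b))" for g :: "'a \<Rightarrow> real"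
    by (intro prod.cong refl) (simp add: inner_sum_left_Basis)
  have i: "integrable ?P (\<lambda>g. \<Prod>b\<in>Basis. f b (g b))"
    by (rule product_integrable_prod) (auto intro: assms)
  show "integrable lborel (\<lambda>x::'a. \<Prod>b\<in>Basis. f b (x \<bullet> b))"
    unfolding L by (subst integrable_distr_eq[OF m2 m]) (simp add: e i)
  show "(LINT x|lborel. (\<Prod>b\<in>Basis. f b (x \<bullet> b))) = (\<Prod>b\<in>Basis. LINT r|lborel. f b r)"
    unfolding L by (subst integral_distr[OF m2 m]) (simp add: e product_integral_prod assms)
qed

lemma integrable_weight: "integrable lborel (\<lambda>x::R3. 1 / (1 + (norm x)\<^sup>2) ^ 3)"
proof -
  have "integrable lborel (\<lambda>x::real. inverse (1 + x^2))"
    using integrable_inverse_1_plus_square by (simp add: set_integrable_def)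
  then have *: "integrable lborel (\<lambda>x::R3. \<Prod>b\<in>Basis. inverse (1 + (x \<bullet> b)^2))"
    by (rule integrable_prod_Basis)
  show ?thesis
  proof (rule Bochner_Integration.integrable_bound[OF *])
    show "AE x in lborel. norm (1 / (1 + (norm (x::R3))\<^sup>2) ^ 3) \<le> norm (\<Prod>b\<in>Basis. inverse (1 + (x \<bullet> b)^2))"
    proof (intro AE_I2)
      fix x :: R3
      have "(\<Prod>b\<in>(Basis::R3 set). inverse (1 + (norm x)^2)) \<le> (\<Prod>b\<in>Basis. inverse (1 + (x \<bullet> b)^2))"
      proof (intro prod_mono conjI le_imp_inverse_le)
        fix b :: R3 assume "b \<in> Basis"
        then have "\<bar>x \<bullet> b\<bar> \<le> norm x" by (rule Basis_le_norm)
        then have "(x \<bullet> b)\<^sup>2 \<le> (norm x)\<^sup>2" by (metis abs_norm_cancel abs_le_square_iff)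
        then show "1 + (x \<bullet> b)\<^sup>2 \<le> 1 + (norm x)^2" by simp
      qed (auto simp: add_pos_nonneg)
      then show "norm (1 / (1 + (norm (x::R3))\<^sup>2) ^ 3) \<le> norm (\<Prod>b\<in>Basis. inverse (1 + (x \<bullet> b)^2))"
        by (simp add: inverse_eq_divide power_divide abs_of_nonneg add_nonneg_nonneg power_one_over)
    qed
  qed simp
qed

lemma pos_1_norm: "0 < 1 + norm x"
  by (simp add: add_pos_nonneg)

lemma weight_le: "1 + (norm x)\<^sup>2 \<le> (1 + norm x)\<^sup>2" "(1 + norm x)\<^sup>2 \<le> 2 * (1 + (norm x)\<^sup>2)"
proof -
  show "1 + (norm x)\<^sup>2 \<le> (1 + norm x)\<^sup>2" by (simp add: power2_sum)
  have "0 \<le> (1 - norm x)\<^sup>2" by simp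
  then show "(1 + norm x)\<^sup>2 \<le> 2 * (1 + (norm x)\<^sup>2)" by (simp add: power2_sum power2_diff)
qed

lemma integrable_weight_norm: "integrable lborel (\<lambda>x::R3. 1 / (1 + norm x) ^ 6)"
proof (rule Bochner_Integration.integrable_bound[OF integrable_weight])
  show "AE x in lborel. norm (1 / (1 + norm (x::R3)) ^ 6) \<le> norm (1 / (1 + (norm x)\<^sup>2) ^ 3)"
  proof (intro AE_I2)
    fix x :: R3
    have "(1 + (norm x)\<^sup>2) ^ 3 \<le> ((1 + norm x)\<^sup>2) ^ 3"
      by (intro power_mono weight_le) simp
    also have "\<dots> = (1 + norm x) ^ 6" by (simp flip: power_mult)
    finally have "1 / (1 + norm x) ^ 6 \<le> 1 / (1 + (norm x)\<^sup>2) ^ 3"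
      by (intro divide_left_mono mult_pos_pos zero_less_power) (auto simp: add_pos_nonneg)
    then show "norm (1 / (1 + norm (x::R3)) ^ 6) \<le> norm (1 / (1 + (norm x)\<^sup>2) ^ 3)" by (simp add: abs_of_nonneg add_nonneg_nonneg)
  qed
qed simp

lemma integrable_decay:
  fixes f :: "R3 \<Rightarrow> 'b::{banach, second_countable_topology}"
  assumes "f \<in> borel_measurable borel" "\<And>x. (1 + norm x) ^ 6 * norm (f x) \<le> B"
  shows "integrable lborel f"
proof (rule Bochner_Integration.integrable_bound)
  show "integrable lborel (\<lambda>x::R3. B * (1 / (1 + norm x) ^ 6))"
    using integrable_weight_norm by (rule integrable_mult_right)
  show "AE x in lborel. norm (f x) \<le> norm (B * (1 / (1 + norm x) ^ 6))"
  proof (intro AE_I2)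
    fix x :: R3
    have "norm (f x) \<le> B / (1 + norm x) ^ 6"
      using assms(2)[of x] pos_1_norm[of x] by (subst pos_le_divide_eq) (simp_all add: mult.commute)
    also have "\<dots> \<le> norm (B * (1 / (1 + norm x) ^ 6))" using abs_ge_self[of "B * (1 / (1 + norm x) ^ 6)"] by simp
    finally show "norm (f x) \<le> norm (B * (1 / (1 + norm x) ^ 6))" .
  qed
qed (use assms in simp)

section \<open>Partial derivatives\<close>

lemma pd_eqI:
  assumes "((\<lambda>s. f (x + s *\<^sub>R axis j 1)) has_vector_derivative D) (at 0)"
  shows "pd j f x = D"
  unfolding pd_def using assms by (rule vector_derivative_at)

lemma has_derivative_line:
  assumes "(f has_derivative f') (at (x + s *\<^sub>R d))"
  shows "((\<lambda>s. f (x + s *\<^sub>R d)) has_vector_derivative f' d) (at s)"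
proof -
  interpret bounded_linear f' using assms by (rule has_derivative_bounded_linear)
  have "((\<lambda>s. f (x + s *\<^sub>R d)) has_derivative (\<lambda>r. f' (r *\<^sub>R d))) (at s)"
    by (rule has_derivative_compose[where g = f and f = "\<lambda>s. x + s *\<^sub>R d", OF _ assms]) (auto intro!: derivative_eq_intros)
  then show ?thesis by (simp add: has_vector_derivative_def scaleR)
qed

lemma pd_of_has_derivative:
  assumes "(f has_derivative f') (at x)"
  shows "pd j f x = f' (axis j 1)"
  by (rule pd_eqI, rule has_derivative_line) (simp add: assms)

lemma pd_line:
  assumes "f differentiable (at (x + s *\<^sub>R axis j 1))"
  shows "((\<lambda>s. f (x + s *\<^sub>R axis j 1)) has_vector_derivative pd j f (x + s *\<^sub>R axis j 1)) (at s)"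
proof -
  obtain f' where f': "(f has_derivative f') (at (x + s *\<^sub>R axis j 1))"
    using assms by (auto simp: differentiable_def)
  show ?thesis unfolding pd_of_has_derivative[OF f'] using f' by (rule has_derivative_line)
qed

lemma pd_at0:
  assumes "f differentiable (at x)"
  shows "((\<lambda>s. f (x + s *\<^sub>R axis j 1)) has_vector_derivative pd j f x) (at 0)"
  using pd_line[of f x 0 j] assms by simp

lemma pd_add:
  assumes "f differentiable (at x)" "g differentiable (at x)"
  shows "pd j (\<lambda>x. f x + g x) x = pd j f x + pd j g x"
  by (rule pd_eqI) (intro has_vector_derivative_add pd_at0 assms)

lemma pd_mult:
  fixes f g :: "R3 \<Rightarrow> 'a::real_normed_algebra"
  assumes "f differentiable (at x)" "g differentiable (at x)"
  shows "pd j (\<lambda>x. f x * g x) x = f x * pd j g x + pd j f x * g x"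
  by (rule pd_eqI) (rule has_vector_derivative_eq_rhs[OF has_vector_derivative_mult[OF pd_at0 pd_at0]],
      use assms in auto)

lemma pd_const: "pd j (\<lambda>x. c) x = 0"
  by (rule pd_eqI) simp

lemma pd_linear:
  assumes "bounded_linear L" "f differentiable (at x)"
  shows "pd j (\<lambda>x. L (f x)) x = L (pd j f x)"
  by (rule pd_eqI) (rule bounded_linear.has_vector_derivative[OF assms(1) pd_at0[OF assms(2)]])

lemma pd_coord: "pd j (\<lambda>x. of_real (x $ k)) x = (of_bool (j = k) :: 'a::real_normed_algebra_1)"
proof (rule pd_eqI)
  have "((\<lambda>s. of_real ((x + s *\<^sub>R axis j 1) $ k)) has_vector_derivative of_real (axis j 1 $ k)) (at 0)"
    by (rule has_derivative_line, rule has_derivative_of_real) (auto intro!: bounded_linear_imp_has_derivative bounded_linear_vec_nth)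
  moreover have "of_real (axis j 1 $ k) = (of_bool (j = k) :: 'a)" by (simp add: axis_def)
  ultimately show "((\<lambda>s. of_real ((x + s *\<^sub>R axis j 1) $ k)) has_vector_derivative (of_bool (j = k) :: 'a)) (at 0)"
    by metis
qed

lemma differentiable_coord [simp]: "(\<lambda>x::R3. (of_real (x $ k)::'a::real_normed_algebra_1)) differentiable (at x)"
proof -
  have "((\<lambda>x::R3. (of_real (x $ k)::'a)) has_derivative (\<lambda>x. of_real (x $ k))) (at x)"
    by (rule has_derivative_of_real) (auto intro!: bounded_linear_imp_has_derivative bounded_linear_vec_nth)
  then show ?thesis by (auto simp: differentiable_def)
qed

section \<open>Schwartz functions\<close>

lemma pds_Nil [simp]: "pds [] f = f" and pds_Cons: "pds (j # js) f = pd j (pds js f)"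
  and pds_snoc: "pds (js @ [j]) f = pds js (pd j f)"
  by (simp_all add: pds_def)

lemma schwartz_differentiable: "schwartz \<phi> \<Longrightarrow> \<phi> differentiable (at x)"
  by (metis pds_Nil schwartz_def)

lemma schwartz_pd: "schwartz \<phi> \<Longrightarrow> schwartz (pd j \<phi>)"
  unfolding schwartz_def pds_snoc[symmetric] by blast

lemma schwartz_decay:
  assumes "schwartz \<phi>"
  obtains B where "\<And>x. (1 + norm x) ^ N * norm (\<phi> x) \<le> B"
proof -
  have "bounded (range (\<lambda>x. (1 + norm x) ^ N *\<^sub>R pds [] \<phi> x))" using assms unfolding schwartz_def by blast
  then obtain B where "\<And>x. norm ((1 + norm x) ^ N *\<^sub>R \<phi> x) \<le> B" by (auto simp: bounded_iff)
  then show ?thesis using that[of B] by (auto simp: add_nonneg_nonneg)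
qed

lemma schwartz_continuous: "schwartz \<phi> \<Longrightarrow> continuous_on UNIV \<phi>"
  by (meson continuous_at_imp_continuous_on differentiable_imp_continuous_within schwartz_differentiable)

lemma schwartz_measurable: "schwartz \<phi> \<Longrightarrow> \<phi> \<in> borel_measurable borel"
  by (rule borel_measurable_continuous_onI) (rule schwartz_continuous)

lemma schwartz_bounded:
  assumes "schwartz \<phi>"
  obtains B where "\<And>x. norm (\<phi> x) \<le> B"
  using schwartz_decay[OF assms, of 0] by auto

lemma schwartz_integrable: "schwartz \<phi> \<Longrightarrow> integrable lborel \<phi>"
  by (rule schwartz_decay[of \<phi> 6], assumption, rule integrable_decay) (auto intro: schwartz_measurable)

text \<open>Iterated derivatives of a concrete function are rarely explicit; it suffices to exhibit a class of
  rapidly decreasing functions that contains it and is closed under single partial derivatives.\<close>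

lemma schwartz_coinduct:
  assumes "P \<phi>"
    and diff: "\<And>\<psi> x. P \<psi> \<Longrightarrow> \<psi> differentiable (at x)"
    and decay: "\<And>\<psi> N. P \<psi> \<Longrightarrow> \<exists>B. \<forall>x. (1 + norm x) ^ N * norm (\<psi> x) \<le> B"
    and pd: "\<And>\<psi> j. P \<psi> \<Longrightarrow> P (pd j \<psi>)"
  shows "schwartz \<phi>"
proof -
  have P: "P (pds js \<phi>)" for js
    by (induction js) (auto simp: pds_Cons assms)
  show ?thesis
    unfolding schwartz_def bounded_iff
  proof (intro conjI allI)
    fix js N
    obtain B where "\<forall>x. (1 + norm x) ^ N * norm (pds js \<phi> x) \<le> B" using decay[OF P] by blast
    then show "\<exists>a. \<forall>x\<in>range (\<lambda>x. (1 + norm x) ^ N *\<^sub>R pds js \<phi> x). norm x \<le> a"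
      by (intro exI[of _ B]) auto
  qed (use diff P in auto)
qed

text \<open>The partial derivatives leave this closure of the Schwartz class invariant, so by
  \<open>schwartz_coinduct\<close> it adds nothing (\<open>schw_iff\<close>). All closure properties follow at once.\<close>

inductive schw :: "(R3 \<Rightarrow> complex) \<Rightarrow> bool" where
  base: "schwartz \<phi> \<Longrightarrow> schw \<phi>"
| add: "schw \<phi> \<Longrightarrow> schw \<psi> \<Longrightarrow> schw (\<lambda>x. \<phi> x + \<psi> x)"
| cmult: "schw \<phi> \<Longrightarrow> schw (\<lambda>x. c * \<phi> x)"
| coord: "schw \<phi> \<Longrightarrow> schw (\<lambda>x. of_real (x $ k) * \<phi> x)"
| reflect: "schw \<phi> \<Longrightarrow> schw (\<lambda>x. \<phi> (- x))"
| cnj: "schw \<phi> \<Longrightarrow> schw (\<lambda>x. cnj (\<phi> x))"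

lemma schw_differentiable: "schw \<phi> \<Longrightarrow> \<phi> differentiable (at x)"
proof (induction arbitrary: x rule: schw.induct)
  case (reflect \<phi>)
  have "(\<phi> \<circ> uminus) differentiable (at x)"
    by (rule differentiable_chain_at) (auto intro!: derivative_intros reflect.IH)
  then show ?case by (simp add: o_def)
next
  case (cnj \<phi>)
  have "(cnj \<circ> \<phi>) differentiable (at x)"
    by (rule differentiable_chain_at) (auto intro!: cnj.IH bounded_linear_imp_differentiable bounded_linear_cnj)
  then show ?case by (simp add: o_def)
qed (auto intro: schwartz_differentiable)

lemma pd_refl:
  assumes "f differentiable (at (- x))"
  shows "pd j (\<lambda>x. f (- x)) x = - pd j f (- x)"
proof -
  obtain f' where f': "(f has_derivative f') (at (- x))" using assms by (auto simp: differentiable_def)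
  have "((\<lambda>x. f (- x)) has_derivative (\<lambda>d. f' (- d))) (at x)"
    by (rule has_derivative_compose[where g = f and f = uminus, OF _ f']) (auto intro!: derivative_eq_intros)
  moreover have "f' (- axis j 1) = - f' (axis j 1)"
    by (rule linear_neg[OF has_derivative_linear[OF f']])
  ultimately show ?thesis by (simp add: pd_of_has_derivative[OF f'] pd_of_has_derivative)
qed

lemma schw_pd: "schw \<phi> \<Longrightarrow> schw (pd j \<phi>)"
proof (induction rule: schw.induct)
  case (base \<phi>)
  then show ?case by (intro schw.base schwartz_pd)
next
  case (add \<phi> \<psi>)
  then have "pd j (\<lambda>x. \<phi> x + \<psi> x) = (\<lambda>x. pd j \<phi> x + pd j \<psi> x)"
    by (intro ext pd_add schw_differentiable)
  then show ?case by (simp add: schw.add add)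
next
  case (cmult \<phi> c)
  then have "pd j (\<lambda>x. c * \<phi> x) = (\<lambda>x. c * pd j \<phi> x)"
    by (intro ext) (simp add: pd_mult pd_const schw_differentiable)
  then show ?case by (simp add: schw.cmult cmult)
next
  case (coord \<phi> k)
  then have "pd j (\<lambda>x. of_real (x $ k) * \<phi> x) = (\<lambda>x. of_real (x $ k) * pd j \<phi> x + of_bool (j = k) * \<phi> x)"
    by (intro ext) (simp add: pd_mult pd_coord schw_differentiable)
  then show ?case by (simp only:) (intro schw.intros(2-) coord)
next
  case (reflect \<phi>)
  then have "pd j (\<lambda>x. \<phi> (- x)) = (\<lambda>x. (-1) * pd j \<phi> (- x))"
    by (intro ext) (simp add: pd_refl schw_differentiable)
  moreover have "schw (\<lambda>x. (-1) * pd j \<phi> (- x))"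
    using schw.cmult[of "\<lambda>x. pd j \<phi> (- x)" "-1"] schw.reflect reflect by blast
  ultimately show ?case by simp
next
  case (cnj \<phi>)
  then have "pd j (\<lambda>x. cnj (\<phi> x)) = (\<lambda>x. cnj (pd j \<phi> x))"
    by (intro ext pd_linear bounded_linear_cnj schw_differentiable)
  then show ?case by (simp add: schw.cnj cnj)
qed

lemma schw_decay: "schw \<phi> \<Longrightarrow> \<exists>B. \<forall>x. (1 + norm x) ^ N * norm (\<phi> x) \<le> B"
proof (induction arbitrary: N rule: schw.induct)
  case (base \<phi>)
  obtain B where "\<And>x. (1 + norm x) ^ N * norm (\<phi> x) \<le> B" by (rule schwartz_decay[OF base, of N]) blast
  then show ?case by blast
next
  case (add \<phi> \<psi>)
  obtain B C where B: "\<And>x. (1 + norm x) ^ N * norm (\<phi> x) \<le> B" and C: "\<And>x. (1 + norm x) ^ N * norm (\<psi> x) \<le> C"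
    using add.IH[of N] by blast
  have "(1 + norm x) ^ N * norm (\<phi> x + \<psi> x) \<le> B + C" for x
  proof -
    have "(1 + norm x) ^ N * norm (\<phi> x + \<psi> x) \<le> (1 + norm x) ^ N * (norm (\<phi> x) + norm (\<psi> x))"
      by (intro mult_left_mono norm_triangle_ineq) (simp add: add_nonneg_nonneg)
    then show ?thesis using B[of x] C[of x] by (simp add: distrib_left)
  qed
  then show ?case by blast
next
  case (cmult \<phi> c)
  obtain B where B: "\<And>x. (1 + norm x) ^ N * norm (\<phi> x) \<le> B" using cmult.IH[of N] by blast
  have "(1 + norm x) ^ N * norm (c * \<phi> x) \<le> norm c * B" for x
    using mult_left_mono[OF B[of x], of "norm c"] by (simp add: norm_mult mult_ac)
  then show ?case by blast
next
  case (coord \<phi> k)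
  obtain B where B: "\<And>x. (1 + norm x) ^ Suc N * norm (\<phi> x) \<le> B" using coord.IH[of "Suc N"] by blast
  have "(1 + norm x) ^ N * norm (of_real (x $ k) * \<phi> x) \<le> B" for x
  proof -
    have "\<bar>x $ k\<bar> \<le> 1 + norm x" using component_le_norm_cart[of x k] by simp
    then have "(1 + norm x) ^ N * norm (\<phi> x) * \<bar>x $ k\<bar> \<le> (1 + norm x) ^ N * norm (\<phi> x) * (1 + norm x)"
      by (intro mult_left_mono) (auto simp: add_nonneg_nonneg)
    then show ?thesis using B[of x] by (simp add: norm_mult mult_ac)
  qed
  then show ?case by blast
next
  case (reflect \<phi>)
  obtain B where B: "\<And>x. (1 + norm x) ^ N * norm (\<phi> x) \<le> B" using reflect.IH[of N] by blast
  have "(1 + norm x) ^ N * norm (\<phi> (- x)) \<le> B" for x using B[of "- x"] by simp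
  then show ?case by blast
next
  case (cnj \<phi>)
  then show ?case by simp
qed

lemma schw_iff: "schw \<phi> \<longleftrightarrow> schwartz \<phi>"
proof
  show "schw \<phi> \<Longrightarrow> schwartz \<phi>"
    by (rule schwartz_coinduct[of schw]) (auto intro: schw_differentiable schw_decay schw_pd)
qed (rule schw.base)

lemmas schwartz_add = schw.add[unfolded schw_iff]
  and schwartz_cmult = schw.cmult[unfolded schw_iff]
  and schwartz_coord = schw.coord[unfolded schw_iff]
  and schwartz_refl = schw.reflect[unfolded schw_iff]
  and schwartz_cnj = schw.cnj[unfolded schw_iff]

lemma schwartz_Re:
  assumes "schwartz \<phi>" shows "schwartz (\<lambda>x. of_real (Re (\<phi> x)))"
proof -
  have "schwartz (\<lambda>x. (1/2) * (\<phi> x + cnj (\<phi> x)))" by (intro schwartz_cmult schwartz_add schwartz_cnj assms)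
  then show ?thesis by (simp add: complex_add_cnj)
qed

lemma schwartz_Im:
  assumes "schwartz \<phi>" shows "schwartz (\<lambda>x. of_real (Im (\<phi> x)))"
  using schwartz_Re[OF schwartz_cmult[OF assms, of "- \<i>"]] by simp

section \<open>Integration by parts\<close>

lemma weight_shift:
  fixes x y :: "'a::real_normed_vector"
  assumes "norm y \<le> 1"
  shows "1 + norm x \<le> 2 * (1 + norm (x + y))"
proof -
  have "norm x \<le> norm (x + y) + norm y" using norm_triangle_ineq4[of "x + y" y] by simp
  moreover have "0 \<le> norm (x + y)" by simp
  ultimately show ?thesis using assms by argo
qed

lemma vector_derivative_quotient:
  assumes "(g has_vector_derivative D) (at 0)"
  shows "((\<lambda>s. (g s - g 0) /\<^sub>R s) \<longlongrightarrow> D) (at 0)"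
proof -
  have "((\<lambda>h. norm (g (0 + h) - g 0 - h *\<^sub>R D) / norm h) \<longlongrightarrow> 0) (at 0)"
    using assms unfolding has_vector_derivative_def has_derivative_at by blast
  moreover have "eventually (\<lambda>h. norm (g (0 + h) - g 0 - h *\<^sub>R D) / norm h = norm ((g h - g 0) /\<^sub>R h - D)) (at 0)"
    unfolding eventually_at_filter
  proof (intro always_eventually allI impI)
    fix h :: real assume h: "h \<noteq> 0"
    have "(g h - g 0) /\<^sub>R h - D = (g h - g 0 - h *\<^sub>R D) /\<^sub>R h" using h by (simp add: scaleR_right_diff_distrib)
    then show "norm (g (0 + h) - g 0 - h *\<^sub>R D) / norm h = norm ((g h - g 0) /\<^sub>R h - D)"
      by (simp add: divide_inverse_commute)
  qed
  ultimately have "((\<lambda>h. norm ((g h - g 0) /\<^sub>R h - D)) \<longlongrightarrow> 0) (at 0)"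
    by (rule Lim_transform_eventually)
  then show ?thesis by (simp add: tendsto_norm_zero_iff LIM_zero_iff)
qed

text \<open>The integral of \<open>f(x + s e\<^sub>j)\<close> does not depend on \<open>s\<close>; the decay of \<open>f'\<close> justifies differentiation in \<open>s\<close>.\<close>

lemma integral_deriv_eq_0:
  fixes f f' :: "R3 \<Rightarrow> complex"
  assumes d: "\<And>x s. ((\<lambda>s. f (x + s *\<^sub>R axis j 1)) has_vector_derivative f' (x + s *\<^sub>R axis j 1)) (at s)"
    and m [measurable]: "f \<in> borel_measurable borel"
    and B: "\<And>x. (1 + norm x) ^ 6 * norm (f x) \<le> B"
    and C: "\<And>x. (1 + norm x) ^ 6 * norm (f' x) \<le> C"
  shows "(LINT x|lborel. f' x) = 0"
proof -
  define e :: R3 where "e = axis j 1"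
  define q where "q n x = real (Suc n) *\<^sub>R (f (x + (1 / real (Suc n)) *\<^sub>R e) - f x)" for n x
  have ne: "norm e = 1" by (simp add: e_def)
  have lim: "(\<lambda>n. q n x) \<longlonglongrightarrow> f' x" for x
  proof -
    have "((\<lambda>s. f (x + s *\<^sub>R e)) has_vector_derivative f' x) (at 0)"
      using d[of x 0] by (simp add: e_def)
    then have "((\<lambda>s. (f (x + s *\<^sub>R e) - f x) /\<^sub>R s) \<longlongrightarrow> f' x) (at 0)"
      using vector_derivative_quotient by fastforce
    moreover have "filterlim (\<lambda>n. 1 / real (Suc n)) (at 0) sequentially"
      by (rule filterlim_atI) (auto intro!: LIMSEQ_Suc lim_1_over_n simp del: of_nat_Suc)
    ultimately have "(\<lambda>n. (f (x + (1 / real (Suc n)) *\<^sub>R e) - f x) /\<^sub>R (1 / real (Suc n))) \<longlonglongrightarrow> f' x"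
      by (rule filterlim_compose)
    then show ?thesis by (simp add: q_def del: of_nat_Suc)
  qed
  have m' [measurable]: "f' \<in> borel_measurable borel"
    by (rule borel_measurable_LIMSEQ_metric[of q, OF _ lim]) (unfold q_def, measurable)
  have mq: "q n \<in> borel_measurable borel" for n unfolding q_def by measurable
  have dom: "norm (q n x) \<le> 64 * C * (1 / (1 + norm x) ^ 6)" for n x
  proof -
    define h where "h = 1 / real (Suc n)"
    have h: "0 < h" "h \<le> 1" by (auto simp: h_def)
    have bd: "norm (f' (x + s *\<^sub>R e)) \<le> 64 * C * (1 / (1 + norm x) ^ 6)" if "s \<in> {0..h}" for s
    proof -
      have "1 + norm x \<le> 2 * (1 + norm (x + s *\<^sub>R e))"
        using that h by (intro weight_shift) (simp add: ne)
      then have "(1 + norm x) ^ 6 \<le> (2 * (1 + norm (x + s *\<^sub>R e))) ^ 6"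
        by (intro power_mono) auto
      then have "(1 + norm x) ^ 6 * norm (f' (x + s *\<^sub>R e)) \<le> 64 * ((1 + norm (x + s *\<^sub>R e)) ^ 6 * norm (f' (x + s *\<^sub>R e)))"
        unfolding power_mult_distrib mult.assoc[symmetric] by (intro mult_right_mono) simp_all
      also have "\<dots> \<le> 64 * C" using C by (intro mult_left_mono) auto
      finally have "norm (f' (x + s *\<^sub>R e)) \<le> 64 * C / (1 + norm x) ^ 6"
        using pos_1_norm[of x] by (subst pos_le_divide_eq) (simp_all add: mult.commute)
      then show ?thesis by simp
    qed
    have "norm (f (x + h *\<^sub>R e) - f (x + 0 *\<^sub>R e)) \<le> (64 * C * (1 / (1 + norm x) ^ 6)) * norm (h - 0)"
    proof (rule differentiable_bound[of "{0..h}"])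
      show "((\<lambda>s. f (x + s *\<^sub>R e)) has_derivative (\<lambda>r. r *\<^sub>R f' (x + s *\<^sub>R e))) (at s within {0..h})" for s
        using d[of x s] unfolding e_def[symmetric] has_vector_derivative_def by (rule has_derivative_at_withinI)
      show "onorm (\<lambda>r. r *\<^sub>R f' (x + s *\<^sub>R e)) \<le> 64 * C * (1 / (1 + norm x) ^ 6)" if "s \<in> {0..h}" for s
      proof (rule onorm_le)
        fix r :: real
        show "norm (r *\<^sub>R f' (x + s *\<^sub>R e)) \<le> 64 * C * (1 / (1 + norm x) ^ 6) * norm r"
          using mult_left_mono[OF bd[OF that], of "\<bar>r\<bar>"] by (simp only: norm_scaleR real_norm_def mult.commute)
      qed
    qed (use h in auto)
    then have "(1/h) * norm (f (x + h *\<^sub>R e) - f x) \<le> (64 * C * (1 / (1 + norm x) ^ 6))"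
      using h by (simp add: field_simps)
    moreover have "norm (q n x) = (1/h) * norm (f (x + h *\<^sub>R e) - f x)"
      by (simp add: q_def h_def del: of_nat_Suc)
    ultimately show ?thesis by simp
  qed
  have fi: "integrable lborel f" using m B by (rule integrable_decay)
  have "(\<lambda>n. LINT x|lborel. q n x) \<longlonglongrightarrow> (LINT x|lborel. f' x)"
    by (rule integral_dominated_convergence[where w = "\<lambda>x. 64 * C * (1 / (1 + norm x) ^ 6)"])
      (use lim dom mq integrable_mult_right[OF integrable_weight_norm] in auto)
  moreover have "(LINT x|lborel. q n x) = 0" for n
    unfolding q_def using fi
    by (simp add: integral_shift integrable_shift_iff)
  ultimately show ?thesis by (simp add: LIMSEQ_const_iff)
qed

section \<open>Fourier integrals of integrable functions\<close>

lemma measurable_cis [measurable]: "cis \<in> borel_measurable borel"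
  by (intro borel_measurable_continuous_onI continuous_intros)

lemma ft_inv_ft: "ft A \<xi> = (2 * pi) ^ 3 * inv_ft A (- \<xi>)"
  by (simp add: ft_def inv_ft_def inner_commute)

lemma integrable_bounded_mult:
  fixes A B :: "'a \<Rightarrow> complex"
  assumes A: "integrable M A" and B: "B \<in> borel_measurable M" and bd: "AE x in M. norm (B x) \<le> C"
  shows "integrable M (\<lambda>x. B x * A x)"
proof (rule Bochner_Integration.integrable_bound)
  show "integrable M (\<lambda>x. C * norm (A x))" using A by (intro integrable_mult_right integrable_norm)
  show "AE x in M. norm (B x * A x) \<le> norm (C * norm (A x))"
    using bd
  proof (rule eventually_mono)
    fix x assume "norm (B x) \<le> C"
    then have "norm (B x) * norm (A x) \<le> \<bar>C\<bar> * norm (A x)" by (intro mult_right_mono) auto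
    then show "norm (B x * A x) \<le> norm (C * norm (A x))" by (simp add: norm_mult abs_mult)
  qed
qed (use A B in measurable)

lemma integrable_cis:
  assumes "integrable lborel A"
  shows "integrable lborel (\<lambda>\<xi>. cis (x \<bullet> \<xi>) * A \<xi>)"
  by (rule integrable_bounded_mult[OF assms, where C = 1]) auto

lemma inv_ft_add:
  assumes "integrable lborel A" "integrable lborel B"
  shows "inv_ft (\<lambda>\<xi>. A \<xi> + B \<xi>) x = inv_ft A x + inv_ft B x"
  using assms by (simp add: inv_ft_def distrib_left integrable_cis add_divide_distrib)

lemma inv_ft_cmult: "inv_ft (\<lambda>\<xi>. c * A \<xi>) x = c * inv_ft A x"
proof -
  have "(\<lambda>\<xi>. cis (x \<bullet> \<xi>) * (c * A \<xi>)) = (\<lambda>\<xi>. c * (cis (x \<bullet> \<xi>) * A \<xi>))" by (simp add: mult_ac)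
  then show ?thesis by (simp add: inv_ft_def)
qed

lemma inv_ft_uminus: "inv_ft (\<lambda>\<xi>. - A \<xi>) x = - inv_ft A x"
  using inv_ft_cmult[of "-1"] by simp

lemma inv_ft_diff:
  assumes "integrable lborel A" "integrable lborel B"
  shows "inv_ft (\<lambda>\<xi>. A \<xi> - B \<xi>) x = inv_ft A x - inv_ft B x"
  using inv_ft_add[OF assms(1) integrable_minus[OF assms(2)]] by (simp add: inv_ft_uminus)

lemma inv_ft_sum:
  assumes "\<And>k. k \<in> I \<Longrightarrow> integrable lborel (A k)"
  shows "inv_ft (\<lambda>\<xi>. \<Sum>k\<in>I. A k \<xi>) x = (\<Sum>k\<in>I. inv_ft (A k) x)"
  using assms by (simp add: inv_ft_def sum_distrib_left integrable_cis sum_divide_distrib)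

lemma inv_ft_cong_AE:
  assumes "AE \<xi> in lborel. A \<xi> = B \<xi>" "A \<in> borel_measurable borel" "B \<in> borel_measurable borel"
  shows "inv_ft A x = inv_ft B x"
proof -
  have "(LINT \<xi>|lborel. cis (x \<bullet> \<xi>) * A \<xi>) = (LINT \<xi>|lborel. cis (x \<bullet> \<xi>) * B \<xi>)"
    by (rule integral_cong_AE) (use assms in auto)
  then show ?thesis by (simp add: inv_ft_def)
qed

lemma norm_inv_ft_le: 
  assumes "integrable lborel A"
  shows "norm (inv_ft A x) \<le> (LINT \<xi>|lborel. norm (A \<xi>))"
proof -
  have 1: "norm (LINT \<xi>|lborel. cis (x \<bullet> \<xi>) * A \<xi>) \<le> (LINT \<xi>|lborel. norm (A \<xi>))"
    using integral_norm_bound[of lborel "\<lambda>\<xi>. cis (x \<bullet> \<xi>) * A \<xi>"] by (simp add: norm_mult)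
  have "(1::real) \<le> (2 * pi) ^ 3" using pi_ge_two by (intro one_le_power) auto
  then have "norm (LINT \<xi>|lborel. cis (x \<bullet> \<xi>) * A \<xi>) / (2 * pi) ^ 3 \<le> norm (LINT \<xi>|lborel. cis (x \<bullet> \<xi>) * A \<xi>) / 1"
    by (intro divide_left_mono) auto
  with 1 show ?thesis by (simp add: inv_ft_def norm_divide norm_power)
qed

lemma continuous_inv_ft:
  assumes "integrable lborel A"
  shows "continuous_on UNIV (inv_ft A)"
  unfolding continuous_on_eq_continuous_at[OF open_UNIV]
proof
  fix x
  have "(\<lambda>y. LINT \<xi>|lborel. cis (y \<bullet> \<xi>) * A \<xi>) \<midarrow>x\<rightarrow> (LINT \<xi>|lborel. cis (x \<bullet> \<xi>) * A \<xi>)"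
    unfolding tendsto_at_iff_sequentially comp_def
  proof (intro allI impI)
    fix X :: "nat \<Rightarrow> R3" assume X: "X \<longlonglongrightarrow> x"
    show "(\<lambda>n. LINT \<xi>|lborel. cis (X n \<bullet> \<xi>) * A \<xi>) \<longlonglongrightarrow> (LINT \<xi>|lborel. cis (x \<bullet> \<xi>) * A \<xi>)"
      by (rule integral_dominated_convergence[where w = "\<lambda>\<xi>. norm (A \<xi>)"])
        (use assms X in \<open>auto simp: norm_mult intro!: tendsto_intros borel_measurable_integrable integrable_cis\<close>)
  qed
  then show "isCont (inv_ft A) x"
    unfolding isCont_def inv_ft_def by (intro tendsto_intros) auto
qed

lemma cis_diff_bound: "norm (cis a - 1 - \<i> * a) \<le> a\<^sup>2 / 2" "norm (cis a - 1) \<le> \<bar>a\<bar>"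
  using iexp_approx1[of a 1] iexp_approx1[of a 0]
  by (simp_all add: cis_conv_exp power2_eq_square fact_numeral numeral_2_eq_2 algebra_simps)

text \<open>The difference quotients of \<open>cis\<close> are dominated by one power of the frequency, whence the second
  hypothesis.\<close>

lemma has_derivative_inv_ft:
  fixes A :: "R3 \<Rightarrow> complex"
  assumes A: "integrable lborel A" and A1: "integrable lborel (\<lambda>\<xi>. norm \<xi> * A \<xi>)"
  shows "(inv_ft A has_derivative (\<lambda>d. inv_ft (\<lambda>\<xi>. \<i> * (d \<bullet> \<xi>) * A \<xi>) x)) (at x)"
proof -
  have [measurable]: "A \<in> borel_measurable borel" using A by auto
  have dA: "integrable lborel (\<lambda>\<xi>. \<i> * (d \<bullet> \<xi>) * A \<xi>)" for d :: R3
  proof (rule Bochner_Integration.integrable_bound)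
    show "integrable lborel (\<lambda>\<xi>. norm d *\<^sub>R (norm \<xi> * A \<xi>))" using A1 by (rule integrable_scaleR_right)
    show "AE \<xi> in lborel. norm (\<i> * (d \<bullet> \<xi>) * A \<xi>) \<le> norm (norm d *\<^sub>R (norm \<xi> * A \<xi>))"
      using Cauchy_Schwarz_ineq2[of d] by (auto simp: norm_mult mult.assoc[symmetric] intro!: mult_right_mono)
  qed simp
  let ?F = "\<lambda>x. LINT \<xi>|lborel. cis (x \<bullet> \<xi>) * A \<xi>"
  let ?D = "\<lambda>d. LINT \<xi>|lborel. cis (x \<bullet> \<xi>) * (\<i> * (d \<bullet> \<xi>) * A \<xi>)"
  have "linear ?D"
  proof (rule linearI)
    fix d e :: R3 and r :: real
    have "?D (d + e) = (LINT \<xi>|lborel. cis (x \<bullet> \<xi>) * (\<i> * (d \<bullet> \<xi>) * A \<xi>) + cis (x \<bullet> \<xi>) * (\<i> * (e \<bullet> \<xi>) * A \<xi>))"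
      by (simp add: inner_add_left algebra_simps)
    then show "?D (d + e) = ?D d + ?D e" by (simp add: integrable_cis[OF dA])
    have "?D (r *\<^sub>R d) = (LINT \<xi>|lborel. r *\<^sub>R (cis (x \<bullet> \<xi>) * (\<i> * (d \<bullet> \<xi>) * A \<xi>)))"
      by (simp add: scaleR_conv_of_real[where 'a = complex] mult_ac)
    then show "?D (r *\<^sub>R d) = r *\<^sub>R ?D d" by simp
  qed
  then have bl: "bounded_linear ?D" by (rule linear_conv_bounded_linear[THEN iffD1])
  have eq: "?F (x + h) - ?F x - ?D h = (LINT \<xi>|lborel. cis (x \<bullet> \<xi>) * ((cis (h \<bullet> \<xi>) - 1 - \<i> * (h \<bullet> \<xi>)) * A \<xi>))" for h
  proof -
    have "?F (x + h) - ?F x - ?D h = (LINT \<xi>|lborel. cis ((x + h) \<bullet> \<xi>) * A \<xi> - cis (x \<bullet> \<xi>) * A \<xi> - cis (x \<bullet> \<xi>) * (\<i> * (h \<bullet> \<xi>) * A \<xi>))"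
      using integrable_cis[OF A] integrable_cis[OF dA] by simp
    also have "\<dots> = (LINT \<xi>|lborel. cis (x \<bullet> \<xi>) * ((cis (h \<bullet> \<xi>) - 1 - \<i> * (h \<bullet> \<xi>)) * A \<xi>))"
    proof (rule Bochner_Integration.integral_cong[OF refl])
      fix \<xi>
      have c: "cis ((x + h) \<bullet> \<xi>) = cis (x \<bullet> \<xi>) * cis (h \<bullet> \<xi>)" by (simp add: inner_add_left cis_mult)
      show "cis ((x + h) \<bullet> \<xi>) * A \<xi> - cis (x \<bullet> \<xi>) * A \<xi> - cis (x \<bullet> \<xi>) * (\<i> * (h \<bullet> \<xi>) * A \<xi>) =
          cis (x \<bullet> \<xi>) * ((cis (h \<bullet> \<xi>) - 1 - \<i> * (h \<bullet> \<xi>)) * A \<xi>)"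
        unfolding c by algebra
    qed
    finally show ?thesis .
  qed
  have lim: "(\<lambda>h. (?F (x + h) - ?F x - ?D h) /\<^sub>R norm h) \<midarrow>0\<rightarrow> 0"
    unfolding tendsto_at_iff_sequentially comp_def
  proof (intro allI impI)
    fix X :: "nat \<Rightarrow> R3" assume X0: "\<forall>i. X i \<in> UNIV - {0}" and X: "X \<longlonglongrightarrow> 0"
    have "(\<lambda>n. LINT \<xi>|lborel. (cis (x \<bullet> \<xi>) * ((cis (X n \<bullet> \<xi>) - 1 - \<i> * (X n \<bullet> \<xi>)) * A \<xi>)) /\<^sub>R norm (X n))
        \<longlonglongrightarrow> (LINT \<xi>::R3|lborel. 0::complex)"
    proof (rule integral_dominated_convergence[where w = "\<lambda>\<xi>. norm (2 * (norm \<xi> * A \<xi>))"])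
      show "integrable lborel (\<lambda>\<xi>. norm (2 * (norm \<xi> * A \<xi>)))"
        using A1 by (intro integrable_norm integrable_mult_right)
      show "AE \<xi> in lborel. (\<lambda>n. (cis (x \<bullet> \<xi>) * ((cis (X n \<bullet> \<xi>) - 1 - \<i> * (X n \<bullet> \<xi>)) * A \<xi>)) /\<^sub>R norm (X n)) \<longlonglongrightarrow> 0"
      proof (intro AE_I2)
        fix \<xi> :: R3
        show "(\<lambda>n. (cis (x \<bullet> \<xi>) * ((cis (X n \<bullet> \<xi>) - 1 - \<i> * (X n \<bullet> \<xi>)) * A \<xi>)) /\<^sub>R norm (X n)) \<longlonglongrightarrow> 0"
        proof (rule Lim_null_comparison)
          show "(\<lambda>n. norm (X n) * ((norm \<xi>)\<^sup>2 / 2 * norm (A \<xi>))) \<longlonglongrightarrow> 0"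
            by (rule tendsto_mult_left_zero) (rule tendsto_norm_zero[OF X])
          show "\<forall>\<^sub>F n in sequentially. norm ((cis (x \<bullet> \<xi>) * ((cis (X n \<bullet> \<xi>) - 1 - \<i> * (X n \<bullet> \<xi>)) * A \<xi>)) /\<^sub>R norm (X n))
              \<le> norm (X n) * ((norm \<xi>)\<^sup>2 / 2 * norm (A \<xi>))"
          proof (intro always_eventually allI)
            fix n
            have n: "norm (X n) > 0" using X0 by auto
            have "norm (cis (X n \<bullet> \<xi>) - 1 - \<i> * (X n \<bullet> \<xi>)) \<le> (X n \<bullet> \<xi>)\<^sup>2 / 2" by (rule cis_diff_bound)
            also have "\<dots> \<le> (norm (X n) * norm \<xi>)\<^sup>2 / 2"
              using Cauchy_Schwarz_ineq2[of "X n" \<xi>] by (intro divide_right_mono) (auto simp flip: abs_le_square_iff)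
            finally have "norm (cis (X n \<bullet> \<xi>) - 1 - \<i> * (X n \<bullet> \<xi>)) * norm (A \<xi>) \<le> (norm (X n) * norm \<xi>)\<^sup>2 / 2 * norm (A \<xi>)"
              by (rule mult_right_mono) simp
            then show "norm ((cis (x \<bullet> \<xi>) * ((cis (X n \<bullet> \<xi>) - 1 - \<i> * (X n \<bullet> \<xi>)) * A \<xi>)) /\<^sub>R norm (X n))
              \<le> norm (X n) * ((norm \<xi>)\<^sup>2 / 2 * norm (A \<xi>))"
              using n by (simp add: norm_mult divide_inverse_commute[symmetric] pos_divide_le_eq power_mult_distrib power2_eq_square mult_ac)
          qed
        qed
      qed
      show "AE \<xi> in lborel. norm ((cis (x \<bullet> \<xi>) * ((cis (X n \<bullet> \<xi>) - 1 - \<i> * (X n \<bullet> \<xi>)) * A \<xi>)) /\<^sub>R norm (X n)) \<le> norm (2 * (norm \<xi> * A \<xi>))" for n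
      proof (intro AE_I2)
        fix \<xi> :: R3
        have n: "norm (X n) > 0" using X0 by auto
        have "norm (cis (X n \<bullet> \<xi>) - 1 - \<i> * (X n \<bullet> \<xi>)) \<le> norm (cis (X n \<bullet> \<xi>) - 1) + norm (\<i> * (X n \<bullet> \<xi>))"
          by (rule norm_triangle_ineq4)
        also have "\<dots> \<le> 2 * \<bar>X n \<bullet> \<xi>\<bar>" using cis_diff_bound(2)[of "X n \<bullet> \<xi>"] by (simp add: norm_mult)
        also have "\<dots> \<le> 2 * (norm (X n) * norm \<xi>)" using Cauchy_Schwarz_ineq2[of "X n" \<xi>] by simp
        finally have "norm (cis (X n \<bullet> \<xi>) - 1 - \<i> * (X n \<bullet> \<xi>)) * norm (A \<xi>) \<le> 2 * (norm (X n) * norm \<xi>) * norm (A \<xi>)"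
          by (rule mult_right_mono) simp
        then show "norm ((cis (x \<bullet> \<xi>) * ((cis (X n \<bullet> \<xi>) - 1 - \<i> * (X n \<bullet> \<xi>)) * A \<xi>)) /\<^sub>R norm (X n)) \<le> norm (2 * (norm \<xi> * A \<xi>))"
          using n by (simp add: norm_mult divide_inverse_commute[symmetric] pos_divide_le_eq mult_ac)
      qed
    qed (use A in \<open>auto intro!: borel_measurable_integrable\<close>)
    then show "(\<lambda>n. (?F (x + X n) - ?F x - ?D (X n)) /\<^sub>R norm (X n)) \<longlonglongrightarrow> 0"
      unfolding eq by simp
  qed
  have "(?F has_derivative ?D) (at x)"
    unfolding has_derivative_at using bl tendsto_norm_zero[OF lim] by (simp add: divide_inverse_commute)
  then have "((\<lambda>x. ?F x / (2 * pi) ^ 3) has_derivative (\<lambda>d. ?D d / (2 * pi) ^ 3)) (at x)"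
    by (rule bounded_linear.has_derivative[OF bounded_linear_divide])
  then show ?thesis unfolding inv_ft_def[abs_def] .
qed

lemma differentiable_inv_ft:
  fixes A :: "R3 \<Rightarrow> complex"
  assumes "integrable lborel A" "integrable lborel (\<lambda>\<xi>. norm \<xi> * A \<xi>)"
  shows "inv_ft A differentiable (at x)"
  using has_derivative_inv_ft[OF assms] by (auto simp: differentiable_def)

lemma pd_inv_ft:
  fixes A :: "R3 \<Rightarrow> complex"
  assumes "integrable lborel A" "integrable lborel (\<lambda>\<xi>. norm \<xi> * A \<xi>)"
  shows "pd j (inv_ft A) x = inv_ft (\<lambda>\<xi>. \<i> * (\<xi> $ j) * A \<xi>) x"
  unfolding pd_of_has_derivative[OF has_derivative_inv_ft[OF assms]] 
  by (simp add: inner_axis' )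

section \<open>The Fourier transform of Schwartz functions\<close>

lemma schwartz_norm_integrable:
  fixes \<phi> :: "R3 \<Rightarrow> complex"
  assumes "schwartz \<phi>" shows "integrable lborel (\<lambda>x. norm x * \<phi> x)"
proof -
  obtain B where B: "\<And>x. (1 + norm x) ^ 7 * norm (\<phi> x) \<le> B" by (rule schwartz_decay[OF assms, of 7]) blast
  show ?thesis
  proof (rule integrable_decay[where B = B])
    fix x :: R3
    have "(1 + norm x) ^ 6 * norm (norm x * \<phi> x) = (1 + norm x) ^ 6 * norm (\<phi> x) * norm x" by (simp add: norm_mult)
    also have "\<dots> \<le> (1 + norm x) ^ 6 * norm (\<phi> x) * (1 + norm x)" by (intro mult_left_mono) auto
    also have "\<dots> = (1 + norm x) ^ 7 * norm (\<phi> x)" by (simp add: eval_nat_numeral mult_ac)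
    finally show "(1 + norm x) ^ 6 * norm (norm x * \<phi> x) \<le> B" using B[of x] by simp
  qed (use schwartz_measurable[OF assms] in simp)
qed

lemma
  assumes "schwartz \<phi>"
  shows differentiable_ft: "ft \<phi> differentiable (at x)"
    and pd_ft: "pd j (ft \<phi>) x = ft (\<lambda>y. - \<i> * of_real (y $ j) * \<phi> y) x"
proof -
  note i = schwartz_integrable[OF assms] schwartz_norm_integrable[OF assms]
  have f: "ft \<phi> = (\<lambda>x. (2 * pi) ^ 3 * inv_ft \<phi> (- x))" by (simp add: ft_inv_ft fun_eq_iff)
  have d: "(\<lambda>x. inv_ft \<phi> (- x)) differentiable (at x)"
    using differentiable_chain_at[of uminus x "inv_ft \<phi>"] differentiable_inv_ft[OF i]
    by (simp add: o_def differentiable_minus)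
  show "ft \<phi> differentiable (at x)" unfolding f by (intro differentiable_mult d differentiable_const)
  have "pd j (ft \<phi>) x = (2 * pi) ^ 3 * - pd j (inv_ft \<phi>) (- x)"
    unfolding f by (simp add: pd_mult[OF differentiable_const d] pd_const pd_refl[OF differentiable_inv_ft[OF i]])
  also have "\<dots> = ft (\<lambda>y. - \<i> * of_real (y $ j) * \<phi> y) x"
    unfolding pd_inv_ft[OF i] ft_inv_ft inv_ft_uminus[symmetric] by simp
  finally show "pd j (ft \<phi>) x = ft (\<lambda>y. - \<i> * of_real (y $ j) * \<phi> y) x" .
qed

lemma ft_pd:
  assumes "schwartz \<phi>"
  shows "ft (pd j \<phi>) \<xi> = \<i> * of_real (\<xi> $ j) * ft \<phi> \<xi>"
proof -
  define e where "e x = cis (- (x \<bullet> \<xi>))" for x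
  have vd: "((\<lambda>s. e (x + s *\<^sub>R axis j 1)) has_vector_derivative (- \<i> * (\<xi> $ j)) * e (x + s *\<^sub>R axis j 1)) (at s)" for x s
  proof -
    have e': "e (x + s *\<^sub>R axis j 1) = exp (- \<i> * (x \<bullet> \<xi>) - \<i> * (\<xi> $ j) * of_real s)" for s
      by (simp add: e_def cis_conv_exp inner_add_left inner_axis' algebra_simps)
    show ?thesis unfolding e'
      by (rule has_vector_derivative_real_field) (auto intro!: derivative_eq_intros)
  qed
  obtain B where B: "\<And>x. (1 + norm x) ^ 6 * norm (\<phi> x) \<le> B" by (rule schwartz_decay[OF assms, of 6]) blast
  obtain C where C: "\<And>x. (1 + norm x) ^ 6 * norm (pd j \<phi> x) \<le> C" by (rule schwartz_decay[OF schwartz_pd[OF assms], of 6]) blast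
  have ie: "integrable lborel (\<lambda>x. e x * \<psi> x)" if "schwartz \<psi>" for \<psi>
    by (rule integrable_bounded_mult[OF schwartz_integrable[OF that], where C = 1]) (auto simp: e_def)
  have ne: "norm (e x) = 1" for x by (simp add: e_def)
  have "(LINT x|lborel. e x * pd j \<phi> x + (- \<i> * (\<xi> $ j)) * e x * \<phi> x) = 0"
  proof (rule integral_deriv_eq_0[of "\<lambda>x. e x * \<phi> x" j])
    show "((\<lambda>s. e (x + s *\<^sub>R axis j 1) * \<phi> (x + s *\<^sub>R axis j 1)) has_vector_derivative
         e (x + s *\<^sub>R axis j 1) * pd j \<phi> (x + s *\<^sub>R axis j 1) + (- \<i> * (\<xi> $ j)) * e (x + s *\<^sub>R axis j 1) * \<phi> (x + s *\<^sub>R axis j 1)) (at s)" for x s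
      by (rule has_vector_derivative_mult[OF vd pd_line[OF schwartz_differentiable[OF assms]]])
    show "(\<lambda>x. e x * \<phi> x) \<in> borel_measurable borel" using schwartz_measurable[OF assms] by (simp add: e_def)
    show "(1 + norm x) ^ 6 * norm (e x * \<phi> x) \<le> B" for x using B by (simp add: norm_mult ne)
    show "(1 + norm x) ^ 6 * norm (e x * pd j \<phi> x + - \<i> * (\<xi> $ j) * e x * \<phi> x) \<le> C + \<bar>\<xi> $ j\<bar> * B" for x
    proof -
      have "norm (e x * pd j \<phi> x + - \<i> * (\<xi> $ j) * e x * \<phi> x) \<le> norm (pd j \<phi> x) + \<bar>\<xi> $ j\<bar> * norm (\<phi> x)"
        by (rule order_trans[OF norm_triangle_ineq]) (simp add: norm_mult ne)
      then have "(1 + norm x) ^ 6 * norm (e x * pd j \<phi> x + - \<i> * (\<xi> $ j) * e x * \<phi> x)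
         \<le> (1 + norm x) ^ 6 * (norm (pd j \<phi> x) + \<bar>\<xi> $ j\<bar> * norm (\<phi> x))" by (intro mult_left_mono) auto
      also have "\<dots> = (1 + norm x) ^ 6 * norm (pd j \<phi> x) + \<bar>\<xi> $ j\<bar> * ((1 + norm x) ^ 6 * norm (\<phi> x))" by (simp add: algebra_simps)
      also have "\<dots> \<le> C + \<bar>\<xi> $ j\<bar> * B" using B C by (intro add_mono mult_left_mono) auto
      finally show ?thesis .
    qed
  qed
  moreover have "(LINT x|lborel. e x * pd j \<phi> x + (- \<i> * (\<xi> $ j)) * e x * \<phi> x) =
      (LINT x|lborel. e x * pd j \<phi> x) + (- \<i> * (\<xi> $ j)) * (LINT x|lborel. e x * \<phi> x)"
    using ie[OF schwartz_pd[OF assms, of j]] ie[OF assms] by (simp add: mult.assoc)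
  ultimately show ?thesis by (simp add: ft_def e_def)
qed

lemma norm_ft_le: "norm (ft \<phi> \<xi>) \<le> (LINT x|lborel. norm (\<phi> x))"
  using integral_norm_bound[of lborel "\<lambda>x. cis (- (x \<bullet> \<xi>)) * \<phi> x"] by (simp add: ft_def norm_mult)

lemma ft_cmult: "ft (\<lambda>x. c * \<phi> x) \<xi> = c * ft \<phi> \<xi>"
  by (simp add: ft_inv_ft inv_ft_cmult)

text \<open>Induction on the power: each factor \<open>|\<xi>|\<close> is bounded by the \<open>|\<xi>\<^sub>j|\<close>, which \<open>ft_pd\<close> trades for a derivative
  of \<open>\<phi>\<close>.\<close>

lemma ft_decay:
  assumes "schwartz \<phi>"
  shows "\<exists>B. \<forall>\<xi>. (1 + norm \<xi>) ^ N * norm (ft \<phi> \<xi>) \<le> B"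
  using assms
proof (induction N arbitrary: \<phi>)
  case 0
  then show ?case using norm_ft_le by auto
next
  case (Suc N)
  obtain B where B: "\<And>\<xi>. (1 + norm \<xi>) ^ N * norm (ft \<phi> \<xi>) \<le> B" using Suc by blast
  have "\<exists>C. \<forall>j \<xi>. (1 + norm \<xi>) ^ N * norm (ft (pd j \<phi>) \<xi>) \<le> C j"
    using Suc.IH[OF schwartz_pd[OF Suc.prems]] by metis
  then obtain C where C: "\<And>j \<xi>. (1 + norm \<xi>) ^ N * norm (ft (pd j \<phi>) \<xi>) \<le> C j" by blast
  have "(1 + norm \<xi>) ^ Suc N * norm (ft \<phi> \<xi>) \<le> B + (\<Sum>j\<in>UNIV. C j)" for \<xi>
  proof -
    have "norm \<xi> \<le> (\<Sum>j\<in>UNIV. \<bar>\<xi> $ j\<bar>)" by (rule norm_le_l1_cart)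
    then have "(1 + norm \<xi>) * ((1 + norm \<xi>) ^ N * norm (ft \<phi> \<xi>)) \<le> (1 + (\<Sum>j\<in>UNIV. \<bar>\<xi> $ j\<bar>)) * ((1 + norm \<xi>) ^ N * norm (ft \<phi> \<xi>))"
      by (intro mult_right_mono) auto
    also have "\<dots> = (1 + norm \<xi>) ^ N * norm (ft \<phi> \<xi>) + (\<Sum>j\<in>UNIV. (1 + norm \<xi>) ^ N * norm (ft (pd j \<phi>) \<xi>))"
      by (simp add: ft_pd[OF Suc.prems] norm_mult sum_distrib_left sum_distrib_right algebra_simps)
    also have "\<dots> \<le> B + (\<Sum>j\<in>UNIV. C j)" using B C by (intro add_mono sum_mono)
    finally show ?thesis by (simp add: mult.assoc)
  qed
  then show ?case by blast
qed

lemma schwartz_ft: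
  assumes "schwartz \<phi>" shows "schwartz (ft \<phi>)"
proof (rule schwartz_coinduct[of "\<lambda>\<psi>. \<exists>\<theta>. schwartz \<theta> \<and> \<psi> = ft \<theta>"])
  fix \<psi> j assume "\<exists>\<theta>. schwartz \<theta> \<and> \<psi> = ft \<theta>"
  then obtain \<theta> where \<theta>: "schwartz \<theta>" "\<psi> = ft \<theta>" by blast
  have "pd j \<psi> = ft (\<lambda>y. - \<i> * of_real (y $ j) * \<theta> y)" using pd_ft[OF \<theta>(1)] \<theta>(2) by auto
  moreover have "schwartz (\<lambda>y. - \<i> * of_real (y $ j) * \<theta> y)"
    unfolding mult.assoc by (intro schwartz_cmult schwartz_coord \<theta>)
  ultimately show "\<exists>\<theta>. schwartz \<theta> \<and> pd j \<psi> = ft \<theta>" by blast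
qed (use assms differentiable_ft ft_decay in auto)

lemma schwartz_inv_ft:
  assumes "schwartz \<phi>" shows "schwartz (inv_ft \<phi>)"
proof -
  have "inv_ft \<phi> = (\<lambda>x. (1 / (2 * pi) ^ 3) * ft \<phi> (- x))" by (auto simp: ft_inv_ft)
  then show ?thesis using schwartz_cmult[OF schwartz_refl[OF schwartz_ft[OF assms]]] by metis
qed

section \<open>The inversion formula\<close>

lemma
  shows integrable_cis_gauss: "integrable lborel (\<lambda>r::real. cis (a * r) * exp (- (r\<^sup>2) / 2))"
    and integral_cis_gauss: "(LINT r|lborel. cis (a * r) * exp (- (r\<^sup>2) / 2)) = sqrt (2 * pi) * exp (- (a\<^sup>2) / 2)"
proof -
  have nd: "std_normal_density r = exp (- (r\<^sup>2) / 2) / sqrt (2 * pi)" for r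
    by (simp add: std_normal_density_def)
  have "integrable lborel (\<lambda>r. sqrt (2 * pi) * std_normal_density r)"
    by (intro integrable_mult_right integrable_normal_density) simp
  then have g: "integrable lborel (\<lambda>r::real. exp (- (r\<^sup>2) / 2))" by (simp add: nd)
  then show "integrable lborel (\<lambda>r::real. cis (a * r) * exp (- (r\<^sup>2) / 2))"
    by (intro integrable_bounded_mult[where C = 1] integrable_of_real) auto
  have "char std_normal_distribution a = (LINT r|lborel. std_normal_density r *\<^sub>R cis (a * r))"
    unfolding char_def by (subst integral_density) (auto simp: cis_conv_exp normal_density_nonneg)
  also have "\<dots> = (LINT r|lborel. cis (a * r) * exp (- (r\<^sup>2) / 2)) / sqrt (2 * pi)"
  proof -
    have "std_normal_density r *\<^sub>R cis (a * r) = cis (a * r) * exp (- (r\<^sup>2) / 2) / sqrt (2 * pi)" for r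
      by (simp add: nd scaleR_conv_of_real del: of_real_exp)
    then show ?thesis by (simp only: integral_divide_zero)
  qed
  finally show "(LINT r|lborel. cis (a * r) * exp (- (r\<^sup>2) / 2)) = sqrt (2 * pi) * exp (- (a\<^sup>2) / 2)"
    by (simp add: char_std_normal_distribution field_simps)
qed

lemma
  fixes z :: R3
  shows integrable_cis_gauss3: "integrable lborel (\<lambda>\<xi>. cis (z \<bullet> \<xi>) * exp (- (norm \<xi>)\<^sup>2 / 2))"
    and integral_cis_gauss3: "(LINT \<xi>|lborel. cis (z \<bullet> \<xi>) * exp (- (norm \<xi>)\<^sup>2 / 2)) = (sqrt (2 * pi)) ^ 3 * exp (- (norm z)\<^sup>2 / 2)"
proof -
  define f where "f b r = cis ((z \<bullet> b) * r) * exp (- (r\<^sup>2) / 2)" for b :: R3 and r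
  have n2: "(norm x)\<^sup>2 = (\<Sum>b\<in>Basis. (x \<bullet> b)\<^sup>2)" for x :: R3
    by (subst power2_norm_eq_inner, subst euclidean_inner, simp add: power2_eq_square)
  have e: "(\<Prod>b\<in>Basis. of_real (exp (- (x \<bullet> b)\<^sup>2 / 2))) = complex_of_real (exp (- (norm x)\<^sup>2 / 2))" for x :: R3
    by (simp add: n2 exp_sum[symmetric] sum_negf sum_divide_distrib flip: of_real_prod)
  have c: "(\<Prod>b\<in>Basis. cis ((z \<bullet> b) * (\<xi> \<bullet> b))) = cis (z \<bullet> \<xi>)" for \<xi> :: R3
    by (subst euclidean_inner) (simp add: cis_conv_exp exp_sum[symmetric] sum_distrib_left)
  have p: "(\<Prod>b\<in>Basis. f b (\<xi> \<bullet> b)) = cis (z \<bullet> \<xi>) * exp (- (norm \<xi>)\<^sup>2 / 2)" for \<xi>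
    unfolding f_def prod.distrib e c ..
  have i: "integrable lborel (f b)" for b unfolding f_def[abs_def] by (rule integrable_cis_gauss)
  show "integrable lborel (\<lambda>\<xi>. cis (z \<bullet> \<xi>) * exp (- (norm \<xi>)\<^sup>2 / 2))"
    using integrable_prod_Basis[where 'a = R3, of f] i p by simp
  have "(LINT \<xi>|lborel. cis (z \<bullet> \<xi>) * exp (- (norm \<xi>)\<^sup>2 / 2)) = (\<Prod>b\<in>Basis. LINT r|lborel. f b r)"
    using integral_prod_Basis[where 'a = R3, of f] i p by simp
  also have "\<dots> = (\<Prod>b\<in>(Basis::R3 set). of_real (sqrt (2 * pi)) * of_real (exp (- (z \<bullet> b)\<^sup>2 / 2)))"
    unfolding f_def integral_cis_gauss by simp
  also have "\<dots> = (sqrt (2 * pi)) ^ 3 * exp (- (norm z)\<^sup>2 / 2)"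
    unfolding prod.distrib e by simp
  finally show "(LINT \<xi>|lborel. cis (z \<bullet> \<xi>) * exp (- (norm \<xi>)\<^sup>2 / 2)) = (sqrt (2 * pi)) ^ 3 * exp (- (norm z)\<^sup>2 / 2)" .
qed

lemma integrable_gauss3: "integrable lborel (\<lambda>\<xi>::R3. exp (- (norm \<xi>)\<^sup>2 / 2))"
  using integrable_norm[OF integrable_cis_gauss3[of 0]] by (simp del: of_real_exp)

lemma integrable_pair_mult:
  fixes f g :: "'a::euclidean_space \<Rightarrow> complex" and k :: "'a \<Rightarrow> 'a \<Rightarrow> complex"
  assumes f: "integrable lborel f" and g: "integrable lborel g"
    and k: "(\<lambda>(x, y). k x y) \<in> borel_measurable (borel \<Otimes>\<^sub>M borel)" and bd: "\<And>x y. norm (k x y) \<le> 1"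
  shows "integrable (lborel \<Otimes>\<^sub>M lborel) (\<lambda>(x, y). k x y * (f x * g y))"
proof (rule lborel_pair.Fubini_integrable)
  have [measurable]: "f \<in> borel_measurable borel" "g \<in> borel_measurable borel" using f g by auto
  note k [measurable]
  show m: "(\<lambda>(x, y). k x y * (f x * g y)) \<in> borel_measurable (lborel \<Otimes>\<^sub>M lborel)"
    by measurable
  have i: "integrable lborel (\<lambda>y. k x y * (f x * g y))" for x
    by (rule integrable_bounded_mult[where C = 1]) (use g bd in \<open>auto intro!: integrable_mult_right\<close>)
  then show "AE x in lborel. integrable lborel (\<lambda>y. case (x, y) of (x, y) \<Rightarrow> k x y * (f x * g y))" by simp
  show "integrable lborel (\<lambda>x. LINT y|lborel. norm (case (x, y) of (x, y) \<Rightarrow> k x y * (f x * g y)))"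
  proof (rule Bochner_Integration.integrable_bound)
    show "integrable lborel (\<lambda>x. (LINT y|lborel. norm (g y)) * norm (f x))"
      using f by (intro integrable_mult_right integrable_norm)
    show "AE x in lborel. norm (LINT y|lborel. norm (case (x, y) of (x, y) \<Rightarrow> k x y * (f x * g y)))
        \<le> norm ((LINT y|lborel. norm (g y)) * norm (f x))"
    proof (intro AE_I2)
      fix x
      have "(LINT y|lborel. norm (k x y * (f x * g y))) \<le> (LINT y|lborel. norm (f x) * norm (g y))"
      proof (rule integral_mono)
        show "norm (k x y * (f x * g y)) \<le> norm (f x) * norm (g y)" for y
          using mult_right_mono[OF bd[of x y], of "norm (f x * g y)"] by (simp add: norm_mult)
      qed (use i[of x] g in \<open>auto intro: integrable_norm integrable_mult_right\<close>)
      then show "norm (LINT y|lborel. norm (case (x, y) of (x, y) \<Rightarrow> k x y * (f x * g y)))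
        \<le> norm ((LINT y|lborel. norm (g y)) * norm (f x))"
        by (simp add: mult.commute)
    qed
    show "(\<lambda>x. LINT y|lborel. norm (case (x, y) of (x, y) \<Rightarrow> k x y * (f x * g y))) \<in> borel_measurable lborel"
      using m by measurable
  qed
qed

text \<open>The Gaussian makes the double integral absolutely convergent, so Fubini applies. As \<open>c\<close> tends to
  \<open>0\<close>, the left side tends to the inversion integral and the right side to a multiple of \<open>\<phi>(x)\<close>.\<close>

lemma inv_ft_gauss:
  fixes \<phi> :: "R3 \<Rightarrow> complex"
  assumes \<phi>: "integrable lborel \<phi>" and c: "c > 0"
  shows "(LINT \<xi>|lborel. cis (x \<bullet> \<xi>) * exp (- (norm (c *\<^sub>R \<xi>))\<^sup>2 / 2) * ft \<phi> \<xi>) =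
    (sqrt (2 * pi)) ^ 3 * (LINT z|lborel. exp (- (norm z)\<^sup>2 / 2) * \<phi> (x + c *\<^sub>R z))"
proof -
  have [measurable]: "\<phi> \<in> borel_measurable borel" using \<phi> by auto
  let ?g = "\<lambda>\<xi>::R3. complex_of_real (exp (- (norm (c *\<^sub>R \<xi>))\<^sup>2 / 2))"
  let ?k = "\<lambda>\<xi> y. cis (x \<bullet> \<xi>) * cis (- (y \<bullet> \<xi>))"
  have "integrable lborel (\<lambda>\<xi>::R3. exp (- (norm (c *\<^sub>R \<xi>))\<^sup>2 / 2))"
    using integrable_affine_iff[of c "\<lambda>\<xi>::R3. exp (- (norm \<xi>)\<^sup>2 / 2)" 0] c integrable_gauss3 by simp
  then have gi: "integrable lborel ?g" by (rule integrable_of_real)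
  have inner: "(LINT \<xi>|lborel. ?k \<xi> y * ?g \<xi>) = (sqrt (2 * pi)) ^ 3 * exp (- (norm ((x - y) /\<^sub>R c))\<^sup>2 / 2) / c ^ 3" for y
  proof -
    have "c ^ 3 *\<^sub>R (LINT \<xi>|lborel. ?k \<xi> y * ?g \<xi>) = 
       c ^ 3 *\<^sub>R (LINT \<xi>|lborel. cis (((x - y) /\<^sub>R c) \<bullet> (c *\<^sub>R \<xi>)) * ?g \<xi>)"
      using c by (simp add: cis_mult inner_diff_left mult.assoc[symmetric] right_inverse)
    also have "\<dots> = (LINT \<xi>|lborel. cis (((x - y) /\<^sub>R c) \<bullet> \<xi>) * exp (- (norm \<xi>)\<^sup>2 / 2))"
      using integral_affine[of c "\<lambda>\<xi>. cis (((x - y) /\<^sub>R c) \<bullet> \<xi>) * exp (- (norm \<xi>)\<^sup>2 / 2)" 0] c by simp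
    also have "\<dots> = (sqrt (2 * pi)) ^ 3 * exp (- (norm ((x - y) /\<^sub>R c))\<^sup>2 / 2)" by (rule integral_cis_gauss3)
    finally show ?thesis using c by (simp add: scaleR_conv_of_real field_simps)
  qed
  have "(LINT \<xi>|lborel. cis (x \<bullet> \<xi>) * ?g \<xi> * ft \<phi> \<xi>) = (LINT \<xi>|lborel. LINT y|lborel. ?k \<xi> y * (?g \<xi> * \<phi> y))"
    unfolding ft_def by (simp only: mult.assoc mult.left_commute flip: integral_mult_right_zero)
  also have "\<dots> = (LINT y|lborel. LINT \<xi>|lborel. ?k \<xi> y * (?g \<xi> * \<phi> y))"
    by (rule lborel_pair.Fubini_integral[symmetric], rule integrable_pair_mult[OF gi \<phi>])
      (auto simp: norm_mult)
  also have "\<dots> = (LINT y|lborel. \<phi> y * (LINT \<xi>|lborel. ?k \<xi> y * ?g \<xi>))"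
    by (simp only: mult.assoc mult.left_commute mult.commute flip: integral_mult_right_zero)
  also have "\<dots> = (LINT y|lborel. (sqrt (2 * pi)) ^ 3 * (exp (- (norm ((x - y) /\<^sub>R c))\<^sup>2 / 2) / c ^ 3 * \<phi> y))"
    unfolding inner by (simp add: mult_ac)
  also have "\<dots> = (sqrt (2 * pi)) ^ 3 * (LINT y|lborel. exp (- (norm ((x - y) /\<^sub>R c))\<^sup>2 / 2) / c ^ 3 * \<phi> y)"
    by (simp only: integral_mult_right_zero)
  also have "(LINT y|lborel. exp (- (norm ((x - y) /\<^sub>R c))\<^sup>2 / 2) / c ^ 3 * \<phi> y) =
      c ^ 3 *\<^sub>R (LINT z|lborel. exp (- (norm ((x - (x + c *\<^sub>R z)) /\<^sub>R c))\<^sup>2 / 2) / c ^ 3 * \<phi> (x + c *\<^sub>R z))"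
    using integral_affine[of c "\<lambda>y. exp (- (norm ((x - y) /\<^sub>R c))\<^sup>2 / 2) / c ^ 3 * \<phi> y" x] c by simp
  also have "\<dots> = (LINT z|lborel. exp (- (norm z)\<^sup>2 / 2) * \<phi> (x + c *\<^sub>R z))"
  proof -
    have e: "norm ((x - (x + c *\<^sub>R z)) /\<^sub>R c) = norm z" for z using c by simp
    show ?thesis
      unfolding e integral_scaleR_right[symmetric]
    proof (rule Bochner_Integration.integral_cong[OF refl])
      fix z :: R3
      have "complex_of_real (c ^ 3) * (complex_of_real (exp (- (norm z)\<^sup>2 / 2) / c ^ 3)) = complex_of_real (exp (- (norm z)\<^sup>2 / 2))"
        unfolding of_real_mult[symmetric] using c by simp
      then show "c ^ 3 *\<^sub>R (complex_of_real (exp (- (norm z)\<^sup>2 / 2) / c ^ 3) * \<phi> (x + c *\<^sub>R z)) =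
          complex_of_real (exp (- (norm z)\<^sup>2 / 2)) * \<phi> (x + c *\<^sub>R z)"
        unfolding scaleR_conv_of_real[where 'a = complex] mult.assoc[symmetric] by (rule arg_cong)
    qed
  qed
  finally show ?thesis .
qed

theorem inv_ft_ft:
  assumes \<phi>: "schwartz \<phi>"
  shows "inv_ft (ft \<phi>) x = \<phi> x"
proof -
  define c where "c n = 1 / real (Suc n)" for n
  have c0: "c n > 0" for n by (simp add: c_def)
  have cl: "c \<longlonglongrightarrow> 0" unfolding c_def by (rule LIMSEQ_Suc[OF lim_1_over_n])
  note i = schwartz_integrable[OF \<phi>] and fi = schwartz_integrable[OF schwartz_ft[OF \<phi>]]
  note [measurable] = schwartz_measurable[OF \<phi>] schwartz_measurable[OF schwartz_ft[OF \<phi>]]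
  have cont: "isCont \<phi> y" for y using schwartz_continuous[OF \<phi>] by (simp add: continuous_on_eq_continuous_at)
  obtain B where B: "\<And>x. norm (\<phi> x) \<le> B" by (rule schwartz_bounded[OF \<phi>]) blast
  let ?L = "\<lambda>n. (LINT \<xi>|lborel. cis (x \<bullet> \<xi>) * exp (- (norm (c n *\<^sub>R \<xi>))\<^sup>2 / 2) * ft \<phi> \<xi>)"
  let ?R = "\<lambda>n. (LINT z|lborel. exp (- (norm z)\<^sup>2 / 2) * \<phi> (x + c n *\<^sub>R z))"
  have "?L \<longlonglongrightarrow> (LINT \<xi>|lborel. cis (x \<bullet> \<xi>) * ft \<phi> \<xi>)"
  proof (rule integral_dominated_convergence[where w = "\<lambda>\<xi>. norm (ft \<phi> \<xi>)"])
    show "AE \<xi> in lborel. (\<lambda>n. cis (x \<bullet> \<xi>) * exp (- (norm (c n *\<^sub>R \<xi>))\<^sup>2 / 2) * ft \<phi> \<xi>) \<longlonglongrightarrow> cis (x \<bullet> \<xi>) * ft \<phi> \<xi>"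
      using cl by (intro AE_I2) (rule tendsto_eq_intros refl | assumption | simp)+
    show "AE \<xi> in lborel. norm (cis (x \<bullet> \<xi>) * exp (- (norm (c n *\<^sub>R \<xi>))\<^sup>2 / 2) * ft \<phi> \<xi>) \<le> norm (ft \<phi> \<xi>)" for n
      by (intro AE_I2) (simp add: norm_mult mult_left_le_one_le del: of_real_exp)
  qed (use fi in auto)
  moreover have "?R \<longlonglongrightarrow> (LINT z::R3|lborel. exp (- (norm z)\<^sup>2 / 2) * \<phi> x)"
  proof (rule integral_dominated_convergence[where w = "\<lambda>z. B * exp (- (norm z)\<^sup>2 / 2)"])
    show "AE z in lborel. (\<lambda>n. exp (- (norm z)\<^sup>2 / 2) * \<phi> (x + c n *\<^sub>R z)) \<longlonglongrightarrow> exp (- (norm z)\<^sup>2 / 2) * \<phi> x"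
    proof (intro AE_I2 tendsto_intros isCont_tendsto_compose[OF cont])
      fix z :: R3
      show "(\<lambda>n. x + c n *\<^sub>R z) \<longlonglongrightarrow> x" using cl by (auto intro!: tendsto_eq_intros)
    qed
    show "AE z in lborel. norm (exp (- (norm z)\<^sup>2 / 2) * \<phi> (x + c n *\<^sub>R z)) \<le> B * exp (- (norm z)\<^sup>2 / 2)" for n
      using B by (intro AE_I2) (simp add: norm_mult mult.commute[of B] mult_left_mono del: of_real_exp)
  qed (use integrable_gauss3 in auto)
  moreover have "(LINT z::R3|lborel. exp (- (norm z)\<^sup>2 / 2) * \<phi> x) = (sqrt (2 * pi)) ^ 3 * \<phi> x"
    using integral_cis_gauss3[of 0] by (simp del: of_real_exp)
  moreover have "?L n = (sqrt (2 * pi)) ^ 3 * ?R n" for n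
    by (rule inv_ft_gauss[OF i c0])
  ultimately have "?L \<longlonglongrightarrow> (LINT \<xi>|lborel. cis (x \<bullet> \<xi>) * ft \<phi> \<xi>)"
      "?L \<longlonglongrightarrow> (sqrt (2 * pi)) ^ 3 * ((sqrt (2 * pi)) ^ 3 * \<phi> x)"
    by (simp_all only: tendsto_mult_left)
  then have "(LINT \<xi>|lborel. cis (x \<bullet> \<xi>) * ft \<phi> \<xi>) = (sqrt (2 * pi)) ^ 3 * ((sqrt (2 * pi)) ^ 3 * \<phi> x)"
    by (rule LIMSEQ_unique)
  also have "\<dots> = (of_real ((sqrt (2 * pi) * sqrt (2 * pi)) ^ 3)) * \<phi> x"
    unfolding power_mult_distrib by (simp only: of_real_mult of_real_power mult.assoc)
  finally show ?thesis by (simp add: inv_ft_def)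
qed

lemma ft_inv_ft_schwartz:
  assumes "schwartz \<phi>" shows "ft (inv_ft \<phi>) x = \<phi> x"
proof -
  have e: "inv_ft \<phi> = (\<lambda>x. (1 / (2 * pi) ^ 3) * ft (\<lambda>y. \<phi> (- y)) x)"
  proof
    fix x
    have "(LINT y|lborel. cis (- (y \<bullet> x)) * \<phi> (- y)) = (LINT y|lborel. cis (y \<bullet> x) * \<phi> y)"
      using integral_refl[of "\<lambda>y. cis (y \<bullet> x) * \<phi> y"] schwartz_measurable[OF assms] by simp
    then show "inv_ft \<phi> x = (1 / (2 * pi) ^ 3) * ft (\<lambda>y. \<phi> (- y)) x"
      by (simp add: inv_ft_def ft_def inner_commute)
  qed
  have "ft (inv_ft \<phi>) x = (1 / (2 * pi) ^ 3) * ft (ft (\<lambda>y. \<phi> (- y))) x" unfolding e by (rule ft_cmult)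
  also have "\<dots> = inv_ft (ft (\<lambda>y. \<phi> (- y))) (- x)" by (simp add: ft_inv_ft)
  also have "\<dots> = \<phi> x" by (simp add: inv_ft_ft schwartz_refl assms)
  finally show ?thesis .
qed

section \<open>Smooth bump functions\<close>

text \<open>The factor \<open>r\<^sup>-\<^sup>k\<close> makes this family closed under differentiation: \<open>bexp 0\<close> is the usual smooth function
  that vanishes to infinite order at \<open>0\<close>.\<close>

definition bexp :: "nat \<Rightarrow> real \<Rightarrow> real" where
  "bexp k r = (if r > 0 then exp (- 1 / r) / r ^ k else 0)"

lemma bexp_nonneg: "0 \<le> bexp k r"
  by (simp add: bexp_def)

lemma bexp_tendsto_0: "bexp k \<midarrow>0\<rightarrow> 0"
proof -
  have "((\<lambda>r::real. inverse r ^ k / exp (inverse r)) \<longlongrightarrow> 0) (at_right 0)"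
    by (rule filterlim_compose[where g = "\<lambda>r. r ^ k / exp r", OF tendsto_power_div_exp_0 filterlim_inverse_at_top_right])
  then have "(bexp k \<longlongrightarrow> 0) (at_right 0)"
    by (rule Lim_transform_eventually)
      (auto simp: eventually_at_filter bexp_def exp_minus divide_inverse power_inverse mult.commute)
  moreover have "(bexp k \<longlongrightarrow> 0) (at_left 0)"
    by (rule Lim_transform_eventually[OF tendsto_const]) (auto simp: eventually_at_filter bexp_def)
  ultimately show ?thesis by (simp add: filterlim_split_at)
qed

text \<open>At the origin the difference quotient of \<open>bexp k\<close> is \<open>bexp (k + 1)\<close>, which tends to \<open>0\<close>.\<close>

lemma bexp_deriv: "(bexp k has_real_derivative (bexp (k + 2) r - k * bexp (k + 1) r)) (at r)"
proof (cases r "0::real" rule: linorder_cases)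
  case less
  have "((\<lambda>_. 0) has_real_derivative (bexp (k + 2) r - k * bexp (k + 1) r)) (at r)" using less by (simp add: bexp_def)
  then show ?thesis
    by (rule has_field_derivative_transform_within_open[of _ _ _ "{..<0}"]) (use less in \<open>auto simp: bexp_def\<close>)
next
  case greater
  have "((\<lambda>r. exp (- 1 / r) / r ^ k) has_real_derivative (exp (- 1 / r) / r ^ (k + 2) - k * (exp (- 1 / r) / r ^ (k + 1)))) (at r)"
    using greater
  proof -
    have "k * r ^ (k - Suc 0) * r = k * r ^ k" by (cases k) auto
    then show ?thesis using greater
      by (auto intro!: derivative_eq_intros simp: field_simps power2_eq_square)
  qed
  then have "(bexp k has_real_derivative (exp (- 1 / r) / r ^ (k + 2) - k * (exp (- 1 / r) / r ^ (k + 1)))) (at r)"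
    by (rule has_field_derivative_transform_within_open[of _ _ _ "{0<..}"]) (use greater in \<open>auto simp: bexp_def\<close>)
  then show ?thesis using greater by (simp add: bexp_def)
next
  case equal
  have "(\<lambda>h. (bexp k (0 + h) - bexp k 0) / h) \<midarrow>0\<rightarrow> 0"
    by (rule Lim_transform_eventually[OF bexp_tendsto_0[of "Suc k"]]) (auto simp: eventually_at_filter bexp_def)
  then show ?thesis using equal by (simp add: DERIV_def bexp_def)
qed

lemma bexp_bounded: "\<exists>B. \<forall>r. \<bar>bexp k r\<bar> \<le> B"
proof -
  have "continuous_on {0..1} (bexp k)"
    by (rule continuous_at_imp_continuous_on) (use bexp_deriv DERIV_isCont in blast)
  then have "bounded (bexp k ` {0..1})" by (intro compact_imp_bounded compact_continuous_image) auto
  then obtain B where "\<forall>r\<in>{0..1}. \<bar>bexp k r\<bar> \<le> B" unfolding bounded_iff by auto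
  then have B: "\<bar>bexp k r\<bar> \<le> B" if "0 \<le> r" "r \<le> 1" for r using that by simp
  have "\<bar>bexp k r\<bar> \<le> max B 1" for r
  proof -
    consider "r < 0" | "0 \<le> r" "r \<le> 1" | "r > 1" by linarith
    then show ?thesis
    proof cases
      case 3
      then have "exp (- 1 / r) \<le> 1" "1 \<le> r ^ k" by (auto simp: one_le_power)
      then have "exp (- 1 / r) \<le> r ^ k" by linarith
      then have "exp (- 1 / r) / r ^ k \<le> 1" using 3 by (simp add: divide_le_eq)
      then have "bexp k r \<le> 1" using 3 by (simp add: bexp_def)
      then show ?thesis using bexp_nonneg[of k r] by (simp add: le_max_iff_disj)
    next
      case 2
      then show ?thesis using B[of r] by (simp add: le_max_iff_disj)
    qed (simp add: bexp_def)
  qed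
  then show ?thesis by blast
qed

text \<open>Products of \<open>bexp\<close> in the distances to the faces of a box, scaled by \<open>c\<close>. The bump itself has all
  exponents \<open>0\<close>; its derivatives are combinations of the other members of the family.\<close>

locale bump_box =
  fixes c :: real and a b :: R3
  assumes c: "c > 0"
begin

definition fac :: "nat \<Rightarrow> nat \<Rightarrow> 3 \<Rightarrow> real \<Rightarrow> real" where
  "fac k l i r = bexp k (c * (r - a $ i)) * bexp l (c * (b $ i - r))"

definition gen :: "(3 \<Rightarrow> nat) \<Rightarrow> (3 \<Rightarrow> nat) \<Rightarrow> R3 \<Rightarrow> complex" where
  "gen k l x = of_real (\<Prod>i\<in>UNIV. fac (k i) (l i) i (x $ i))"

inductive span :: "(R3 \<Rightarrow> complex) \<Rightarrow> bool" where
  spgen: "span (gen k l)"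
| spadd: "span f \<Longrightarrow> span g \<Longrightarrow> span (\<lambda>x. f x + g x)"
| spmult: "span f \<Longrightarrow> span (\<lambda>x. d * f x)"

lemma fac_deriv:
  "(fac k l i has_real_derivative c * (fac (k + 2) l i r - k * fac (k + 1) l i r - fac k (l + 2) i r + l * fac k (l + 1) i r)) (at r)"
proof -
  have 1: "((\<lambda>r. bexp k (c * (r - a $ i))) has_real_derivative (bexp (k + 2) (c * (r - a $ i)) - k * bexp (k + 1) (c * (r - a $ i))) * c) (at r)"
    by (rule DERIV_chain2[OF bexp_deriv]) (auto intro!: derivative_eq_intros)
  have 2: "((\<lambda>r. bexp l (c * (b $ i - r))) has_real_derivative (bexp (l + 2) (c * (b $ i - r)) - l * bexp (l + 1) (c * (b $ i - r))) * (- c)) (at r)"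
    by (rule DERIV_chain2[OF bexp_deriv]) (auto intro!: derivative_eq_intros)
  show ?thesis unfolding fac_def[abs_def]
    by (rule DERIV_cong[OF DERIV_mult[OF 1 2]]) (simp add: algebra_simps)
qed

lemma gen_differentiable: "gen k l differentiable (at x)"
proof -
  have "((\<lambda>x. fac (k i) (l i) i (x $ i)) has_derivative (\<lambda>d. d $ i * (c * (fac (k i + 2) (l i) i (x $ i) - k i * fac (k i + 1) (l i) i (x $ i)
      - fac (k i) (l i + 2) i (x $ i) + l i * fac (k i) (l i + 1) i (x $ i))))) (at x)" for i
    by (rule has_derivative_compose[OF _ fac_deriv[unfolded has_field_derivative_def], THEN has_derivative_eq_rhs])
      (auto intro!: bounded_linear_imp_has_derivative bounded_linear_vec_nth simp: mult.commute)
  then have "((\<lambda>x. \<Prod>i\<in>UNIV. fac (k i) (l i) i (x $ i)) has_derivative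
      (\<lambda>d. \<Sum>i\<in>UNIV. d $ i * (c * (fac (k i + 2) (l i) i (x $ i) - k i * fac (k i + 1) (l i) i (x $ i)
      - fac (k i) (l i + 2) i (x $ i) + l i * fac (k i) (l i + 1) i (x $ i))) * (\<Prod>j\<in>UNIV - {i}. fac (k j) (l j) j (x $ j)))) (at x)"
    by (rule has_derivative_prod)
  then show ?thesis unfolding gen_def[abs_def]
    using has_derivative_of_real differentiable_def by blast
qed

lemma pd_gen:
  "pd j (gen k l) = (\<lambda>x. of_real c * gen (k(j := k j + 2)) l x + ((- of_real (c * k j)) * gen (k(j := k j + 1)) l x
     + ((- of_real c) * gen k (l(j := l j + 2)) x + of_real (c * l j) * gen k (l(j := l j + 1)) x)))"
proof
  fix x
  define C where "C = (\<Prod>i\<in>UNIV - {j}. fac (k i) (l i) i (x $ i))"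
  have gen: "gen k' l' y = of_real (fac (k' j) (l' j) j (y $ j) * C)"
    if "\<And>i. i \<noteq> j \<Longrightarrow> k' i = k i \<and> l' i = l i \<and> y $ i = x $ i" for k' l' y
  proof -
    have "(\<Prod>i\<in>UNIV. fac (k' i) (l' i) i (y $ i)) = fac (k' j) (l' j) j (y $ j) * (\<Prod>i\<in>UNIV - {j}. fac (k' i) (l' i) i (y $ i))"
      by (rule prod.remove) auto
    also have "(\<Prod>i\<in>UNIV - {j}. fac (k' i) (l' i) i (y $ i)) = C"
      unfolding C_def by (rule prod.cong) (use that in auto)
    finally show ?thesis by (simp add: gen_def)
  qed
  let ?D = "c * (fac (k j + 2) (l j) j (x $ j) - k j * fac (k j + 1) (l j) j (x $ j) - fac (k j) (l j + 2) j (x $ j) + l j * fac (k j) (l j + 1) j (x $ j))"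
  have "((\<lambda>s. fac (k j) (l j) j (x $ j + s)) has_real_derivative ?D * 1) (at 0)"
    by (rule DERIV_chain2[where f = "fac (k j) (l j) j"]) (auto intro!: derivative_eq_intros simp: fac_deriv simp del: One_nat_def add_2_eq_Suc')
  then have "((\<lambda>s. fac (k j) (l j) j (x $ j + s)) has_real_derivative ?D) (at 0)" by simp
  then have "((\<lambda>s. fac (k j) (l j) j (x $ j + s) * C) has_real_derivative ?D * C) (at 0)"
    by (rule DERIV_cmult_right)
  then have "((\<lambda>s. of_real (fac (k j) (l j) j (x $ j + s) * C)) has_vector_derivative complex_of_real (?D * C)) (at 0)"
    by (intro has_vector_derivative_of_real) (simp add: has_real_derivative_iff_has_vector_derivative)
  moreover have "gen k l (x + s *\<^sub>R axis j 1) = of_real (fac (k j) (l j) j (x $ j + s) * C)" for s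
    by (subst gen) (auto simp: axis_def)
  ultimately have "((\<lambda>s. gen k l (x + s *\<^sub>R axis j 1)) has_vector_derivative complex_of_real (?D * C)) (at 0)"
    by simp
  then have "pd j (gen k l) x = complex_of_real (?D * C)" by (rule pd_eqI)
  then show "pd j (gen k l) x = of_real c * gen (k(j := k j + 2)) l x + ((- of_real (c * k j)) * gen (k(j := k j + 1)) l x
     + ((- of_real c) * gen k (l(j := l j + 2)) x + of_real (c * l j) * gen k (l(j := l j + 1)) x))"
    by (simp add: gen algebra_simps)
qed

lemma span_differentiable: "span f \<Longrightarrow> f differentiable (at x)"
  by (induction rule: span.induct) (auto intro: gen_differentiable)

lemma span_pd: "span f \<Longrightarrow> span (pd j f)"
proof (induction rule: span.induct)
  case (spgen k l)
  show ?case unfolding pd_gen by (intro span.intros)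
next
  case (spadd f g)
  then have "pd j (\<lambda>x. f x + g x) = (\<lambda>x. pd j f x + pd j g x)"
    by (intro ext pd_add span_differentiable)
  then show ?case by (simp add: span.spadd spadd)
next
  case (spmult f d)
  then have "pd j (\<lambda>x. d * f x) = (\<lambda>x. d * pd j f x)"
    by (intro ext) (simp add: pd_mult pd_const span_differentiable)
  then show ?case by (simp add: span.spmult spmult)
qed

lemma gen_outside: "x \<notin> box a b \<Longrightarrow> gen k l x = 0"
proof -
  assume "x \<notin> box a b"
  then obtain i where "x $ i \<le> a $ i \<or> b $ i \<le> x $ i" by (auto simp: mem_box_cart not_less)
  then have "fac (k i) (l i) i (x $ i) = 0"
    using c by (auto simp: fac_def bexp_def zero_less_mult_iff)
  then have "(\<Prod>i\<in>UNIV. fac (k i) (l i) i (x $ i)) = 0" by (auto intro!: prod_zero)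
  then show ?thesis by (simp add: gen_def)
qed

lemma span_bounded: "span f \<Longrightarrow> \<exists>B. \<forall>x. norm (f x) \<le> B \<and> (x \<notin> box a b \<longrightarrow> f x = 0)"
proof (induction rule: span.induct)
  case (spgen k l)
  obtain B where B: "\<And>k r. \<bar>bexp k r\<bar> \<le> B k" using bexp_bounded by metis
  have "norm (gen k l x) \<le> (\<Prod>i\<in>UNIV. B (k i) * B (l i))" for x
    unfolding gen_def norm_of_real abs_prod fac_def abs_mult
    by (intro prod_mono conjI mult_mono B mult_nonneg_nonneg abs_ge_zero order_trans[OF abs_ge_zero B])
  then show ?case using gen_outside by blast
next
  case (spadd f g)
  then obtain B C where "\<And>x. norm (f x) \<le> B \<and> (x \<notin> box a b \<longrightarrow> f x = 0)"
    "\<And>x. norm (g x) \<le> C \<and> (x \<notin> box a b \<longrightarrow> g x = 0)" by blast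
  then show ?case by (intro exI[of _ "B + C"]) (auto intro: norm_triangle_le add_mono)
next
  case (spmult f d)
  then obtain B where "\<And>x. norm (f x) \<le> B \<and> (x \<notin> box a b \<longrightarrow> f x = 0)" by blast
  then show ?case by (intro exI[of _ "norm d * B"]) (auto simp: norm_mult intro: mult_left_mono)
qed

lemma span_schwartz:
  assumes "span f" shows "schwartz f"
proof (rule schwartz_coinduct[of span])
  fix f :: "R3 \<Rightarrow> complex" and N assume f: "span f"
  obtain R where R: "\<And>x. x \<in> box a b \<Longrightarrow> norm x \<le> R" using bounded_box[of a b] by (auto simp: bounded_iff)
  obtain B where B: "\<And>x. norm (f x) \<le> B \<and> (x \<notin> box a b \<longrightarrow> f x = 0)" using span_bounded[OF f] by blast
  then have B0: "0 \<le> B" using norm_ge_zero order_trans by blast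
  have "(1 + norm x) ^ N * norm (f x) \<le> (1 + \<bar>R\<bar>) ^ N * B" for x
  proof (cases "x \<in> box a b")
    case True
    then show ?thesis using R[OF True] B[of x] by (intro mult_mono power_mono) auto
  qed (use B B0 in auto)
  then show "\<exists>B. \<forall>x. (1 + norm x) ^ N * norm (f x) \<le> B" by blast
qed (auto intro: assms span_differentiable span_pd)

lemma bump_01: "gen (\<lambda>_. 0) (\<lambda>_. 0) x = of_real (norm (gen (\<lambda>_. 0) (\<lambda>_. 0) x))" "norm (gen (\<lambda>_. 0) (\<lambda>_. 0) x) \<le> 1"
proof -
  have 1: "bexp 0 r \<le> 1" for r by (simp add: bexp_def)
  have "0 \<le> (\<Prod>i\<in>UNIV. fac 0 0 i (x $ i))" by (intro prod_nonneg) (auto simp: fac_def bexp_nonneg)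
  then show "gen (\<lambda>_. 0) (\<lambda>_. 0) x = of_real (norm (gen (\<lambda>_. 0) (\<lambda>_. 0) x))"
    unfolding gen_def norm_of_real by simp
  have "(\<Prod>i\<in>UNIV. fac 0 0 i (x $ i)) \<le> 1"
    by (intro prod_le_1) (auto simp: fac_def bexp_nonneg intro!: mult_le_one 1)
  then show "norm (gen (\<lambda>_. 0) (\<lambda>_. 0) x) \<le> 1"
    using \<open>0 \<le> (\<Prod>i\<in>UNIV. fac 0 0 i (x $ i))\<close> unfolding gen_def norm_of_real by simp
qed

end

text \<open>With the scale \<open>c = n + 1\<close> the factors \<open>exp (-1 / (c r))\<close> tend to \<open>1\<close> wherever \<open>r > 0\<close>.\<close>

lemma bump_box_limit:
  obtains \<beta> where "\<And>n::nat. schwartz (\<beta> n)" "\<And>n x. norm (\<beta> n x) \<le> 1"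
    "\<And>n x. x \<notin> box a b \<Longrightarrow> \<beta> n x = 0" "\<And>x. (\<lambda>n. \<beta> n x) \<longlonglongrightarrow> indicator (box a b) x"
proof -
  define \<beta> where "\<beta> n = bump_box.gen (real (Suc n)) a b (\<lambda>_. 0) (\<lambda>_. 0)" for n
  have bb: "bump_box (real (Suc n))" for n by unfold_locales simp
  have out: "\<beta> n x = 0" if "x \<notin> box a b" for n x
    unfolding \<beta>_def using bump_box.gen_outside[OF bb that] .
  have lim: "(\<lambda>n. \<beta> n x) \<longlonglongrightarrow> indicator (box a b) x" for x
  proof (cases "x \<in> box a b")
    case False
    then show ?thesis using out[OF False] by simp
  next
    case True
    have e: "(\<lambda>n. bexp 0 (real (Suc n) * r)) \<longlonglongrightarrow> 1" if "r > 0" for r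
    proof -
      have "(\<lambda>n. exp (- ((1 / real (Suc n)) * (1 / r)))) \<longlonglongrightarrow> exp (- (0 * (1 / r)))"
        by (intro tendsto_intros LIMSEQ_Suc[OF lim_1_over_n])
      then show ?thesis using that by (simp add: bexp_def zero_less_mult_iff del: of_nat_Suc)
    qed
    have "(\<lambda>n. \<Prod>i\<in>(UNIV::3 set). bexp 0 (real (Suc n) * (x $ i - a $ i)) * bexp 0 (real (Suc n) * (b $ i - x $ i)))
        \<longlonglongrightarrow> (\<Prod>i\<in>(UNIV::3 set). 1 * 1)"
      using True by (intro tendsto_prod tendsto_mult e) (auto simp: mem_box_cart)
    then have "(\<lambda>n. complex_of_real (\<Prod>i\<in>(UNIV::3 set). bexp 0 (real (Suc n) * (x $ i - a $ i)) * bexp 0 (real (Suc n) * (b $ i - x $ i))))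
        \<longlonglongrightarrow> of_real (\<Prod>i\<in>(UNIV::3 set). 1 * 1)"
      by (rule tendsto_of_real)
    then show ?thesis using True
      by (simp add: \<beta>_def bump_box.gen_def[OF bb] bump_box.fac_def[OF bb] del: of_nat_Suc of_real_prod)
  qed
  show ?thesis
  proof (rule that[of \<beta>])
    show "schwartz (\<beta> n)" for n unfolding \<beta>_def
      by (rule bump_box.span_schwartz[OF bb]) (rule bump_box.spgen[OF bb])
    show "norm (\<beta> n x) \<le> 1" for n x unfolding \<beta>_def by (rule bump_box.bump_01[OF bb])
  qed (use out lim in auto)
qed

lemma schwartz_ge_on_ball:
  obtains \<phi> d where "schwartz \<phi>" "d > 0" "\<And>x. norm x \<le> r \<Longrightarrow> d \<le> norm (\<phi> x)"
proof -
  define w :: R3 where "w = (\<chi> i. r + 1)"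
  interpret bump_box 1 "- w" w by unfold_locales simp
  have "exp (-2) ^ 3 \<le> norm (gen (\<lambda>_. 0) (\<lambda>_. 0) x)" if x: "norm x \<le> r" for x
  proof -
    have "(\<Prod>i\<in>(UNIV::3 set). exp (-2)) \<le> (\<Prod>i\<in>UNIV. fac 0 0 i (x $ i))"
    proof (intro prod_mono conjI)
      fix i :: 3
      have e: "exp (-1) \<le> bexp 0 s" if "s \<ge> 1" for s using that by (simp add: bexp_def)
      have "\<bar>x $ i\<bar> \<le> r" using component_le_norm_cart[of x i] x by simp
      then have "exp (-1) * exp (-1) \<le> fac 0 0 i (x $ i)"
        unfolding fac_def by (intro mult_mono e) (auto simp: w_def bexp_nonneg)
      then show "exp (-2) \<le> fac 0 0 i (x $ i)" by (simp flip: exp_add)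
    qed simp
    then have "exp (-2) ^ 3 \<le> (\<Prod>i\<in>UNIV. fac 0 0 i (x $ i))" by simp
    also have "\<dots> \<le> norm (gen (\<lambda>_. 0) (\<lambda>_. 0) x)" unfolding gen_def norm_of_real by simp
    finally show ?thesis .
  qed
  moreover have "schwartz (gen (\<lambda>_. 0) (\<lambda>_. 0))" by (intro span_schwartz spgen)
  ultimately show ?thesis using that[of "gen (\<lambda>_. 0) (\<lambda>_. 0)" "exp (-2) ^ 3"] by simp
qed

section \<open>From test functions to bounded measurable functions\<close>

text \<open>One parameter bounds both the values and the support, which keeps the convergence hypotheses below
  short.\<close>

definition bsupp :: "real \<Rightarrow> (R3 \<Rightarrow> complex) \<Rightarrow> bool" where
  "bsupp r f \<longleftrightarrow> f \<in> borel_measurable borel \<and> (\<forall>x. norm (f x) \<le> r \<and> (r < norm x \<longrightarrow> f x = 0))"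

lemma bsupp_mono: "bsupp r f \<Longrightarrow> r \<le> s \<Longrightarrow> bsupp s f"
  unfolding bsupp_def by (meson order_trans order_le_less_trans)

text \<open>Box indicators are dominated limits of bumps, so \<open>L\<close> vanishes on them; Dynkin's lemma inside a large
  box passes to Borel sets, and approximation by simple functions does the rest. The functional
  need not be integration against a function: for the evolution it contains an integral over time of
  frequency pairings, where no jointly measurable choice of the transforms is at hand.\<close>

lemma functional_eq_0:
  fixes L :: "(R3 \<Rightarrow> complex) \<Rightarrow> complex"
  assumes lin: "\<And>f g c r. bsupp r f \<Longrightarrow> bsupp r g \<Longrightarrow> L (\<lambda>x. f x + c * g x) = L f + c * L g"
    and conv: "\<And>F f r. (\<And>n::nat. bsupp r (F n)) \<Longrightarrow> (\<And>x. (\<lambda>n. F n x) \<longlonglongrightarrow> f x) \<Longrightarrow> (\<lambda>n. L (F n)) \<longlonglongrightarrow> L f"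
    and zero: "\<And>\<phi> r. schwartz \<phi> \<Longrightarrow> bsupp r \<phi> \<Longrightarrow> L \<phi> = 0"
    and f: "bsupp r f"
  shows "L f = 0"
proof -
  have lim0: "L g = 0" if "\<And>n::nat. bsupp s (F n)" "\<And>x. (\<lambda>n. F n x) \<longlonglongrightarrow> g x" "\<And>n. L (F n) = 0" for s F g
    using conv[OF that(1,2)] that(3) by (simp add: LIMSEQ_const_iff)
  have box: "L (indicator (box a b)) = 0" for a b
  proof -
    obtain R where R: "\<And>x. x \<in> box a b \<Longrightarrow> norm x \<le> R" using bounded_box[of a b] by (auto simp: bounded_iff)
    obtain \<beta> where \<beta>: "\<And>n::nat. schwartz (\<beta> n)" "\<And>n x. norm (\<beta> n x) \<le> 1"
      "\<And>n x. x \<notin> box a b \<Longrightarrow> \<beta> n x = 0" "\<And>x. (\<lambda>n. \<beta> n x) \<longlonglongrightarrow> indicator (box a b) x"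
      using bump_box_limit[of a b] by blast
    have "bsupp (max R 1) (\<beta> n)" for n
      unfolding bsupp_def using schwartz_measurable[OF \<beta>(1)] \<beta>(2,3) R
      by (fastforce simp: le_max_iff_disj)
    then show ?thesis using lim0[of "max R 1" \<beta>] \<beta> zero by blast
  qed
  have zero0: "L (\<lambda>x. 0) = 0" using box[of 0 0] by (simp add: indicator_def[abs_def])
  define k where "k = r + 1"
  define K :: "R3 set" where "K = box (\<chi> i. - k) (\<chi> i. k)"
  have K: "x \<in> K" if "norm x \<le> r" for x
    using component_le_norm_cart[of x] that unfolding K_def k_def
    by (auto simp: mem_box_cart) (smt (verit) component_le_norm_cart)+
  obtain R where R: "R \<ge> 1" "\<And>x. x \<in> K \<Longrightarrow> norm x \<le> R"
    using bounded_box[of "(\<chi> i. - k) :: R3" "\<chi> i. k"] unfolding K_def bounded_iff by (meson order_trans linear)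
  have bi: "bsupp R (indicator (A \<inter> K))" if "A \<in> sets borel" for A
  proof -
    have "x \<in> K \<Longrightarrow> \<not> R < norm x" for x using R by force
    then show ?thesis using that R(1) unfolding bsupp_def by (auto simp: K_def[symmetric] indicator_def, auto simp: K_def)
  qed
  have diff: "L (\<lambda>x. indicator A x - indicator B x) = L (indicator A) - L (indicator B)"
    if "bsupp R (indicator A)" "bsupp R (indicator B)" for A B
    using lin[OF that, of "-1"] by simp
  have "sets (borel :: R3 measure) = sigma_sets UNIV (range (\<lambda>(a, b). box a b))"
    by (subst borel_eq_box) simp
  moreover have Kbox: "L (indicator (box a b \<inter> K)) = 0" for a b
    unfolding K_def Int_interval_cart[symmetric] by (simp add: box_Int_box box)
  moreover have "L (indicator (A \<inter> K)) = 0" if A: "A \<in> sigma_sets UNIV (range (\<lambda>(a, b). box a b))" for A :: "R3 set"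
  proof (rule sigma_sets_induct_disjoint[OF _ _ A])
    show "Int_stable (range (\<lambda>(a, b). box a b :: R3 set))"
    proof (rule Int_stableI)
      fix S S' :: "R3 set" assume "S \<in> range (\<lambda>(a, b). box a b)" "S' \<in> range (\<lambda>(a, b). box a b)"
      then obtain a b a' b' where "S = box a b" "S' = box a' b'" by auto
      then have "S \<inter> S' = (\<lambda>(a, b). box a b) (\<Sum>i\<in>Basis. max (a \<bullet> i) (a' \<bullet> i) *\<^sub>R i, \<Sum>i\<in>Basis. min (b \<bullet> i) (b' \<bullet> i) *\<^sub>R i)"
        by (simp add: box_Int_box)
      then show "S \<inter> S' \<in> range (\<lambda>(a, b). box a b)" by (rule range_eqI)
    qed
  next
    fix A :: "R3 set" assume "A \<in> range (\<lambda>(a, b). box a b)"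
    then show "L (indicator (A \<inter> K)) = 0" using Kbox by auto
  next
    show "L (indicator ({} \<inter> K)) = 0" using zero0 by (simp add: indicator_def[abs_def])
  next
    fix A :: "R3 set" assume "A \<in> sigma_sets UNIV (range (\<lambda>(a, b). box a b))" "L (indicator (A \<inter> K)) = 0"
    moreover from this have "A \<in> sets borel" by (subst borel_eq_box) simp
    moreover have "(\<lambda>x. indicator (UNIV \<inter> K) x - indicator (A \<inter> K) x) = (indicator ((UNIV - A) \<inter> K) :: R3 \<Rightarrow> complex)"
      by (auto simp: indicator_def)
    ultimately show "L (indicator ((UNIV - A) \<inter> K)) = 0"
      using diff[OF bi bi, of UNIV A] box by (simp add: K_def)
  next
    fix A :: "nat \<Rightarrow> R3 set"
    assume A: "disjoint_family A" "range A \<subseteq> sigma_sets UNIV (range (\<lambda>(a, b). box a b))" "\<And>i. L (indicator (A i \<inter> K)) = 0"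
    have As: "A i \<in> sets borel" for i using A(2) by (subst borel_eq_box) auto
    define U where "U n = (\<Union>i<n. A i)" for n
    have Us: "U n \<in> sets borel" for n using As by (auto simp: U_def)
    have U0: "L (indicator (U n \<inter> K)) = 0" for n
    proof (induction n)
      case 0
      then show ?case using zero0 by (simp add: U_def indicator_def[abs_def])
    next
      case (Suc n)
      have "A i \<inter> A n = {}" if "i < n" for i using A(1) that by (auto simp: disjoint_family_on_def)
      then have "U n \<inter> A n = {}" unfolding U_def by blast
      then have "indicator (U (Suc n) \<inter> K) = (\<lambda>x. indicator (U n \<inter> K) x + 1 * indicator (A n \<inter> K) x :: complex)"
        by (intro ext) (auto simp: U_def indicator_def lessThan_Suc)
      then show ?case using lin[OF bi[OF Us] bi[OF As], of n 1 n] Suc A(3) by simp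
    qed
    show "L (indicator (\<Union> (range A) \<inter> K)) = 0"
    proof (rule lim0[of R "\<lambda>n. indicator (U n \<inter> K)"])
      show "(\<lambda>n. indicator (U n \<inter> K) x :: complex) \<longlonglongrightarrow> indicator (\<Union> (range A) \<inter> K) x" for x
      proof -
        have "(\<lambda>n. indicator (\<Union>i<n. A i) x :: complex) \<longlonglongrightarrow> indicator (\<Union>i. A i) x"
          by (rule LIMSEQ_indicator_UN)
        then have "(\<lambda>n. indicator (U n) x * indicator K x :: complex) \<longlonglongrightarrow> indicator (\<Union>i. A i) x * indicator K x"
          unfolding U_def by (rule tendsto_mult_right)
        then show ?thesis by (simp add: indicator_inter_arith)
      qed
    qed (use bi[OF Us] U0 in auto)
  qed simp
  ultimately have ind: "L (indicator (A \<inter> K)) = 0" if "A \<in> sets borel" for A using that by blast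
  have fin: "L (\<lambda>x. \<Sum>y\<in>I. y * indicator (A y \<inter> K) x) = 0 \<and> (\<exists>s. bsupp s (\<lambda>x. \<Sum>y\<in>I. y * indicator (A y \<inter> K) x))"
    if "finite I" "\<And>y. A y \<in> sets borel" for I :: "complex set" and A
    using that(1)
  proof (induction I rule: finite_induct)
    case empty
    then show ?case using zero0 by (auto simp: bsupp_def intro!: exI[of _ 0])
  next
    case (insert y I)
    then obtain s where s: "bsupp s (\<lambda>x. \<Sum>y\<in>I. y * indicator (A y \<inter> K) x)" by blast
    let ?s = "max s R"
    have b: "bsupp ?s (\<lambda>x. \<Sum>y\<in>I. y * indicator (A y \<inter> K) x)" "bsupp ?s (indicator (A y \<inter> K))"
      using bsupp_mono[OF s] bsupp_mono[OF bi[OF that(2)]] by auto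
    have e: "(\<lambda>x. \<Sum>y\<in>insert y I. y * indicator (A y \<inter> K) x) = (\<lambda>x. (\<Sum>y\<in>I. y * indicator (A y \<inter> K) x) + y * indicator (A y \<inter> K) x)"
      by (intro ext, subst sum.insert) (use insert in \<open>auto simp only: add.commute\<close>)
    have "bsupp (?s + norm y * ?s) (\<lambda>x. (\<Sum>y\<in>I. y * indicator (A y \<inter> K) x) + y * indicator (A y \<inter> K) x)"
      unfolding bsupp_def
    proof (intro conjI allI impI)
      fix x
      show "norm ((\<Sum>y\<in>I. y * indicator (A y \<inter> K) x) + y * indicator (A y \<inter> K) x) \<le> ?s + norm y * ?s"
        using b unfolding bsupp_def
        by (intro order_trans[OF norm_triangle_ineq] add_mono) (auto simp only: norm_mult intro!: mult_left_mono norm_ge_zero)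
      assume "?s + norm y * ?s < norm x"
      moreover have "0 \<le> norm y * ?s" using R by (intro mult_nonneg_nonneg) auto
      ultimately have "?s < norm x" by linarith
      then show "(\<Sum>y\<in>I. y * indicator (A y \<inter> K) x) + y * indicator (A y \<inter> K) x = 0"
        using b unfolding bsupp_def by auto
    qed (use b in \<open>auto simp: bsupp_def\<close>)
    then show ?case unfolding e using lin[OF b] insert ind[OF that(2)] by auto
  qed
  have [measurable]: "f \<in> borel_measurable borel" using f by (simp add: bsupp_def)
  obtain s where s: "\<And>i. simple_function borel (s i)" "\<And>x. (\<lambda>i. s i x) \<longlonglongrightarrow> f x" "\<And>i x. norm (s i x) \<le> 2 * norm (f x)"
    using borel_measurable_implies_sequence_metric[of f borel 0] by (auto simp: dist_norm)
  have r0: "r \<ge> 0" using f norm_ge_zero unfolding bsupp_def by (meson order_trans)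
  show ?thesis
  proof (rule lim0[OF _ s(2)])
    fix n
    show "bsupp (2 * r) (s n)"
      unfolding bsupp_def
    proof (intro conjI allI impI)
      show "s n \<in> borel_measurable borel" using s(1) by (rule borel_measurable_simple_function)
      fix x
      have fx: "norm (f x) \<le> r" "r < norm x \<Longrightarrow> f x = 0" using f by (auto simp: bsupp_def)
      show "norm (s n x) \<le> 2 * r" using s(3)[of n x] fx by linarith
      assume "2 * r < norm x"
      then show "s n x = 0" using s(3)[of n x] fx r0 by simp
    qed
    have "s n x = (\<Sum>y\<in>range (s n). y * indicator (s n -` {y} \<inter> K) x)" for x
    proof -
      have "s n x = 0" if "x \<notin> K"
      proof -
        have "f x = 0" using that K f unfolding bsupp_def by (meson not_le)
        then show ?thesis using s(3)[of n x] by simp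
      qed
      moreover have "(\<Sum>y\<in>range (s n). y * indicator (s n -` {y} \<inter> K) x) = (\<Sum>y\<in>range (s n). if y = s n x then y * indicator K x else 0)"
        by (intro sum.cong refl) (auto simp: indicator_def)
      ultimately show ?thesis using s(1)[of n] by (cases "x \<in> K") (auto simp: simple_function_def)
    qed
    moreover have "s n -` {y} \<in> sets borel" for y
      using simple_functionD(2)[OF s(1), of n "{y}"] by simp
    moreover have "finite (range (s n))" using simple_functionD(1)[OF s(1), of n] by simp
    ultimately show "L (s n) = 0" using fin[of "range (s n)" "\<lambda>y. s n -` {y}"] by simp
  qed
qed

section \<open>Uniqueness of Fourier transforms\<close>

lemma temperate_locally_integrable:
  assumes F: "temperate_function F"
  shows "integrable lborel (\<lambda>x. indicator (cball 0 r) x * F x)"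
proof -
  obtain \<phi> d where \<phi>: "schwartz \<phi>" "d > 0" "\<And>x. norm x \<le> r \<Longrightarrow> d \<le> norm (\<phi> x)" by (rule schwartz_ge_on_ball) blast
  have [measurable]: "F \<in> borel_measurable borel" using F by (simp add: temperate_function_def)
  have "integrable lborel (\<lambda>x. (1 / d) * (F x * \<phi> x))"
    using F \<phi> by (intro integrable_mult_right) (simp add: temperate_function_def)
  then show ?thesis
  proof (rule Bochner_Integration.integrable_bound)
    show "AE x in lborel. norm (indicator (cball 0 r) x * F x) \<le> norm (complex_of_real (1 / d) * (F x * \<phi> x))"
    proof (intro AE_I2)
      fix x
      show "norm (indicator (cball 0 r) x * F x) \<le> norm (complex_of_real (1 / d) * (F x * \<phi> x))"
      proof (cases "norm x \<le> r")
        case True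
        then have "d * norm (F x) \<le> norm (\<phi> x) * norm (F x)" using \<phi> by (intro mult_right_mono) auto
        then show ?thesis using \<phi>(2) True by (simp add: norm_mult norm_divide pos_le_divide_eq mult.commute)
      qed simp
    qed
  qed (auto intro!: borel_measurable_times borel_measurable_indicator)
qed

lemma integrable_bsupp:
  assumes F: "temperate_function F" and f: "bsupp r f"
  shows "integrable lborel (\<lambda>x. F x * f x)"
proof -
  have "integrable lborel (\<lambda>x. f x * (indicator (cball 0 r) x * F x))"
    using temperate_locally_integrable[OF F] by (rule integrable_bounded_mult[where C = r]) (use f in \<open>auto simp: bsupp_def\<close>)
  moreover have "f x * (indicator (cball 0 r) x * F x) = F x * f x" for x
    using f by (auto simp: bsupp_def indicator_def)
  ultimately show ?thesis by simp
qed

lemma bsupp_dominated: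
  assumes F: "temperate_function F" and b: "\<And>n. bsupp r (G n)" and lim: "\<And>x. (\<lambda>n. G n x) \<longlonglongrightarrow> g x"
  shows "(\<lambda>n. LINT x|lborel. F x * G n x) \<longlonglongrightarrow> (LINT x|lborel. F x * g x)"
proof (rule integral_dominated_convergence[where w = "\<lambda>x. norm (r * (indicator (cball 0 r) x * F x))"])
  have [measurable]: "F \<in> borel_measurable borel" using F by (simp add: temperate_function_def)
  have [measurable]: "G n \<in> borel_measurable borel" for n using b by (simp add: bsupp_def)
  have [measurable]: "g \<in> borel_measurable borel" using lim by (rule borel_measurable_LIMSEQ_metric[of G, rotated]) simp
  show "integrable lborel (\<lambda>x. norm (r * (indicator (cball 0 r) x * F x)))"
    by (intro integrable_norm integrable_mult_right temperate_locally_integrable F)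
  show "AE x in lborel. norm (F x * G n x) \<le> norm (r * (indicator (cball 0 r) x * F x))" for n
  proof (intro AE_I2)
    fix x
    have g: "norm (G n x) \<le> r" "r < norm x \<longrightarrow> G n x = 0" using b unfolding bsupp_def by auto
    show "norm (F x * G n x) \<le> norm (r * (indicator (cball 0 r) x * F x))"
    proof (cases "norm x \<le> r")
      case True
      have "norm (G n x) * norm (F x) \<le> \<bar>r\<bar> * norm (F x)" using g by (intro mult_right_mono) auto
      then show ?thesis using True by (simp add: norm_mult mult.commute)
    qed (use g in auto)
  qed
  show "(\<lambda>x. F x * G n x) \<in> borel_measurable lborel" for n by measurable
  show "(\<lambda>x. F x * g x) \<in> borel_measurable lborel" by measurable
  show "AE x in lborel. (\<lambda>n. F x * G n x) \<longlonglongrightarrow> F x * g x" using lim by (intro AE_I2 tendsto_intros)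
qed

text \<open>By \<open>functional_eq_0\<close> the pairing also vanishes for the phase of \<open>cnj F\<close> cut off to a ball, where it
  is the integral of \<open>|F|\<close>.\<close>

lemma temperate_eq_0:
  assumes F: "temperate_function F" and z: "\<And>\<phi>. schwartz \<phi> \<Longrightarrow> (LINT x|lborel. F x * \<phi> x) = 0"
  shows "AE x in lborel. F x = 0"
proof -
  have [measurable]: "F \<in> borel_measurable borel" using F by (simp add: temperate_function_def)
  have L: "(LINT x|lborel. F x * f x) = 0" if "bsupp r f" for r f
  proof (rule functional_eq_0[where L = "\<lambda>f. LINT x|lborel. F x * f x", OF _ _ _ that])
    show "(LINT x|lborel. F x * (f x + c * g x)) = (LINT x|lborel. F x * f x) + c * (LINT x|lborel. F x * g x)"
      if "bsupp r f" "bsupp r g" for f g c r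
    proof -
      have "(LINT x|lborel. F x * (f x + c * g x)) = (LINT x|lborel. F x * f x + c * (F x * g x))" by (simp add: algebra_simps)
      also have "\<dots> = (LINT x|lborel. F x * f x) + c * (LINT x|lborel. F x * g x)"
        using integrable_bsupp[OF F] that by simp
      finally show ?thesis .
    qed
  next
    show "(\<lambda>n. LINT x|lborel. F x * G n x) \<longlonglongrightarrow> (LINT x|lborel. F x * g x)"
      if "\<And>n. bsupp r (G n)" "\<And>x. (\<lambda>n. G n x) \<longlonglongrightarrow> g x" for G g r
      using bsupp_dominated[OF F that] .
  qed (use z in auto)
  have "AE x in lborel. norm x \<le> real n \<longrightarrow> F x = 0" for n
  proof -
    define f where "f x = indicator (cball 0 (real n)) x * cnj (sgn (F x))" for x
    have n1: "norm (sgn z) \<le> 1" for z :: complex by (simp add: norm_sgn)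
    have [measurable]: "cnj \<in> borel_measurable borel" by (intro borel_measurable_continuous_onI continuous_intros)
    have "(\<lambda>x. sgn (F x)) \<in> borel_measurable borel" unfolding sgn_div_norm by measurable
    then have "(\<lambda>x. cnj (sgn (F x))) \<in> borel_measurable borel"
      using measurable_compose[of "\<lambda>x. sgn (F x)" borel borel cnj borel] by simp
    then have "f \<in> borel_measurable borel" unfolding f_def[abs_def]
      by (intro borel_measurable_times borel_measurable_indicator) auto
    then have bs: "bsupp (max (real n) 1) f" unfolding bsupp_def f_def
      using order_trans[OF n1 max.cobounded2] by (auto simp: norm_mult indicator_def)
    have e: "F x * f x = of_real (indicator (cball 0 (real n)) x * norm (F x))" for x
      by (cases "F x = 0") (auto simp: f_def sgn_eq complex_norm_square[symmetric] power2_eq_square indicator_def)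
    have "integrable lborel (\<lambda>x. complex_of_real (indicator (cball 0 (real n)) x * norm (F x)))"
      using integrable_bsupp[OF F bs] by (simp only: e)
    then have i: "integrable lborel (\<lambda>x. indicator (cball 0 (real n)) x * norm (F x))"
      by (simp only: complex_of_real_integrable_eq)
    have "complex_of_real (LINT x|lborel. indicator (cball 0 (real n)) x * norm (F x)) = 0"
      using L[OF bs] by (simp only: e integral_complex_of_real)
    then have "(LINT x|lborel. indicator (cball 0 (real n)) x * norm (F x)) = 0" by simp
    then have "AE x in lborel. indicator (cball 0 (real n)) x * norm (F x) = 0"
      by (subst (asm) integral_nonneg_eq_0_iff_AE[OF i]) auto
    then show ?thesis by (rule eventually_mono) (auto simp: indicator_def split: if_splits)
  qed
  then have "AE x in lborel. \<forall>n::nat. norm x \<le> real n \<longrightarrow> F x = 0" unfolding AE_all_countable by blast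
  then show ?thesis by (rule eventually_mono) (use real_arch_simple in blast)
qed

lemma temperate_unique:
  assumes F: "temperate_function F" and G: "temperate_function G"
    and e: "\<And>\<phi>. schwartz \<phi> \<Longrightarrow> distribution_of F \<phi> = distribution_of G \<phi>"
  shows "AE x in lborel. F x = G x"
proof -
  have [measurable]: "F \<in> borel_measurable borel" "G \<in> borel_measurable borel" using F G by (simp_all add: temperate_function_def)
  have i: "integrable lborel (\<lambda>x. F x * \<phi> x)" "integrable lborel (\<lambda>x. G x * \<phi> x)" if "schwartz \<phi>" for \<phi>
    using F G that by (simp_all add: temperate_function_def)
  have "AE x in lborel. F x - G x = 0"
    by (rule temperate_eq_0) (use i e in \<open>auto simp: temperate_function_def left_diff_distrib distribution_of_def\<close>)
  then show ?thesis by simp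
qed

lemma is_fourier_unique:
  assumes "is_fourier S F" "is_fourier S G"
  shows "AE x in lborel. F x = G x"
  using assms by (intro temperate_unique) (auto simp: is_fourier_def)

lemma is_fourier_fourier: "is_fourier S F \<Longrightarrow> is_fourier S (fourier S)"
  unfolding fourier_def by (rule someI[where P = "is_fourier S"])

lemma is_fourier_imp_AE: "is_fourier S F \<Longrightarrow> AE x in lborel. fourier S x = F x"
  by (rule is_fourier_unique[OF is_fourier_fourier])

lemma AE_eq_continuous:
  fixes f g :: "R3 \<Rightarrow> complex"
  assumes "AE x in lborel. f x = g x" "continuous_on UNIV f" "continuous_on UNIV g"
  shows "f = g"
proof (rule ccontr)
  assume "f \<noteq> g"
  then obtain x where "f x \<noteq> g x" by auto
  have "open ((\<lambda>x. f x - g x) -` (- {0}))"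
    by (rule open_vimage) (auto intro!: continuous_intros assms)
  then have o: "open {x. f x \<noteq> g x}" by (simp add: vimage_def)
  have "emeasure lborel {x. f x \<noteq> g x} = 0"
    using assms(1) o by (subst (asm) AE_iff_measurable[OF _ refl]) auto
  moreover obtain e where e: "e > 0" "cball x e \<subseteq> {x. f x \<noteq> g x}"
    using o \<open>f x \<noteq> g x\<close> by (auto simp: open_contains_cball)
  moreover from e have "emeasure lborel (cball x e) \<le> emeasure lborel {x. f x \<noteq> g x}"
    using o by (intro emeasure_mono) auto
  ultimately have "emeasure lborel (cball x e) = 0" by simp
  then have "measure lborel (cball x e) = 0" by (simp add: measure_def)
  then show False using content_cball_pos[OF e(1), of x] by simp
qed

section \<open>Functions with integrable Fourier transform\<close>

lemma temperate_growth:
  assumes [measurable]: "F \<in> borel_measurable borel" and bd: "AE x in lborel. norm (F x) \<le> C * (1 + norm x) ^ k"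
  shows "temperate_function F"
  unfolding temperate_function_def
proof (intro conjI allI impI)
  fix \<phi> assume \<phi>: "schwartz \<phi>"
  note [measurable] = schwartz_measurable[OF \<phi>]
  obtain B where B: "\<And>x. (1 + norm x) ^ (6 + k) * norm (\<phi> x) \<le> B" by (rule schwartz_decay[OF \<phi>, of "6 + k"]) blast
  have "integrable lborel (\<lambda>x. of_real ((1 + norm x) ^ k) * \<phi> x)"
  proof (rule integrable_decay[where B = B])
    show "(1 + norm x) ^ 6 * norm (of_real ((1 + norm x) ^ k) * \<phi> x) \<le> B" for x
      using B[of x] by (simp add: norm_mult power_add mult.assoc del: of_real_power of_real_add)
  qed simp
  then have "integrable lborel (\<lambda>x. of_real C * (of_real ((1 + norm x) ^ k) * \<phi> x))" by (rule integrable_mult_right)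
  then show "integrable lborel (\<lambda>x. F x * \<phi> x)"
  proof (rule Bochner_Integration.integrable_bound)
    show "AE x in lborel. norm (F x * \<phi> x) \<le> norm (of_real C * (of_real ((1 + norm x) ^ k) * \<phi> x))"
      using bd
    proof (rule eventually_mono)
      fix x assume "norm (F x) \<le> C * (1 + norm x) ^ k"
      also have "\<dots> \<le> \<bar>C\<bar> * (1 + norm x) ^ k" by (intro mult_right_mono) auto
      finally have "norm (F x) * norm (\<phi> x) \<le> \<bar>C\<bar> * (1 + norm x) ^ k * norm (\<phi> x)" by (rule mult_right_mono) simp
      then show "norm (F x * \<phi> x) \<le> norm (of_real C * (of_real ((1 + norm x) ^ k) * \<phi> x))"
        by (simp add: norm_mult mult.assoc del: of_real_power of_real_add)
    qed
  qed simp
qed simp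

lemma temperate_bounded:
  assumes "F \<in> borel_measurable borel" "\<And>x. norm (F x) \<le> C"
  shows "temperate_function F"
  by (rule temperate_growth[of F C 0]) (use assms in auto)

lemma temperate_integrable:
  assumes "integrable lborel A" shows "temperate_function A"
  unfolding temperate_function_def
proof (intro conjI allI impI)
  fix \<phi> assume \<phi>: "schwartz \<phi>"
  obtain B where "\<And>x. norm (\<phi> x) \<le> B" by (rule schwartz_bounded[OF \<phi>]) blast
  then have "integrable lborel (\<lambda>x. \<phi> x * A x)"
    using schwartz_measurable[OF \<phi>] by (intro integrable_bounded_mult[OF assms]) auto
  then show "integrable lborel (\<lambda>x. A x * \<phi> x)" by (simp add: mult.commute)
qed (use assms in auto)

lemma temperate_measurable: "temperate_function F \<Longrightarrow> F \<in> borel_measurable borel"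
  by (simp add: temperate_function_def)

lemma temperate_cong:
  assumes F: "temperate_function F" and ae: "AE x in lborel. F x = G x" and G [measurable]: "G \<in> borel_measurable borel"
  shows "temperate_function G"
  unfolding temperate_function_def
proof (intro conjI allI impI)
  fix \<phi> assume \<phi>: "schwartz \<phi>"
  note [measurable] = schwartz_measurable[OF \<phi>] temperate_measurable[OF F]
  have "integrable lborel (\<lambda>x. F x * \<phi> x)" using F \<phi> by (simp add: temperate_function_def)
  moreover have "AE x in lborel. F x * \<phi> x = G x * \<phi> x" using ae by (rule eventually_mono) simp
  ultimately show "integrable lborel (\<lambda>x. G x * \<phi> x)" by (subst (asm) integrable_cong_AE) auto
qed simp

lemma is_fourier_cong:
  assumes F: "is_fourier S F" and ae: "AE x in lborel. F x = G x" and G [measurable]: "G \<in> borel_measurable borel"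
  shows "is_fourier S G"
proof -
  have t: "temperate_function F" using F by (simp add: is_fourier_def)
  note [measurable] = temperate_measurable[OF t]
  have "distribution_of F \<phi> = distribution_of G \<phi>" if "schwartz \<phi>" for \<phi>
    unfolding distribution_of_def
    by (rule integral_cong_AE) (use schwartz_measurable[OF that] ae in \<open>auto elim!: eventually_mono\<close>)
  then show ?thesis using F temperate_cong[OF t ae G] by (simp add: is_fourier_def)
qed

lemma inv_ft_measurable: "integrable lborel A \<Longrightarrow> inv_ft A \<in> borel_measurable borel"
  by (intro borel_measurable_continuous_onI continuous_inv_ft)

lemma temperate_inv_ft: "integrable lborel A \<Longrightarrow> temperate_function (inv_ft A)"
  by (rule temperate_bounded[OF inv_ft_measurable norm_inv_ft_le])

lemma inv_ft_duality:
  assumes A: "integrable lborel A" and B: "integrable lborel B"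
  shows "(LINT x|lborel. inv_ft A x * B x) = (LINT \<xi>|lborel. A \<xi> * inv_ft B \<xi>)"
proof -
  have "(LINT x|lborel. inv_ft A x * B x) = (LINT x|lborel. LINT \<xi>|lborel. cis (x \<bullet> \<xi>) * (B x * A \<xi>)) / (2 * pi) ^ 3"
    by (simp only: inv_ft_def times_divide_eq_left integral_divide_zero integral_mult_left_zero[symmetric] mult.assoc mult.commute[of "A _"])
  also have "(LINT x|lborel. LINT \<xi>|lborel. cis (x \<bullet> \<xi>) * (B x * A \<xi>)) = (LINT \<xi>|lborel. LINT x|lborel. cis (x \<bullet> \<xi>) * (B x * A \<xi>))"
    by (rule lborel_pair.Fubini_integral[symmetric], rule integrable_pair_mult[OF B A]) auto
  also have "\<dots> = (LINT \<xi>|lborel. A \<xi> * (LINT x|lborel. cis (\<xi> \<bullet> x) * B x))"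
    by (simp only: integral_mult_right_zero[symmetric] inner_commute mult.assoc mult.commute[of "A _"])
  also have "\<dots> / (2 * pi) ^ 3 = (LINT \<xi>|lborel. A \<xi> * inv_ft B \<xi>)"
    by (simp only: inv_ft_def times_divide_eq_right integral_divide_zero)
  finally show ?thesis .
qed

lemma is_fourier_inv_ft:
  assumes A: "integrable lborel A"
  shows "is_fourier (distribution_of (inv_ft A)) A"
  unfolding is_fourier_def distribution_of_def
  using temperate_integrable[OF A] inv_ft_duality[OF A schwartz_integrable[OF schwartz_ft]] by (simp add: inv_ft_ft)

text \<open>By inversion every Schwartz function is a Fourier transform, so \<open>f\<close> and \<open>inv_ft A\<close> are the same
  distribution; they agree everywhere because both are continuous.\<close>

lemma inv_ft_unique:
  assumes f: "continuous_on UNIV f" "temperate_function f" and A: "integrable lborel A" and F: "is_fourier (distribution_of f) A"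
  shows "f = inv_ft A"
proof (rule AE_eq_continuous[OF _ f(1) continuous_inv_ft[OF A]])
  show "AE x in lborel. f x = inv_ft A x"
  proof (rule temperate_unique[OF f(2) temperate_inv_ft[OF A]])
    fix \<phi> assume "schwartz \<phi>"
    then have "\<phi> = ft (inv_ft \<phi>)" "schwartz (inv_ft \<phi>)" by (auto simp: ft_inv_ft_schwartz schwartz_inv_ft)
    then show "distribution_of f \<phi> = distribution_of (inv_ft A) \<phi>"
      using F is_fourier_inv_ft[OF A] unfolding is_fourier_def by metis
  qed
qed

lemma is_fourier_measurable: "is_fourier S F \<Longrightarrow> F \<in> borel_measurable borel"
  by (simp add: is_fourier_def temperate_function_def)

text \<open>The operator selects the continuous representative, which is \<open>inv_ft\<close> of the product by \<open>inv_ft_unique\<close>.\<close>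

lemma multiplier_eq:
  assumes f: "temperate_function f" "is_fourier (distribution_of f) A"
    and m [measurable]: "m \<in> borel_measurable borel" and mA: "integrable lborel (\<lambda>\<xi>. m \<xi> * A \<xi>)"
  shows "multiplier m f = inv_ft (\<lambda>\<xi>. m \<xi> * A \<xi>)"
proof -
  let ?F = "fourier (distribution_of f)"
  note [measurable] = is_fourier_measurable[OF f(2)] is_fourier_measurable[OF is_fourier_fourier[OF f(2)]]
  have ae: "AE \<xi> in lborel. m \<xi> * A \<xi> = m \<xi> * ?F \<xi>"
    using is_fourier_imp_AE[OF f(2)] by (rule eventually_mono) simp
  have iff: "is_multiplier m f g \<longleftrightarrow> temperate_function g \<and> is_fourier (distribution_of g) (\<lambda>\<xi>. m \<xi> * A \<xi>)" for g
  proof -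
    have "is_fourier (distribution_of g) (\<lambda>\<xi>. m \<xi> * A \<xi>) \<longleftrightarrow> is_fourier (distribution_of g) (\<lambda>\<xi>. m \<xi> * ?F \<xi>)"
      using ae by (auto elim!: is_fourier_cong elim: eventually_mono)
    then show ?thesis using f by (auto simp: is_multiplier_def has_fourier_def)
  qed
  show ?thesis
    unfolding multiplier_def iff
  proof (rule the_equality)
    show "continuous_on UNIV (inv_ft (\<lambda>\<xi>. m \<xi> * A \<xi>)) \<and> temperate_function (inv_ft (\<lambda>\<xi>. m \<xi> * A \<xi>)) \<and>
      is_fourier (distribution_of (inv_ft (\<lambda>\<xi>. m \<xi> * A \<xi>))) (\<lambda>\<xi>. m \<xi> * A \<xi>)"
      using mA by (auto intro: continuous_inv_ft temperate_inv_ft is_fourier_inv_ft)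
  qed (use mA in \<open>auto intro: inv_ft_unique\<close>)
qed

lemma conv_eq:
  assumes f: "temperate_function f" "is_fourier (distribution_of f) A"
    and S: "is_fourier S M" and MA: "integrable lborel (\<lambda>\<xi>. M \<xi> * A \<xi>)"
  shows "conv f S = inv_ft (\<lambda>\<xi>. M \<xi> * A \<xi>)"
proof -
  note [measurable] = is_fourier_measurable[OF f(2)] is_fourier_measurable[OF S] is_fourier_measurable[OF is_fourier_fourier[OF S]]
  have ae: "AE \<xi> in lborel. M \<xi> * A \<xi> = fourier S \<xi> * A \<xi>"
    using is_fourier_imp_AE[OF S] by (rule eventually_mono) simp
  have i: "integrable lborel (\<lambda>\<xi>. fourier S \<xi> * A \<xi>)" using MA ae by (subst (asm) integrable_cong_AE) auto
  show ?thesis unfolding conv_def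
    by (subst multiplier_eq[OF f _ i]) (use inv_ft_cong_AE[OF ae] in auto)
qed

section \<open>Products and convolutions\<close>

text \<open>The factor is the one of \<open>inv_ft\<close>, so that convolutions correspond to plain products.\<close>

definition fconv :: "(R3 \<Rightarrow> complex) \<Rightarrow> (R3 \<Rightarrow> complex) \<Rightarrow> R3 \<Rightarrow> complex" where
  "fconv A B \<xi> = (LINT \<eta>|lborel. A (\<xi> - \<eta>) * B \<eta>) / (2 * pi) ^ 3"

lemma integrable_fconv_pair:
  fixes A B :: "R3 \<Rightarrow> complex"
  assumes A: "integrable lborel A" and B: "integrable lborel B"
  shows "integrable (lborel \<Otimes>\<^sub>M lborel) (\<lambda>(\<eta>, \<xi>). A (\<xi> - \<eta>) * B \<eta>)"
proof (rule lborel_pair.Fubini_integrable)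
  have [measurable]: "A \<in> borel_measurable borel" "B \<in> borel_measurable borel" using A B by auto
  show m: "(\<lambda>(\<eta>, \<xi>). A (\<xi> - \<eta>) * B \<eta>) \<in> borel_measurable (lborel \<Otimes>\<^sub>M lborel)" by measurable
  have i: "integrable lborel (\<lambda>\<xi>. A (\<xi> - \<eta>))" for \<eta>
    using A integrable_shift_iff[of A "- \<eta>"] by simp
  show "AE \<eta> in lborel. integrable lborel (\<lambda>\<xi>. case (\<eta>, \<xi>) of (\<eta>, \<xi>) \<Rightarrow> A (\<xi> - \<eta>) * B \<eta>)"
    using i by simp
  have "(LINT \<xi>|lborel. norm (A (\<xi> - \<eta>) * B \<eta>)) = (LINT \<xi>|lborel. norm (A \<xi>)) * norm (B \<eta>)" for \<eta>
    using integral_shift[of "\<lambda>\<xi>. norm (A \<xi>)" "- \<eta>"] by (simp add: norm_mult)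
  then show "integrable lborel (\<lambda>\<eta>. LINT \<xi>|lborel. norm (case (\<eta>, \<xi>) of (\<eta>, \<xi>) \<Rightarrow> A (\<xi> - \<eta>) * B \<eta>))"
    using B by simp
qed

lemma
  assumes A: "integrable lborel A" and B: "integrable lborel B"
  shows integrable_fconv: "integrable lborel (fconv A B)"
    and AE_integrable_fconv: "AE \<xi> in lborel. integrable lborel (\<lambda>\<eta>. A (\<xi> - \<eta>) * B \<eta>)"
    and norm_fconv_le: "(LINT \<xi>|lborel. norm (fconv A B \<xi>)) \<le> (LINT \<xi>|lborel. norm (A \<xi>)) * (LINT \<xi>|lborel. norm (B \<xi>))"
    and inv_ft_fconv: "inv_ft (fconv A B) x = inv_ft A x * inv_ft B x"
proof -
  have [measurable]: "A \<in> borel_measurable borel" "B \<in> borel_measurable borel" using A B by auto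
  note p = integrable_fconv_pair[OF A B]
  show "AE \<xi> in lborel. integrable lborel (\<lambda>\<eta>. A (\<xi> - \<eta>) * B \<eta>)"
    using lborel_pair.AE_integrable_snd[OF p] by simp
  have "integrable lborel (\<lambda>\<xi>. LINT \<eta>|lborel. A (\<xi> - \<eta>) * B \<eta>)"
    using lborel_pair.integrable_snd[OF p] by simp
  then show fi: "integrable lborel (fconv A B)"
    unfolding fconv_def[abs_def] by (intro integrable_divide_zero) auto
  have one: "(1::real) \<le> (2 * pi) ^ 3" using pi_ge_two by (intro one_le_power) auto
  have pn: "integrable (lborel \<Otimes>\<^sub>M lborel) (\<lambda>(\<eta>, \<xi>). norm (A (\<xi> - \<eta>) * B \<eta>))"
    using integrable_norm[OF p] by (simp add: case_prod_unfold)
  have "(LINT \<xi>|lborel. norm (fconv A B \<xi>)) \<le> (LINT \<xi>|lborel. LINT \<eta>|lborel. norm (A (\<xi> - \<eta>) * B \<eta>))"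
  proof (rule integral_mono)
    show "integrable lborel (\<lambda>\<xi>. LINT \<eta>|lborel. norm (A (\<xi> - \<eta>) * B \<eta>))"
      using lborel_pair.integrable_snd[OF pn] by simp
    fix \<xi>
    have "norm (fconv A B \<xi>) = norm (LINT \<eta>|lborel. A (\<xi> - \<eta>) * B \<eta>) / (2 * pi) ^ 3"
      by (simp add: fconv_def norm_divide norm_power)
    also have "\<dots> \<le> norm (LINT \<eta>|lborel. A (\<xi> - \<eta>) * B \<eta>) / 1" using one by (intro divide_left_mono) auto
    also have "\<dots> \<le> (LINT \<eta>|lborel. norm (A (\<xi> - \<eta>) * B \<eta>))" by simp
    finally show "norm (fconv A B \<xi>) \<le> (LINT \<eta>|lborel. norm (A (\<xi> - \<eta>) * B \<eta>))" .
  qed (use fi in auto)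
  also have "\<dots> = (LINT \<eta>|lborel. LINT \<xi>|lborel. norm (A (\<xi> - \<eta>) * B \<eta>))"
    by (rule lborel_pair.Fubini_integral[OF pn])
  also have "\<dots> = (LINT \<xi>|lborel. norm (A \<xi>)) * (LINT \<xi>|lborel. norm (B \<xi>))"
    using integral_shift[of "\<lambda>\<xi>. norm (A \<xi>)" "- \<eta>" for \<eta>] by (simp add: norm_mult)
  finally show "(LINT \<xi>|lborel. norm (fconv A B \<xi>)) \<le> (LINT \<xi>|lborel. norm (A \<xi>)) * (LINT \<xi>|lborel. norm (B \<xi>))" .
  have q: "integrable (lborel \<Otimes>\<^sub>M lborel) (\<lambda>(\<eta>, \<xi>). cis (x \<bullet> \<xi>) * (A (\<xi> - \<eta>) * B \<eta>))"
    using integrable_bounded_mult[OF p, of "\<lambda>(\<eta>, \<xi>). cis (x \<bullet> \<xi>)" 1] by (simp add: case_prod_unfold)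
  have "(LINT \<xi>|lborel. cis (x \<bullet> \<xi>) * fconv A B \<xi>) = (LINT \<xi>|lborel. LINT \<eta>|lborel. cis (x \<bullet> \<xi>) * (A (\<xi> - \<eta>) * B \<eta>)) / (2 * pi) ^ 3"
    by (simp only: fconv_def times_divide_eq_right integral_divide_zero integral_mult_right_zero)
  also have "(LINT \<xi>|lborel. LINT \<eta>|lborel. cis (x \<bullet> \<xi>) * (A (\<xi> - \<eta>) * B \<eta>)) =
      (LINT \<eta>|lborel. LINT \<xi>|lborel. cis (x \<bullet> \<xi>) * (A (\<xi> - \<eta>) * B \<eta>))"
    by (rule lborel_pair.Fubini_integral[OF q])
  also have "\<dots> = (LINT \<eta>|lborel. (LINT \<xi>|lborel. cis (x \<bullet> \<xi>) * A \<xi>) * (cis (x \<bullet> \<eta>) * B \<eta>))"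
  proof (rule Bochner_Integration.integral_cong[OF refl])
    fix \<eta>
    have "(LINT \<xi>|lborel. cis (x \<bullet> \<xi>) * (A (\<xi> - \<eta>) * B \<eta>)) =
      (LINT \<xi>|lborel. (cis (x \<bullet> (\<xi> - \<eta>)) * A (\<xi> - \<eta>)) * (cis (x \<bullet> \<eta>) * B \<eta>))"
    proof (rule Bochner_Integration.integral_cong[OF refl])
      fix \<xi>
      have "cis (x \<bullet> \<xi>) = cis (x \<bullet> (\<xi> - \<eta>)) * cis (x \<bullet> \<eta>)" by (simp add: inner_diff_right cis_mult)
      then show "cis (x \<bullet> \<xi>) * (A (\<xi> - \<eta>) * B \<eta>) = (cis (x \<bullet> (\<xi> - \<eta>)) * A (\<xi> - \<eta>)) * (cis (x \<bullet> \<eta>) * B \<eta>)"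
        by (simp only: mult_ac)
    qed
    also have "\<dots> = (LINT \<xi>|lborel. cis (x \<bullet> (\<xi> - \<eta>)) * A (\<xi> - \<eta>)) * (cis (x \<bullet> \<eta>) * B \<eta>)"
      by (rule integral_mult_left_zero)
    also have "(LINT \<xi>|lborel. cis (x \<bullet> (\<xi> - \<eta>)) * A (\<xi> - \<eta>)) = (LINT \<xi>|lborel. cis (x \<bullet> \<xi>) * A \<xi>)"
      using integral_shift[of "\<lambda>\<xi>. cis (x \<bullet> \<xi>) * A \<xi>" "- \<eta>"] by simp
    finally show "(LINT \<xi>|lborel. cis (x \<bullet> \<xi>) * (A (\<xi> - \<eta>) * B \<eta>)) =
       (LINT \<xi>|lborel. cis (x \<bullet> \<xi>) * A \<xi>) * (cis (x \<bullet> \<eta>) * B \<eta>)" .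
  qed
  also have "\<dots> = (LINT \<xi>|lborel. cis (x \<bullet> \<xi>) * A \<xi>) * (LINT \<eta>|lborel. cis (x \<bullet> \<eta>) * B \<eta>)"
    by (rule integral_mult_right_zero)
  finally show "inv_ft (fconv A B) x = inv_ft A x * inv_ft B x"
    by (simp add: inv_ft_def)
qed

section \<open>Curves in the space of integrable functions\<close>

text \<open>Continuity in \<open>L\<^sup>1\<close>. The representatives \<open>A t\<close> are chosen for each time separately, so nothing is
  assumed about the dependence of \<open>A t \<xi>\<close> on \<open>t\<close> for fixed \<open>\<xi>\<close>.\<close>

definition L1_cont :: "real set \<Rightarrow> (real \<Rightarrow> R3 \<Rightarrow> complex) \<Rightarrow> bool" where
  "L1_cont S A \<longleftrightarrow> (\<forall>t\<in>S. integrable lborel (A t) \<and>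
     ((\<lambda>\<tau>. LINT \<xi>|lborel. norm (A \<tau> \<xi> - A t \<xi>)) \<longlongrightarrow> 0) (at t within S))"

lemma L1_contD: "L1_cont S A \<Longrightarrow> t \<in> S \<Longrightarrow> integrable lborel (A t)"
  by (simp add: L1_cont_def)

lemma eventually_in_within: "\<forall>\<^sub>F \<tau> in at t within S. \<tau> \<in> S"
  by (simp add: eventually_at_filter)

lemma L1_contI:
  assumes i: "\<And>t. t \<in> S \<Longrightarrow> integrable lborel (A t)"
    and g: "\<And>t. t \<in> S \<Longrightarrow> (g t \<longlongrightarrow> 0) (at t within S)"
    and le: "\<And>t \<tau>. t \<in> S \<Longrightarrow> \<tau> \<in> S \<Longrightarrow> (LINT \<xi>|lborel. norm (A \<tau> \<xi> - A t \<xi>)) \<le> g t \<tau>"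
  shows "L1_cont S A"
  unfolding L1_cont_def
proof (intro ballI conjI i)
  fix t assume t: "t \<in> S"
  show "((\<lambda>\<tau>. LINT \<xi>|lborel. norm (A \<tau> \<xi> - A t \<xi>)) \<longlongrightarrow> 0) (at t within S)"
  proof (rule Lim_null_comparison[OF _ g[OF t]])
    show "\<forall>\<^sub>F \<tau> in at t within S. norm (LINT \<xi>|lborel. norm (A \<tau> \<xi> - A t \<xi>)) \<le> g t \<tau>"
      using eventually_in_within by (rule eventually_mono) (use le[OF t] in auto)
  qed
qed

lemma L1_cont_tendsto: "L1_cont S A \<Longrightarrow> t \<in> S \<Longrightarrow> ((\<lambda>\<tau>. LINT \<xi>|lborel. norm (A \<tau> \<xi> - A t \<xi>)) \<longlongrightarrow> 0) (at t within S)"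
  by (simp add: L1_cont_def)

lemma L1_cont_add:
  assumes A: "L1_cont S A" and B: "L1_cont S B"
  shows "L1_cont S (\<lambda>t \<xi>. A t \<xi> + B t \<xi>)"
proof (rule L1_contI)
  fix t assume t: "t \<in> S"
  show "((\<lambda>\<tau>. (LINT \<xi>|lborel. norm (A \<tau> \<xi> - A t \<xi>)) + (LINT \<xi>|lborel. norm (B \<tau> \<xi> - B t \<xi>))) \<longlongrightarrow> 0) (at t within S)"
    using tendsto_add[OF L1_cont_tendsto[OF A t] L1_cont_tendsto[OF B t]] by simp
  fix \<tau> assume \<tau>: "\<tau> \<in> S"
  note i = L1_contD[OF A t] L1_contD[OF B t] L1_contD[OF A \<tau>] L1_contD[OF B \<tau>]
  have "(LINT \<xi>|lborel. norm (A \<tau> \<xi> + B \<tau> \<xi> - (A t \<xi> + B t \<xi>))) \<le> (LINT \<xi>|lborel. norm (A \<tau> \<xi> - A t \<xi>) + norm (B \<tau> \<xi> - B t \<xi>))"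
    by (rule integral_mono) (use i in \<open>auto simp: add_diff_add intro: norm_triangle_ineq\<close>)
  then show "(LINT \<xi>|lborel. norm (A \<tau> \<xi> + B \<tau> \<xi> - (A t \<xi> + B t \<xi>))) \<le> (LINT \<xi>|lborel. norm (A \<tau> \<xi> - A t \<xi>)) + (LINT \<xi>|lborel. norm (B \<tau> \<xi> - B t \<xi>))"
    using i by simp
qed (use L1_contD[OF A] L1_contD[OF B] in auto)

lemma L1_cont_bounded_mult:
  assumes A: "L1_cont S A" and m [measurable]: "m \<in> borel_measurable borel" and C: "AE \<xi> in lborel. norm (m \<xi>) \<le> C"
  shows "L1_cont S (\<lambda>t \<xi>. m \<xi> * A t \<xi>)"
proof (rule L1_contI)
  fix t assume t: "t \<in> S"
  show i: "integrable lborel (\<lambda>\<xi>. m \<xi> * A t \<xi>)" if "t \<in> S" for t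
    by (rule integrable_bounded_mult[OF L1_contD[OF A that], where C = C]) (use C in auto)
  show "((\<lambda>\<tau>. C * (LINT \<xi>|lborel. norm (A \<tau> \<xi> - A t \<xi>))) \<longlongrightarrow> 0) (at t within S)"
    using tendsto_mult_right_zero[OF L1_cont_tendsto[OF A t]] .
  fix \<tau> assume \<tau>: "\<tau> \<in> S"
  note i' = L1_contD[OF A t] L1_contD[OF A \<tau>]
  have "(LINT \<xi>|lborel. norm (m \<xi> * A \<tau> \<xi> - m \<xi> * A t \<xi>)) \<le> (LINT \<xi>|lborel. C * norm (A \<tau> \<xi> - A t \<xi>))"
  proof (rule integral_mono_AE)
    show "AE \<xi> in lborel. norm (m \<xi> * A \<tau> \<xi> - m \<xi> * A t \<xi>) \<le> C * norm (A \<tau> \<xi> - A t \<xi>)"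
      using C by (rule eventually_mono) (simp add: norm_mult mult_right_mono flip: right_diff_distrib)
  qed (use i' i[OF t] i[OF \<tau>] in auto)
  then show "(LINT \<xi>|lborel. norm (m \<xi> * A \<tau> \<xi> - m \<xi> * A t \<xi>)) \<le> C * (LINT \<xi>|lborel. norm (A \<tau> \<xi> - A t \<xi>))"
    by simp
qed

lemma L1_cont_sum:
  assumes "finite I" "\<And>k. k \<in> I \<Longrightarrow> L1_cont S (A k)"
  shows "L1_cont S (\<lambda>t \<xi>. \<Sum>k\<in>I. A k t \<xi>)"
  using assms
proof (induction I rule: finite_induct)
  case empty
  then show ?case by (simp add: L1_cont_def)
next
  case (insert k I)
  have "L1_cont S (\<lambda>t \<xi>. A k t \<xi> + (\<Sum>k\<in>I. A k t \<xi>))"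
    by (rule L1_cont_add) (use insert in auto)
  then show ?case using insert by simp
qed

lemma L1_cont_uminus: "L1_cont S A \<Longrightarrow> L1_cont S (\<lambda>t \<xi>. - A t \<xi>)"
  using L1_cont_bounded_mult[of S A "\<lambda>_. -1" 1] by simp

lemma L1_cont_diff: "L1_cont S A \<Longrightarrow> L1_cont S B \<Longrightarrow> L1_cont S (\<lambda>t \<xi>. A t \<xi> - B t \<xi>)"
  using L1_cont_add[OF _ L1_cont_uminus, of S A B] by simp

lemma L1_cont_norm:
  assumes A: "L1_cont S A"
  shows "continuous_on S (\<lambda>t. LINT \<xi>|lborel. norm (A t \<xi>))"
  unfolding continuous_on_def
proof
  fix t assume t: "t \<in> S"
  show "((\<lambda>\<tau>. LINT \<xi>|lborel. norm (A \<tau> \<xi>)) \<longlongrightarrow> (LINT \<xi>|lborel. norm (A t \<xi>))) (at t within S)"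
    unfolding LIM_zero_iff[symmetric, of "\<lambda>\<tau>. LINT \<xi>|lborel. norm (A \<tau> \<xi>)"]
  proof (rule Lim_null_comparison[OF _ L1_cont_tendsto[OF A t]])
    show "\<forall>\<^sub>F \<tau> in at t within S. norm ((LINT \<xi>|lborel. norm (A \<tau> \<xi>)) - (LINT \<xi>|lborel. norm (A t \<xi>))) \<le> (LINT \<xi>|lborel. norm (A \<tau> \<xi> - A t \<xi>))"
      using eventually_in_within
    proof (rule eventually_mono)
      fix \<tau> assume \<tau>: "\<tau> \<in> S"
      note i = L1_contD[OF A t] L1_contD[OF A \<tau>]
      have "(LINT \<xi>|lborel. norm (A \<tau> \<xi>)) - (LINT \<xi>|lborel. norm (A t \<xi>)) = (LINT \<xi>|lborel. norm (A \<tau> \<xi>) - norm (A t \<xi>))"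
        using i by simp
      also have "norm \<dots> \<le> (LINT \<xi>|lborel. norm (norm (A \<tau> \<xi>) - norm (A t \<xi>)))" by (rule integral_norm_bound)
      also have "\<dots> \<le> (LINT \<xi>|lborel. norm (A \<tau> \<xi> - A t \<xi>))"
        by (rule integral_mono) (use i in \<open>auto intro: norm_triangle_ineq3\<close>)
      finally show "norm ((LINT \<xi>|lborel. norm (A \<tau> \<xi>)) - (LINT \<xi>|lborel. norm (A t \<xi>))) \<le> (LINT \<xi>|lborel. norm (A \<tau> \<xi> - A t \<xi>))" .
    qed
  qed
qed

lemma L1_cont_fconv:
  assumes A: "L1_cont S A" and B: "L1_cont S B"
  shows "L1_cont S (\<lambda>t. fconv (A t) (B t))"
proof (rule L1_contI)
  let ?n = "\<lambda>A. LINT \<xi>::R3|lborel. norm (A \<xi> :: complex)"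
  fix t assume t: "t \<in> S"
  show i: "integrable lborel (fconv (A t) (B t))" if "t \<in> S" for t
    using integrable_fconv L1_contD[OF A that] L1_contD[OF B that] by blast
  have "((\<lambda>\<tau>. ?n (B \<tau>)) \<longlongrightarrow> ?n (B t)) (at t within S)"
    using L1_cont_norm[OF B] t by (simp add: continuous_on_def)
  then have "((\<lambda>\<tau>. ?n (\<lambda>\<xi>. A \<tau> \<xi> - A t \<xi>) * ?n (B \<tau>) + ?n (A t) * ?n (\<lambda>\<xi>. B \<tau> \<xi> - B t \<xi>)) \<longlongrightarrow> 0 * ?n (B t) + ?n (A t) * 0) (at t within S)"
    by (intro tendsto_intros L1_cont_tendsto[OF A t] L1_cont_tendsto[OF B t])
  then show "((\<lambda>\<tau>. ?n (\<lambda>\<xi>. A \<tau> \<xi> - A t \<xi>) * ?n (B \<tau>) + ?n (A t) * ?n (\<lambda>\<xi>. B \<tau> \<xi> - B t \<xi>)) \<longlongrightarrow> 0) (at t within S)"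
    by simp
  fix \<tau> assume \<tau>: "\<tau> \<in> S"
  note At = L1_contD[OF A t] and Bt = L1_contD[OF B t] and A\<tau> = L1_contD[OF A \<tau>] and B\<tau> = L1_contD[OF B \<tau>]
  have dA: "integrable lborel (\<lambda>\<xi>. A \<tau> \<xi> - A t \<xi>)" and dB: "integrable lborel (\<lambda>\<xi>. B \<tau> \<xi> - B t \<xi>)"
    using At Bt A\<tau> B\<tau> by auto
  have eq: "AE \<xi> in lborel. fconv (A \<tau>) (B \<tau>) \<xi> - fconv (A t) (B t) \<xi> =
      fconv (\<lambda>\<xi>. A \<tau> \<xi> - A t \<xi>) (B \<tau>) \<xi> + fconv (A t) (\<lambda>\<xi>. B \<tau> \<xi> - B t \<xi>) \<xi>"
    using AE_integrable_fconv[OF A\<tau> B\<tau>] AE_integrable_fconv[OF At B\<tau>] AE_integrable_fconv[OF At Bt]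
  proof eventually_elim
    case (elim \<xi>)
    then show ?case by (simp add: fconv_def left_diff_distrib right_diff_distrib diff_divide_distrib)
  qed
  have "?n (\<lambda>\<xi>. fconv (A \<tau>) (B \<tau>) \<xi> - fconv (A t) (B t) \<xi>) \<le>
      (LINT \<xi>|lborel. norm (fconv (\<lambda>\<xi>. A \<tau> \<xi> - A t \<xi>) (B \<tau>) \<xi>) + norm (fconv (A t) (\<lambda>\<xi>. B \<tau> \<xi> - B t \<xi>) \<xi>))"
  proof (rule integral_mono_AE)
    show "AE \<xi> in lborel. norm (fconv (A \<tau>) (B \<tau>) \<xi> - fconv (A t) (B t) \<xi>) \<le>
       norm (fconv (\<lambda>\<xi>. A \<tau> \<xi> - A t \<xi>) (B \<tau>) \<xi>) + norm (fconv (A t) (\<lambda>\<xi>. B \<tau> \<xi> - B t \<xi>) \<xi>)"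
      using eq by (rule eventually_mono) (simp add: norm_triangle_ineq)
  qed (use i[OF t] i[OF \<tau>] integrable_fconv[OF dA B\<tau>] integrable_fconv[OF At dB] in auto)
  also have "\<dots> = ?n (fconv (\<lambda>\<xi>. A \<tau> \<xi> - A t \<xi>) (B \<tau>)) + ?n (fconv (A t) (\<lambda>\<xi>. B \<tau> \<xi> - B t \<xi>))"
    using integrable_fconv[OF dA B\<tau>] integrable_fconv[OF At dB] by simp
  also have "\<dots> \<le> ?n (\<lambda>\<xi>. A \<tau> \<xi> - A t \<xi>) * ?n (B \<tau>) + ?n (A t) * ?n (\<lambda>\<xi>. B \<tau> \<xi> - B t \<xi>)"
    by (intro add_mono norm_fconv_le dA dB At B\<tau>)
  finally show "?n (\<lambda>\<xi>. fconv (A \<tau>) (B \<tau>) \<xi> - fconv (A t) (B t) \<xi>) \<le> ?n (\<lambda>\<xi>. A \<tau> \<xi> - A t \<xi>) * ?n (B \<tau>) + ?n (A t) * ?n (\<lambda>\<xi>. B \<tau> \<xi> - B t \<xi>)" .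
qed

lemma L1_cont_weight:
  assumes A: "L1_cont S (\<lambda>t \<xi>. of_real ((1 + norm \<xi>) ^ k) * A t \<xi>)"
    and m [measurable]: "m \<in> borel_measurable borel" and C: "\<And>\<xi>. norm (m \<xi>) \<le> C * (1 + norm \<xi>) ^ k"
  shows "L1_cont S (\<lambda>t \<xi>. m \<xi> * A t \<xi>)"
proof -
  have "L1_cont S (\<lambda>t \<xi>. (m \<xi> / of_real ((1 + norm \<xi>) ^ k)) * (of_real ((1 + norm \<xi>) ^ k) * A t \<xi>))"
  proof (rule L1_cont_bounded_mult[OF A, where C = C])
    show "AE \<xi> in lborel. norm (m \<xi> / of_real ((1 + norm \<xi>) ^ k)) \<le> C"
    proof (intro AE_I2)
      fix \<xi> :: R3
      have "0 < (1 + norm \<xi>) ^ k" by (intro zero_less_power pos_1_norm)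
      then show "norm (m \<xi> / of_real ((1 + norm \<xi>) ^ k)) \<le> C" 
        using C[of \<xi>] by (simp add: norm_divide pos_divide_le_eq del: of_real_power of_real_add)
    qed
  qed simp
  moreover have "(m \<xi> / of_real ((1 + norm \<xi>) ^ k)) * (of_real ((1 + norm \<xi>) ^ k) * A t \<xi>) = m \<xi> * A t \<xi>" for t \<xi>
  proof -
    have "complex_of_real ((1 + norm \<xi>) ^ k) \<noteq> 0"
      using pos_1_norm[of \<xi>] by (metis of_real_eq_0_iff power_not_zero less_numeral_extra(3))
    then show ?thesis by (metis mult.assoc nonzero_eq_divide_eq)
  qed
  ultimately show ?thesis by (simp only:)
qed

lemma continuous_on_L1_pairing:
  assumes A: "L1_cont S A" and m [measurable]: "m \<in> borel_measurable borel" and C: "AE \<xi> in lborel. norm (m \<xi>) \<le> C"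
  shows "continuous_on S (\<lambda>t. LINT \<xi>|lborel. m \<xi> * A t \<xi>)"
  unfolding continuous_on_def
proof
  fix t assume t: "t \<in> S"
  note mA = L1_cont_bounded_mult[OF A m C]
  show "((\<lambda>\<tau>. LINT \<xi>|lborel. m \<xi> * A \<tau> \<xi>) \<longlongrightarrow> (LINT \<xi>|lborel. m \<xi> * A t \<xi>)) (at t within S)"
    unfolding LIM_zero_iff[symmetric, of "\<lambda>\<tau>. LINT \<xi>|lborel. m \<xi> * A \<tau> \<xi>"]
  proof (rule Lim_null_comparison[OF _ L1_cont_tendsto[OF mA t]])
    show "\<forall>\<^sub>F \<tau> in at t within S. norm ((LINT \<xi>|lborel. m \<xi> * A \<tau> \<xi>) - (LINT \<xi>|lborel. m \<xi> * A t \<xi>)) \<le> (LINT \<xi>|lborel. norm (m \<xi> * A \<tau> \<xi> - m \<xi> * A t \<xi>))"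
      using eventually_in_within
    proof (rule eventually_mono)
      fix \<tau> assume \<tau>: "\<tau> \<in> S"
      have "(LINT \<xi>|lborel. m \<xi> * A \<tau> \<xi>) - (LINT \<xi>|lborel. m \<xi> * A t \<xi>) = (LINT \<xi>|lborel. m \<xi> * A \<tau> \<xi> - m \<xi> * A t \<xi>)"
        using L1_contD[OF mA t] L1_contD[OF mA \<tau>] by simp
      also have "norm \<dots> \<le> (LINT \<xi>|lborel. norm (m \<xi> * A \<tau> \<xi> - m \<xi> * A t \<xi>))" by (rule integral_norm_bound)
      finally show "norm ((LINT \<xi>|lborel. m \<xi> * A \<tau> \<xi>) - (LINT \<xi>|lborel. m \<xi> * A t \<xi>)) \<le> (LINT \<xi>|lborel. norm (m \<xi> * A \<tau> \<xi> - m \<xi> * A t \<xi>))" .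
    qed
  qed
qed

lemma continuous_on_inv_ft_joint:
  assumes A: "L1_cont S A"
  shows "continuous_on (S \<times> UNIV) (\<lambda>(t, x). inv_ft (A t) x)"
  unfolding continuous_on_def
proof safe
  fix t and x :: R3 assume t: "t \<in> S"
  let ?F = "at (t, x) within S \<times> UNIV"
  have cA: "((\<lambda>p. LINT \<xi>|lborel. norm (A (fst p) \<xi> - A t \<xi>)) \<longlongrightarrow> 0) ?F"
  proof -
    have "continuous_on S (\<lambda>\<tau>. LINT \<xi>|lborel. norm (A \<tau> \<xi> - A t \<xi>))"
      by (rule L1_cont_norm, rule L1_cont_diff[OF A]) (use L1_contD[OF A t] in \<open>simp add: L1_cont_def\<close>)
    then have "continuous_on (S \<times> UNIV) (\<lambda>p :: real \<times> R3. LINT \<xi>|lborel. norm (A (fst p) \<xi> - A t \<xi>))"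
      by (rule continuous_on_compose2) (auto intro!: continuous_intros)
    then have "((\<lambda>p. LINT \<xi>|lborel. norm (A (fst p) \<xi> - A t \<xi>)) \<longlongrightarrow> (LINT \<xi>|lborel. norm (A (fst (t, x)) \<xi> - A t \<xi>))) ?F"
      using t unfolding continuous_on_def by blast
    then show ?thesis by simp
  qed
  have cx: "((\<lambda>p. inv_ft (A t) (snd p)) \<longlongrightarrow> inv_ft (A t) x) ?F"
  proof -
    have "continuous_on (S \<times> UNIV) (\<lambda>p :: real \<times> R3. inv_ft (A t) (snd p))"
      by (rule continuous_on_compose2[OF continuous_inv_ft[OF L1_contD[OF A t]]]) (auto intro!: continuous_intros)
    then have "((\<lambda>p. inv_ft (A t) (snd p)) \<longlongrightarrow> inv_ft (A t) (snd (t, x))) ?F"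
      using t unfolding continuous_on_def by blast
    then show ?thesis by simp
  qed
  have "((\<lambda>p. inv_ft (A (fst p)) (snd p) - inv_ft (A t) (snd p)) \<longlongrightarrow> 0) ?F"
  proof (rule Lim_null_comparison[OF _ cA])
    have "\<forall>\<^sub>F p in ?F. p \<in> S \<times> UNIV" by (rule eventually_in_within)
    then show "\<forall>\<^sub>F p in ?F. norm (inv_ft (A (fst p)) (snd p) - inv_ft (A t) (snd p)) \<le> (LINT \<xi>|lborel. norm (A (fst p) \<xi> - A t \<xi>))"
    proof (rule eventually_mono)
      fix p :: "real \<times> R3" assume "p \<in> S \<times> UNIV"
      then have p: "fst p \<in> S" by auto
      show "norm (inv_ft (A (fst p)) (snd p) - inv_ft (A t) (snd p)) \<le> (LINT \<xi>|lborel. norm (A (fst p) \<xi> - A t \<xi>))"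
        unfolding inv_ft_diff[OF L1_contD[OF A p] L1_contD[OF A t], symmetric]
        by (rule norm_inv_ft_le) (use L1_contD[OF A p] L1_contD[OF A t] in auto)
    qed
  qed
  from tendsto_add[OF this cx] show "((\<lambda>(t, x). inv_ft (A t) x) \<longlongrightarrow> inv_ft (A t) x) ?F"
    by (simp add: case_prod_unfold)
qed

lemma L1_cont_bounded:
  assumes A: "L1_cont S A" and K: "compact K" "K \<subseteq> S"
  obtains B where "\<And>t. t \<in> K \<Longrightarrow> (LINT \<xi>|lborel. norm (A t \<xi>)) \<le> B"
proof -
  have "bounded ((\<lambda>t. LINT \<xi>|lborel. norm (A t \<xi>)) ` K)"
    by (intro compact_imp_bounded compact_continuous_image continuous_on_subset[OF L1_cont_norm[OF A]] K)
  then obtain B where B: "\<forall>t\<in>K. norm (LINT \<xi>|lborel. norm (A t \<xi>)) \<le> B" unfolding bounded_iff by auto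
  have "(LINT \<xi>|lborel. norm (A t \<xi>)) \<le> B" if "t \<in> K" for t
    using B that by (auto dest!: bspec[of K _ t])
  then show ?thesis by (rule that)
qed

section \<open>Sobolev curves have integrable Fourier transforms\<close>

text \<open>The inequality between arithmetic and geometric mean; it replaces the Cauchy--Schwarz inequality for
  the weights \<open>w\<^sup>-\<^sup>3\<close> and \<open>w\<^sup>5\<close>, of which the first is integrable in dimension three.\<close>

lemma young_weight:
  fixes \<delta> w d :: real
  assumes "\<delta> > 0" "w > 0" "0 \<le> d"
  shows "2 * (w * d) \<le> \<delta> * (1 / w ^ 3) + (w ^ 5 * d\<^sup>2) / \<delta>"
proof -
  have e: "\<delta> * (1 / w ^ 3) + (w ^ 5 * d\<^sup>2) / \<delta> - 2 * (w * d) = (\<delta> - w ^ 4 * d)\<^sup>2 / (\<delta> * w ^ 3)"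
    using assms by (simp add: field_simps eval_nat_numeral)
  have "0 \<le> (\<delta> - w ^ 4 * d)\<^sup>2 / (\<delta> * w ^ 3)" using assms by (intro divide_nonneg_nonneg) auto
  then show ?thesis using e by linarith
qed

lemma
  fixes A :: "R3 \<Rightarrow> complex"
  assumes [measurable]: "A \<in> borel_measurable borel"
    and i: "integrable lborel (\<lambda>\<xi>. (1 + (norm \<xi>)\<^sup>2) powr 5 * (norm (A \<xi>))\<^sup>2)"
  shows sobolev_integrable: "integrable lborel (\<lambda>\<xi>. of_real ((1 + norm \<xi>)\<^sup>2) * A \<xi>)"
    and sobolev_L1_le: "(LINT \<xi>|lborel. norm (of_real ((1 + norm \<xi>)\<^sup>2) * A \<xi>)) \<le>
      sqrt (LINT \<xi>|lborel. (1 + (norm \<xi>)\<^sup>2) powr 5 * (norm (A \<xi>))\<^sup>2) * ((LINT \<xi>::R3|lborel. 1 / (1 + (norm \<xi>)\<^sup>2) ^ 3) + 1)"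
proof -
  let ?w = "\<lambda>\<xi>::R3. 1 + (norm \<xi>)\<^sup>2"
  have wpos: "?w \<xi> > 0" for \<xi> by (simp add: add_pos_nonneg)
  have i5: "integrable lborel (\<lambda>\<xi>. ?w \<xi> ^ 5 * (norm (A \<xi>))\<^sup>2)"
    using i wpos by (simp add: powr_numeral)
  define N2 where "N2 = (LINT \<xi>|lborel. ?w \<xi> ^ 5 * (norm (A \<xi>))\<^sup>2)"
  define C where "C = (LINT \<xi>|lborel. 1 / ?w \<xi> ^ 3)"
  have pt: "norm (of_real ((1 + norm \<xi>)\<^sup>2) * A \<xi>) \<le> \<delta> * (1 / ?w \<xi> ^ 3) + (?w \<xi> ^ 5 * (norm (A \<xi>))\<^sup>2) / \<delta>" if "\<delta> > 0" for \<delta> \<xi>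
  proof -
    have "(1 + norm \<xi>)\<^sup>2 * norm (A \<xi>) \<le> 2 * ?w \<xi> * norm (A \<xi>)" by (intro mult_right_mono weight_le) simp
    also have "\<dots> \<le> \<delta> * (1 / ?w \<xi> ^ 3) + (?w \<xi> ^ 5 * (norm (A \<xi>))\<^sup>2) / \<delta>"
      using young_weight[OF that wpos[of \<xi>], of "norm (A \<xi>)"] by (simp only: mult.assoc norm_ge_zero)
    finally show ?thesis by (simp add: norm_mult del: of_real_power of_real_add)
  qed
  have ib: "integrable lborel (\<lambda>\<xi>. \<delta> * (1 / ?w \<xi> ^ 3) + (?w \<xi> ^ 5 * (norm (A \<xi>))\<^sup>2) / \<delta>)" for \<delta>
    using integrable_mult_right[OF integrable_weight, of \<delta>] integrable_divide[OF i5, of \<delta>] by (rule Bochner_Integration.integrable_add)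
  show ii: "integrable lborel (\<lambda>\<xi>. of_real ((1 + norm \<xi>)\<^sup>2) * A \<xi>)"
    by (rule Bochner_Integration.integrable_bound[OF ib[of 1]]) (use pt[of 1] in \<open>auto intro!: AE_I2 order_trans[OF _ abs_ge_self]\<close>)
  have le: "(LINT \<xi>|lborel. norm (of_real ((1 + norm \<xi>)\<^sup>2) * A \<xi>)) \<le> \<delta> * C + N2 / \<delta>" if "\<delta> > 0" for \<delta>
  proof -
    have "(LINT \<xi>|lborel. norm (of_real ((1 + norm \<xi>)\<^sup>2) * A \<xi>)) \<le> (LINT \<xi>|lborel. \<delta> * (1 / ?w \<xi> ^ 3) + (?w \<xi> ^ 5 * (norm (A \<xi>))\<^sup>2) / \<delta>)"
      by (rule integral_mono[OF integrable_norm[OF ii] ib pt[OF that]])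
    also have "\<dots> = \<delta> * C + N2 / \<delta>"
      unfolding C_def N2_def
      by (subst Bochner_Integration.integral_add)
        (use integrable_mult_right[OF integrable_weight, of \<delta>] integrable_divide[OF i5, of \<delta>]
          in \<open>auto simp only: integral_mult_right_zero integral_divide_zero\<close>)
    finally show ?thesis .
  qed
  have N20: "N2 \<ge> 0" and C0: "C \<ge> 0" unfolding N2_def C_def using wpos by (auto intro!: integral_nonneg_AE AE_I2 simp: less_imp_le)
  have "(LINT \<xi>|lborel. norm (of_real ((1 + norm \<xi>)\<^sup>2) * A \<xi>)) \<le> sqrt N2 * (C + 1)"
  proof (cases "N2 = 0")
    case False
    then show ?thesis using le[of "sqrt N2"] N20 by (simp add: real_div_sqrt algebra_simps)
  next
    case True
    have "(LINT \<xi>|lborel. norm (of_real ((1 + norm \<xi>)\<^sup>2) * A \<xi>)) \<le> 0 + e" if "e > 0" for e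
    proof -
      have "(LINT \<xi>|lborel. norm (of_real ((1 + norm \<xi>)\<^sup>2) * A \<xi>)) \<le> e / (C + 1) * C"
        using le[of "e / (C + 1)"] that C0 True by simp
      also have "\<dots> \<le> e" using that C0 by (simp add: field_simps)
      finally show ?thesis by simp
    qed
    then have "(LINT \<xi>|lborel. norm (of_real ((1 + norm \<xi>)\<^sup>2) * A \<xi>)) \<le> 0" by (rule field_le_epsilon)
    then show ?thesis using True by simp
  qed
  moreover have "(LINT \<xi>|lborel. (1 + (norm \<xi>)\<^sup>2) powr 5 * (norm (A \<xi>))\<^sup>2) = N2"
    unfolding N2_def using wpos by (simp add: powr_numeral)
  ultimately show "(LINT \<xi>|lborel. norm (of_real ((1 + norm \<xi>)\<^sup>2) * A \<xi>)) \<le>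
      sqrt (LINT \<xi>|lborel. (1 + (norm \<xi>)\<^sup>2) powr 5 * (norm (A \<xi>))\<^sup>2) * ((LINT \<xi>::R3|lborel. 1 / (1 + (norm \<xi>)\<^sup>2) ^ 3) + 1)"
    by (simp add: C_def)
qed

lemma is_fourier_diff:
  assumes f: "temperate_function f" "is_fourier (distribution_of f) A" and g: "temperate_function g" "is_fourier (distribution_of g) B"
  shows "temperate_function (\<lambda>x. f x - g x)" "is_fourier (distribution_of (\<lambda>x. f x - g x)) (\<lambda>\<xi>. A \<xi> - B \<xi>)"
proof -
  have d: "temperate_function (\<lambda>x. f x - g x) \<and> (\<forall>\<phi>. schwartz \<phi> \<longrightarrow> distribution_of (\<lambda>x. f x - g x) \<phi> = distribution_of f \<phi> - distribution_of g \<phi>)"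
    if "temperate_function f" "temperate_function g" for f g
    using that by (auto simp: temperate_function_def left_diff_distrib distribution_of_def)
  show "temperate_function (\<lambda>x. f x - g x)" using d f g by blast
  show "is_fourier (distribution_of (\<lambda>x. f x - g x)) (\<lambda>\<xi>. A \<xi> - B \<xi>)"
    using d[OF f(1) g(1)] d[of A B] f(2) g(2) schwartz_ft unfolding is_fourier_def by auto
qed

lemma sobolev_L1_cont:
  assumes f: "continuous_in_sobolev T 5 f"
  shows "L1_cont {0..<T} (\<lambda>t \<xi>. of_real ((1 + norm \<xi>) ^ 2) * fourier (distribution_of (f t)) \<xi>)"
proof -
  define U where "U t = fourier (distribution_of (f t))" for t
  have sob: "sobolev 5 (f t)" if "t \<in> {0..<T}" for t using f that by (simp add: continuous_in_sobolev_def)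
  have tmp: "temperate_function (f t)" if "t \<in> {0..<T}" for t using sob[OF that] by (simp add: sobolev_def)
  have U: "is_fourier (distribution_of (f t)) (U t)" if "t \<in> {0..<T}" for t
    using sob[OF that] is_fourier_fourier unfolding U_def sobolev_def has_fourier_def by blast
  note Um = is_fourier_measurable[OF U]
  have Ui: "integrable lborel (\<lambda>\<xi>. (1 + (norm \<xi>)\<^sup>2) powr 5 * (norm (U t \<xi>))\<^sup>2)" if "t \<in> {0..<T}" for t
    using sob[OF that] by (simp add: sobolev_def U_def)
  let ?C = "(LINT \<xi>::R3|lborel. 1 / (1 + (norm \<xi>)\<^sup>2) ^ 3) + 1"
  have "L1_cont {0..<T} (\<lambda>t \<xi>. of_real ((1 + norm \<xi>) ^ 2) * U t \<xi>)"
  proof (rule L1_contI)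
    fix t assume t: "t \<in> {0..<T}"
    show "integrable lborel (\<lambda>\<xi>. of_real ((1 + norm \<xi>) ^ 2) * U t \<xi>)" if "t \<in> {0..<T}" for t
      by (rule sobolev_integrable[OF Um[OF that] Ui[OF that]])
    have "((\<lambda>\<tau>. sobolev_norm 5 (\<lambda>x. f \<tau> x - f t x)) \<longlongrightarrow> 0) (at t within {0..<T})"
      using f t by (simp add: continuous_in_sobolev_def)
    then show "((\<lambda>\<tau>. sobolev_norm 5 (\<lambda>x. f \<tau> x - f t x) * ?C) \<longlongrightarrow> 0) (at t within {0..<T})"
      by (rule tendsto_mult_left_zero)
    fix \<tau> assume \<tau>: "\<tau> \<in> {0..<T}"
    note [measurable] = Um[OF t] Um[OF \<tau>]
    let ?D = "\<lambda>\<xi>. U \<tau> \<xi> - U t \<xi>"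
    have Di: "integrable lborel (\<lambda>\<xi>. (1 + (norm \<xi>)\<^sup>2) powr 5 * (norm (?D \<xi>))\<^sup>2)"
    proof (rule Bochner_Integration.integrable_bound)
      show "integrable lborel (\<lambda>\<xi>. 2 * ((1 + (norm \<xi>)\<^sup>2) powr 5 * (norm (U \<tau> \<xi>))\<^sup>2 + (1 + (norm \<xi>)\<^sup>2) powr 5 * (norm (U t \<xi>))\<^sup>2))"
        by (intro integrable_mult_right Bochner_Integration.integrable_add Ui t \<tau>)
      show "AE \<xi> in lborel. norm ((1 + (norm \<xi>)\<^sup>2) powr 5 * (norm (?D \<xi>))\<^sup>2) \<le>
        norm (2 * ((1 + (norm \<xi>)\<^sup>2) powr 5 * (norm (U \<tau> \<xi>))\<^sup>2 + (1 + (norm \<xi>)\<^sup>2) powr 5 * (norm (U t \<xi>))\<^sup>2))"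
      proof (intro AE_I2)
        fix \<xi> :: R3
        have "(norm (?D \<xi>))\<^sup>2 \<le> (norm (U \<tau> \<xi>) + norm (U t \<xi>))\<^sup>2" by (intro power_mono norm_triangle_ineq4) simp
        also have "\<dots> \<le> 2 * ((norm (U \<tau> \<xi>))\<^sup>2 + (norm (U t \<xi>))\<^sup>2)"
          using zero_le_power2[of "norm (U \<tau> \<xi>) - norm (U t \<xi>)"] by (simp add: power2_sum power2_diff)
        finally have "(1 + (norm \<xi>)\<^sup>2) powr 5 * (norm (?D \<xi>))\<^sup>2 \<le> (1 + (norm \<xi>)\<^sup>2) powr 5 * (2 * ((norm (U \<tau> \<xi>))\<^sup>2 + (norm (U t \<xi>))\<^sup>2))"
          by (rule mult_left_mono) simp
        then show "norm ((1 + (norm \<xi>)\<^sup>2) powr 5 * (norm (?D \<xi>))\<^sup>2) \<le>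
          norm (2 * ((1 + (norm \<xi>)\<^sup>2) powr 5 * (norm (U \<tau> \<xi>))\<^sup>2 + (1 + (norm \<xi>)\<^sup>2) powr 5 * (norm (U t \<xi>))\<^sup>2))"
          by (simp add: algebra_simps)
      qed
    qed simp
    let ?F = "fourier (distribution_of (\<lambda>x. f \<tau> x - f t x))"
    have dF: "is_fourier (distribution_of (\<lambda>x. f \<tau> x - f t x)) ?D"
      by (rule is_fourier_diff(2)) (use tmp t \<tau> U in auto)
    note [measurable] = is_fourier_measurable[OF is_fourier_fourier[OF dF]]
    have "sobolev_norm 5 (\<lambda>x. f \<tau> x - f t x) = sqrt (LINT \<xi>|lborel. (1 + (norm \<xi>)\<^sup>2) powr 5 * (norm (?D \<xi>))\<^sup>2)"
      unfolding sobolev_norm_def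
      by (intro arg_cong[of _ _ sqrt] integral_cong_AE) (use is_fourier_imp_AE[OF dF] in \<open>auto elim!: eventually_mono\<close>)
    moreover have "(LINT \<xi>|lborel. norm (of_real ((1 + norm \<xi>)\<^sup>2) * ?D \<xi>)) \<le> sqrt (LINT \<xi>|lborel. (1 + (norm \<xi>)\<^sup>2) powr 5 * (norm (?D \<xi>))\<^sup>2) * ?C"
      by (rule sobolev_L1_le) (use Di in auto)
    ultimately show "(LINT \<xi>|lborel. norm (of_real ((1 + norm \<xi>) ^ 2) * U \<tau> \<xi> - of_real ((1 + norm \<xi>) ^ 2) * U t \<xi>)) \<le> sobolev_norm 5 (\<lambda>x. f \<tau> x - f t x) * ?C"
      by (simp only: right_diff_distrib)
  qed
  then show ?thesis by (simp add: U_def)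
qed

section \<open>Time integrals of gradient fields\<close>

text \<open>The potential is \<open>\<integral>\<^sub>a\<^sup>b (q(\<tau>,x) - q(\<tau>,0)) d\<tau>\<close>; subtracting the value at the origin makes the integrand
  continuous in \<open>\<tau>\<close>, although \<open>q(\<tau>,x)\<close> itself may depend on \<open>\<tau>\<close> in any way.\<close>

lemma gradient_time_integral:
  fixes q :: "real \<Rightarrow> R3 \<Rightarrow> real" and E :: "real \<Rightarrow> R3 \<Rightarrow> R3"
  assumes q: "\<And>\<tau> x. \<tau> \<in> {a..b} \<Longrightarrow> (q \<tau> has_derivative (\<lambda>d. d \<bullet> E \<tau> x)) (at x)"
    and E: "continuous_on ({a..b} \<times> UNIV) (\<lambda>(\<tau>, x). E \<tau> x)"
  defines "Q \<equiv> \<lambda>x. integral {a..b} (\<lambda>\<tau>. E \<tau> x)"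
  assumes B: "\<And>x. norm (Q x) \<le> B"
  shows "\<exists>P. (\<forall>x. (P has_derivative (\<lambda>d. d \<bullet> Q x)) (at x)) \<and> (\<forall>x. \<bar>P x\<bar> \<le> B * norm x)"
proof -
  have E': "continuous_on (UNIV \<times> {a..b}) (\<lambda>(x, \<tau>). E \<tau> x)"
  proof -
    have "continuous_on (UNIV \<times> {a..b}) (\<lambda>p :: R3 \<times> real. (\<lambda>(\<tau>, x). E \<tau> x) (snd p, fst p))"
      by (rule continuous_on_compose2[OF E]) (auto intro!: continuous_intros)
    then show ?thesis by (simp add: case_prod_unfold)
  qed
  have Ei: "(\<lambda>\<tau>. E \<tau> x) integrable_on {a..b}" for x
  proof -
    have "continuous_on {a..b} (\<lambda>\<tau>. (\<lambda>(\<tau>, x). E \<tau> x) (\<tau>, x))"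
      by (rule continuous_on_compose2[OF E]) (auto intro!: continuous_intros)
    then show ?thesis by (intro integrable_continuous_interval) simp
  qed
  have qi: "(\<lambda>\<tau>. q \<tau> x - q \<tau> 0) integrable_on {a..b}" for x
  proof -
    have "((\<lambda>r. x \<bullet> E \<tau> (r *\<^sub>R x)) has_integral (q \<tau> (1 *\<^sub>R x) - q \<tau> (0 *\<^sub>R x))) {0..1}" if "\<tau> \<in> {a..b}" for \<tau>
    proof (rule fundamental_theorem_of_calculus)
      fix r :: real
      show "((\<lambda>r. q \<tau> (r *\<^sub>R x)) has_vector_derivative x \<bullet> E \<tau> (r *\<^sub>R x)) (at r within {0..1})"
        using has_derivative_line[of "q \<tau>" "\<lambda>d. d \<bullet> E \<tau> (r *\<^sub>R x)" 0 r x] q[OF that]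
        by (auto intro: has_vector_derivative_at_within)
    qed simp
    from integral_unique[OF this]
    have eq: "q \<tau> x - q \<tau> 0 = integral (cbox 0 1) (\<lambda>r. x \<bullet> E \<tau> (r *\<^sub>R x))" if "\<tau> \<in> {a..b}" for \<tau>
      using that by simp
    have "continuous_on ({a..b} \<times> cbox 0 1) (\<lambda>(\<tau>, r::real). x \<bullet> E \<tau> (r *\<^sub>R x))"
    proof -
      have "continuous_on ({a..b} \<times> cbox 0 1) (\<lambda>p :: real \<times> real. (\<lambda>(\<tau>, x). E \<tau> x) (fst p, snd p *\<^sub>R x))"
        by (rule continuous_on_compose2[OF E]) (auto intro!: continuous_intros)
      then show ?thesis by (auto simp: case_prod_unfold intro!: continuous_intros)
    qed
    then have "continuous_on {a..b} (\<lambda>\<tau>. integral (cbox 0 1) (\<lambda>r. x \<bullet> E \<tau> (r *\<^sub>R x)))"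
      by (rule integral_continuous_on_param)
    then have "continuous_on {a..b} (\<lambda>\<tau>. q \<tau> x - q \<tau> 0)"
      by (rule continuous_on_eq) (simp add: eq)
    then show ?thesis by (rule integrable_continuous_interval)
  qed
  define P where "P x = integral {a..b} (\<lambda>\<tau>. q \<tau> x - q \<tau> 0)" for x
  have P: "(P has_derivative (\<lambda>d. d \<bullet> Q x)) (at x)" for x
  proof -
    have cont: "continuous_on (UNIV \<times> cbox a b) (\<lambda>(x, \<tau>). blinfun_inner_left (E \<tau> x))"
      using bounded_linear.continuous_on[OF bounded_linear_blinfun_inner_left E'] by (simp add: case_prod_unfold)
    have "((\<lambda>x. integral (cbox a b) (\<lambda>\<tau>. q \<tau> x - q \<tau> 0)) has_derivative
       blinfun_apply (integral (cbox a b) (\<lambda>\<tau>. blinfun_inner_left (E \<tau> x)))) (at x within UNIV)"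
    proof (rule leibniz_rule[OF _ _ cont])
      show "((\<lambda>x. q \<tau> x - q \<tau> 0) has_derivative blinfun_apply (blinfun_inner_left (E \<tau> x))) (at x)" if "\<tau> \<in> cbox a b" for x \<tau>
        using has_derivative_diff[OF q has_derivative_const] that by simp
    qed (use qi in auto)
    moreover have "integral {a..b} (\<lambda>\<tau>. blinfun_inner_left (E \<tau> x)) = blinfun_inner_left (Q x)"
      unfolding Q_def using integral_linear[OF Ei bounded_linear_blinfun_inner_left] by (simp add: o_def)
    ultimately show ?thesis unfolding P_def[abs_def] by (simp add: cbox_interval)
  qed
  have "\<bar>P x\<bar> \<le> B * norm x" for x
  proof -
    have "norm (P x - P 0) \<le> B * norm (x - 0)"
    proof (rule differentiable_bound[of UNIV])
      show "(P has_derivative (\<lambda>d. d \<bullet> Q x)) (at x within UNIV)" for x using P by simp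
      show "onorm (\<lambda>d. d \<bullet> Q x) \<le> B" for x
      proof (rule onorm_le)
        fix d
        have "\<bar>d \<bullet> Q x\<bar> \<le> norm d * norm (Q x)" by (rule Cauchy_Schwarz_ineq2)
        also have "\<dots> \<le> norm d * B" using B by (intro mult_left_mono) auto
        finally show "norm (d \<bullet> Q x) \<le> B * norm d" by (simp add: mult.commute)
      qed
    qed auto
    then show ?thesis by (simp add: P_def)
  qed
  with P show ?thesis by blast
qed

text \<open>Integration by parts, allowed by the linear growth of \<open>P\<close>. With \<open>g = \<partial>\<^sub>j \<theta>\<close> the right side is symmetric
  in \<open>j\<close> and \<open>k\<close>.\<close>

lemma weak_curl_free:
  fixes P :: "R3 \<Rightarrow> real" and Q :: "R3 \<Rightarrow> R3"
  assumes P: "\<And>x. (P has_derivative (\<lambda>d. d \<bullet> Q x)) (at x)" "\<And>x. \<bar>P x\<bar> \<le> B * norm x"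
    and Q: "continuous_on UNIV Q" "\<And>x. norm (Q x) \<le> B"
    and g: "schwartz g"
  shows "(LINT x|lborel. of_real (Q x $ k) * g x) = - (LINT x|lborel. of_real (P x) * pd k g x)"
proof -
  note sg = schwartz_pd[OF g, of k]
  have B0: "B \<ge> 0" using Q(2)[of 0] norm_ge_zero order_trans by blast
  have Pc: "continuous_on UNIV P" using P(1) has_derivative_continuous by (intro continuous_at_imp_continuous_on) blast
  note [measurable] = borel_measurable_continuous_onI[OF Pc] borel_measurable_continuous_onI[OF Q(1)]
    schwartz_measurable[OF g] schwartz_measurable[OF sg]
  have Qm [measurable]: "(\<lambda>x. Q x $ k) \<in> borel_measurable borel"
    by (intro borel_measurable_continuous_onI continuous_on_component Q)
  have Qk: "\<bar>Q x $ k\<bar> \<le> B" for x using component_le_norm_cart[of "Q x" k] Q(2)[of x] by linarith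
  have dec: "\<exists>C. \<forall>x. (1 + norm x) ^ 6 * norm (of_real (f x) * \<psi> x) \<le> C" if \<psi>: "schwartz \<psi>" and f: "\<And>x. \<bar>f x\<bar> \<le> B * (1 + norm x)" for f \<psi>
  proof -
    obtain C where C: "\<And>x. (1 + norm x) ^ 7 * norm (\<psi> x) \<le> C" by (rule schwartz_decay[OF \<psi>, of 7]) blast
    have "(1 + norm x) ^ 6 * norm (of_real (f x) * \<psi> x) \<le> B * C" for x
    proof -
      have "(1 + norm x) ^ 6 * norm (\<psi> x) * \<bar>f x\<bar> \<le> (1 + norm x) ^ 6 * norm (\<psi> x) * (B * (1 + norm x))"
        by (intro mult_left_mono f) auto
      also have "\<dots> = B * ((1 + norm x) ^ 7 * norm (\<psi> x))" by (simp add: eval_nat_numeral mult_ac)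
      also have "\<dots> \<le> B * C" using C B0 by (intro mult_left_mono) auto
      finally show ?thesis by (simp add: norm_mult mult_ac)
    qed
    then show ?thesis by blast
  qed
  have fP: "\<bar>P x\<bar> \<le> B * (1 + norm x)" for x using P(2)[of x] B0 by (simp add: algebra_simps)
  have fQ: "\<bar>Q x $ k\<bar> \<le> B * (1 + norm x)" for x
    using Qk[of x] B0 by (simp add: algebra_simps add_increasing2)
  obtain C1 where C1: "\<And>x. (1 + norm x) ^ 6 * norm (of_real (P x) * g x) \<le> C1" using dec[OF g fP] by blast
  obtain C2 where C2: "\<And>x. (1 + norm x) ^ 6 * norm (of_real (P x) * pd k g x) \<le> C2" using dec[OF sg fP] by blast
  obtain C3 where C3: "\<And>x. (1 + norm x) ^ 6 * norm (of_real (Q x $ k) * g x) \<le> C3" using dec[OF g fQ] by blast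
  have i2: "integrable lborel (\<lambda>x. of_real (P x) * pd k g x)" and i3: "integrable lborel (\<lambda>x. of_real (Q x $ k) * g x)"
    using Qm by (auto intro!: integrable_decay[OF _ C2] integrable_decay[OF _ C3])
  have "(LINT x|lborel. of_real (P x) * pd k g x + of_real (Q x $ k) * g x) = 0"
  proof (rule integral_deriv_eq_0[of "\<lambda>x. of_real (P x) * g x" k])
    fix x s
    have "((\<lambda>s. P (x + s *\<^sub>R axis k 1)) has_vector_derivative Q (x + s *\<^sub>R axis k 1) $ k) (at s)"
      using has_derivative_line[OF P(1), where d = "axis k 1" and x = x and s = s] by (simp add: inner_axis')
    then have "((\<lambda>s. complex_of_real (P (x + s *\<^sub>R axis k 1))) has_vector_derivative of_real (Q (x + s *\<^sub>R axis k 1) $ k)) (at s)"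
      by (intro has_vector_derivative_of_real) (simp add: has_real_derivative_iff_has_vector_derivative)
    from has_vector_derivative_mult[OF this pd_line[OF schwartz_differentiable[OF g]]]
    show "((\<lambda>s. of_real (P (x + s *\<^sub>R axis k 1)) * g (x + s *\<^sub>R axis k 1)) has_vector_derivative
      of_real (P (x + s *\<^sub>R axis k 1)) * pd k g (x + s *\<^sub>R axis k 1) + of_real (Q (x + s *\<^sub>R axis k 1) $ k) * g (x + s *\<^sub>R axis k 1)) (at s)" .
  next
    fix x
    show "(1 + norm x) ^ 6 * norm (of_real (P x) * pd k g x + of_real (Q x $ k) * g x) \<le> C2 + C3"
    proof -
      have "(1 + norm x) ^ 6 * norm (of_real (P x) * pd k g x + of_real (Q x $ k) * g x) \<le>
        (1 + norm x) ^ 6 * (norm (of_real (P x) * pd k g x) + norm (of_real (Q x $ k) * g x))"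
        by (intro mult_left_mono norm_triangle_ineq) simp
      then show ?thesis using C2[of x] C3[of x] by (simp add: distrib_left)
    qed
  qed (use C1 in auto)
  then show ?thesis using i2 i3 by (simp add: add_eq_0_iff2 add.commute)
qed

section \<open>The evolution of frequency pairings\<close>

lemma integral_time_swap:
  assumes A: "L1_cont S A" and ab: "{a..b} \<subseteq> S" and \<psi>: "schwartz \<psi>"
  shows "(LINT x|lborel. integral {a..b} (\<lambda>\<tau>. inv_ft (A \<tau>) x) * ft \<psi> x) =
    integral {a..b} (\<lambda>\<tau>. LINT \<xi>|lborel. A \<tau> \<xi> * \<psi> \<xi>)"
proof -
  note s = schwartz_ft[OF \<psi>]
  note [measurable] = schwartz_measurable[OF s]
  obtain B where B: "\<And>t. t \<in> {a..b} \<Longrightarrow> (LINT \<xi>|lborel. norm (A t \<xi>)) \<le> B"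
    by (rule L1_cont_bounded[OF A _ ab]) auto
  have AB: "norm (inv_ft (A \<tau>) x) \<le> B" if "\<tau> \<in> {a..b}" for \<tau> x
    using norm_inv_ft_le[OF L1_contD[OF A subsetD[OF ab that]], of x] B[OF that] by linarith
  let ?I = "indicator {a..b} :: real \<Rightarrow> real"
  have cj: "continuous_on ({a..b} \<times> UNIV) (\<lambda>p. inv_ft (A (fst p)) (snd p))"
    using continuous_on_subset[OF continuous_on_inv_ft_joint[OF A], of "{a..b} \<times> UNIV"] ab by (auto simp: case_prod_unfold)
  have "(\<lambda>p::real \<times> R3. indicator ({a..b} \<times> UNIV) p *\<^sub>R inv_ft (A (fst p)) (snd p)) \<in> borel_measurable borel"
    by (rule borel_measurable_continuous_on_indicator[OF _ cj]) (auto intro!: borel_closed closed_Times)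
  then have m [measurable]: "(\<lambda>p::real \<times> R3. ?I (fst p) *\<^sub>R inv_ft (A (fst p)) (snd p)) \<in> borel_measurable (borel \<Otimes>\<^sub>M borel)"
    by (simp add: borel_prod indicator_times)
  have cont: "continuous_on {a..b} (\<lambda>\<tau>. inv_ft (A \<tau>) x)" for x
  proof -
    have "continuous_on {a..b} (\<lambda>\<tau>. inv_ft (A (fst (\<tau>, x))) (snd (\<tau>, x)))"
      by (rule continuous_on_compose2[OF cj]) (auto intro!: continuous_intros)
    then show ?thesis by simp
  qed
  have F: "integrable (lborel \<Otimes>\<^sub>M lborel) (\<lambda>(\<tau>, x). (?I \<tau> *\<^sub>R inv_ft (A \<tau>) x) * ft \<psi> x)"
  proof (rule lborel_pair.Fubini_integrable)
    show mm: "(\<lambda>(\<tau>, x). (?I \<tau> *\<^sub>R inv_ft (A \<tau>) x) * ft \<psi> x) \<in> borel_measurable (lborel \<Otimes>\<^sub>M lborel)"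
    proof -
      have "(\<lambda>p::real \<times> R3. ft \<psi> (snd p)) \<in> borel_measurable (borel \<Otimes>\<^sub>M borel)" by measurable
      from borel_measurable_times[OF m this] show ?thesis by (simp add: case_prod_unfold cong: measurable_cong_sets)
    qed
    have ix: "integrable lborel (\<lambda>x. (?I \<tau> *\<^sub>R inv_ft (A \<tau>) x) * ft \<psi> x)" for \<tau>
    proof (cases "\<tau> \<in> {a..b}")
      case True
      note [measurable] = inv_ft_measurable[OF L1_contD[OF A subsetD[OF ab True]]]
      show ?thesis by (rule integrable_bounded_mult[OF schwartz_integrable[OF s], where C = B]) (use AB[OF True] True in auto)
    qed simp
    then show "AE \<tau> in lborel. integrable lborel (\<lambda>x. case (\<tau>, x) of (\<tau>, x) \<Rightarrow> (?I \<tau> *\<^sub>R inv_ft (A \<tau>) x) * ft \<psi> x)" by simp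
    let ?n = "LINT x|lborel. norm (ft \<psi> x)"
    have le: "(LINT x|lborel. norm ((?I \<tau> *\<^sub>R inv_ft (A \<tau>) x) * ft \<psi> x)) \<le> B * ?n" if "\<tau> \<in> {a..b}" for \<tau>
    proof -
      have "(LINT x|lborel. norm ((?I \<tau> *\<^sub>R inv_ft (A \<tau>) x) * ft \<psi> x)) \<le> (LINT x|lborel. B * norm (ft \<psi> x))"
      proof (rule integral_mono)
        show "integrable lborel (\<lambda>x. norm ((?I \<tau> *\<^sub>R inv_ft (A \<tau>) x) * ft \<psi> x))" using ix by (rule integrable_norm)
      qed (use AB[OF that] that schwartz_integrable[OF s] in \<open>auto simp: norm_mult intro!: mult_right_mono\<close>)
      then show ?thesis by simp
    qed
    show "integrable lborel (\<lambda>\<tau>. LINT x|lborel. norm (case (\<tau>, x) of (\<tau>, x) \<Rightarrow> (?I \<tau> *\<^sub>R inv_ft (A \<tau>) x) * ft \<psi> x))"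
    proof (rule Bochner_Integration.integrable_bound)
      show "integrable lborel (\<lambda>\<tau>. ?I \<tau> *\<^sub>R (B * ?n))"
        using borel_integrable_atLeastAtMost'[of a b "\<lambda>_. B * ?n"] by (simp add: set_integrable_def)
      show "(\<lambda>\<tau>. LINT x|lborel. norm (case (\<tau>, x) of (\<tau>, x) \<Rightarrow> (?I \<tau> *\<^sub>R inv_ft (A \<tau>) x) * ft \<psi> x)) \<in> borel_measurable lborel"
        using mm by measurable
      show "AE \<tau> in lborel. norm (LINT x|lborel. norm (case (\<tau>, x) of (\<tau>, x) \<Rightarrow> (?I \<tau> *\<^sub>R inv_ft (A \<tau>) x) * ft \<psi> x)) \<le> norm (?I \<tau> *\<^sub>R (B * ?n))"
      proof (intro AE_I2)
        fix \<tau>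
        show "norm (LINT x|lborel. norm (case (\<tau>, x) of (\<tau>, x) \<Rightarrow> (?I \<tau> *\<^sub>R inv_ft (A \<tau>) x) * ft \<psi> x)) \<le> norm (?I \<tau> *\<^sub>R (B * ?n))"
        proof (cases "\<tau> \<in> {a..b}")
          case True
          then show ?thesis using order_trans[OF le[OF True] abs_ge_self] by simp
        qed simp
      qed
    qed
  qed
  have tau: "(LINT \<tau>|lborel. ?I \<tau> *\<^sub>R h \<tau>) = integral {a..b} h" if "continuous_on {a..b} h" for h :: "real \<Rightarrow> complex"
    using set_borel_integral_eq_integral(2)[OF borel_integrable_atLeastAtMost'[OF that]] by (simp add: set_lebesgue_integral_def)
  have "(LINT x|lborel. integral {a..b} (\<lambda>\<tau>. inv_ft (A \<tau>) x) * ft \<psi> x) = (LINT x|lborel. LINT \<tau>|lborel. (?I \<tau> *\<^sub>R inv_ft (A \<tau>) x) * ft \<psi> x)"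
    by (simp only: integral_mult_left_zero tau[OF cont])
  also have "\<dots> = (LINT \<tau>|lborel. LINT x|lborel. (?I \<tau> *\<^sub>R inv_ft (A \<tau>) x) * ft \<psi> x)"
    by (rule lborel_pair.Fubini_integral[OF F])
  also have "\<dots> = (LINT \<tau>|lborel. ?I \<tau> *\<^sub>R (LINT \<xi>|lborel. \<psi> \<xi> * A \<tau> \<xi>))"
  proof (rule Bochner_Integration.integral_cong[OF refl])
    fix \<tau>
    show "(LINT x|lborel. (?I \<tau> *\<^sub>R inv_ft (A \<tau>) x) * ft \<psi> x) = ?I \<tau> *\<^sub>R (LINT \<xi>|lborel. \<psi> \<xi> * A \<tau> \<xi>)"
    proof (cases "\<tau> \<in> {a..b}")
      case True
      have "(LINT x|lborel. inv_ft (A \<tau>) x * ft \<psi> x) = (LINT \<xi>|lborel. A \<tau> \<xi> * inv_ft (ft \<psi>) \<xi>)"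
        by (rule inv_ft_duality[OF L1_contD[OF A subsetD[OF ab True]] schwartz_integrable[OF s]])
      then show ?thesis using True by (simp add: inv_ft_ft[OF \<psi>] mult.commute)
    qed simp
  qed
  also have "\<dots> = integral {a..b} (\<lambda>\<tau>. LINT \<xi>|lborel. \<psi> \<xi> * A \<tau> \<xi>)"
  proof (rule tau)
    obtain C where "\<And>x. norm (\<psi> x) \<le> C" by (rule schwartz_bounded[OF \<psi>]) blast
    then have "continuous_on S (\<lambda>\<tau>. LINT \<xi>|lborel. \<psi> \<xi> * A \<tau> \<xi>)"
      by (intro continuous_on_L1_pairing[OF A schwartz_measurable[OF \<psi>], of C]) auto
    then show "continuous_on {a..b} (\<lambda>\<tau>. LINT \<xi>|lborel. \<psi> \<xi> * A \<tau> \<xi>)" using ab by (rule continuous_on_subset)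
  qed
  finally show ?thesis by (simp add: mult.commute)
qed

text \<open>How far \<open>\<integral> m W = \<integral>\<^sub>a\<^sup>b (\<integral> m A(\<tau>)) d\<tau>\<close> is from being true, as a functional of the bounded symbol \<open>m\<close>.\<close>

definition defect :: "(R3 \<Rightarrow> complex) \<Rightarrow> (real \<Rightarrow> R3 \<Rightarrow> complex) \<Rightarrow> real \<Rightarrow> real \<Rightarrow> (R3 \<Rightarrow> complex) \<Rightarrow> complex" where
  "defect W A a b m = (LINT \<xi>|lborel. m \<xi> * W \<xi>) - integral {a..b} (\<lambda>\<tau>. LINT \<xi>|lborel. m \<xi> * A \<tau> \<xi>)"

definition bdd :: "(R3 \<Rightarrow> complex) \<Rightarrow> bool" where
  "bdd m \<longleftrightarrow> m \<in> borel_measurable borel \<and> (\<exists>C. \<forall>\<xi>. norm (m \<xi>) \<le> C)"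

lemma bdd_add: "bdd m \<Longrightarrow> bdd n \<Longrightarrow> bdd (\<lambda>\<xi>. m \<xi> + n \<xi>)"
  unfolding bdd_def by auto (meson norm_triangle_mono)

lemma bdd_const: "bdd (\<lambda>_. c)"
  unfolding bdd_def by auto

lemma bdd_sum: "finite I \<Longrightarrow> (\<And>i. i \<in> I \<Longrightarrow> bdd (m i)) \<Longrightarrow> bdd (\<lambda>\<xi>. \<Sum>i\<in>I. m i \<xi>)"
  by (induction I rule: finite_induct) (auto intro: bdd_add bdd_const)

lemma bdd_integrable:
  assumes "bdd m" "integrable lborel F" shows "integrable lborel (\<lambda>\<xi>. m \<xi> * F \<xi>)"
proof -
  obtain C where "\<And>\<xi>. norm (m \<xi>) \<le> C" using assms(1) unfolding bdd_def by blast
  then show ?thesis using assms unfolding bdd_def by (intro integrable_bounded_mult[where C = C]) auto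
qed

context
  fixes W :: "R3 \<Rightarrow> complex" and A :: "real \<Rightarrow> R3 \<Rightarrow> complex" and S :: "real set" and a b :: real
  assumes W: "integrable lborel W" and A: "L1_cont S A" and ab: "{a..b} \<subseteq> S"
begin

lemma bdd_cont: "bdd m \<Longrightarrow> continuous_on {a..b} (\<lambda>\<tau>. LINT \<xi>|lborel. m \<xi> * A \<tau> \<xi>)"
  unfolding bdd_def using continuous_on_subset[OF continuous_on_L1_pairing[OF A] ab] by blast

lemma defect_linear:
  assumes m: "bdd m" and n: "bdd n"
  shows "defect W A a b (\<lambda>\<xi>. m \<xi> + c * n \<xi>) = defect W A a b m + c * defect W A a b n"
proof -
  have e: "(LINT \<xi>|lborel. (m \<xi> + c * n \<xi>) * F \<xi>) = (LINT \<xi>|lborel. m \<xi> * F \<xi>) + c * (LINT \<xi>|lborel. n \<xi> * F \<xi>)"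
    if "integrable lborel F" for F
    using bdd_integrable[OF m that] bdd_integrable[OF n that] by (simp add: distrib_right mult.assoc)
  have "integral {a..b} (\<lambda>\<tau>. LINT \<xi>|lborel. (m \<xi> + c * n \<xi>) * A \<tau> \<xi>) =
      integral {a..b} (\<lambda>\<tau>. (LINT \<xi>|lborel. m \<xi> * A \<tau> \<xi>) + c * (LINT \<xi>|lborel. n \<xi> * A \<tau> \<xi>))"
    by (rule integral_cong) (use e L1_contD[OF A] ab in auto)
  also have "\<dots> = integral {a..b} (\<lambda>\<tau>. LINT \<xi>|lborel. m \<xi> * A \<tau> \<xi>) + c * integral {a..b} (\<lambda>\<tau>. LINT \<xi>|lborel. n \<xi> * A \<tau> \<xi>)"
    by (subst integral_add) (auto intro!: integrable_continuous_interval continuous_on_mult continuous_on_const bdd_cont m n)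
  finally show ?thesis unfolding defect_def using e[OF W] by (simp add: algebra_simps)
qed

lemma defect_sum:
  assumes "finite I" "\<And>i. i \<in> I \<Longrightarrow> bdd (m i)"
  shows "defect W A a b (\<lambda>\<xi>. \<Sum>i\<in>I. m i \<xi>) = (\<Sum>i\<in>I. defect W A a b (m i))"
  using assms
proof (induction I rule: finite_induct)
  case empty
  show ?case by (simp add: defect_def)
next
  case (insert i I)
  then show ?case using defect_linear[of "m i" "\<lambda>\<xi>. \<Sum>i\<in>I. m i \<xi>" 1] by (auto intro: bdd_sum)
qed

lemma defect_conv:
  assumes m [measurable]: "\<And>n. m n \<in> borel_measurable borel" and l [measurable]: "l \<in> borel_measurable borel"
    and C: "\<And>n \<xi>. norm (m n \<xi>) \<le> C"
    and lim: "AE \<xi> in lborel. (\<lambda>n. m n \<xi>) \<longlonglongrightarrow> l \<xi>"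
  shows "(\<lambda>n. defect W A a b (m n)) \<longlonglongrightarrow> defect W A a b l"
proof -
  have C': "C \<ge> 0" using C[of 0 0] norm_ge_zero order_trans by blast
  have mb: "bdd (m n)" for n using C m unfolding bdd_def by blast
  have e: "(\<lambda>n. LINT \<xi>|lborel. m n \<xi> * F \<xi>) \<longlonglongrightarrow> (LINT \<xi>|lborel. l \<xi> * F \<xi>)" if F: "integrable lborel F" for F
  proof (rule integral_dominated_convergence[where w = "\<lambda>\<xi>. C * norm (F \<xi>)"])
    have [measurable]: "F \<in> borel_measurable borel" using F by auto
    show "AE \<xi> in lborel. (\<lambda>n. m n \<xi> * F \<xi>) \<longlonglongrightarrow> l \<xi> * F \<xi>"
      using lim by (rule eventually_mono) (rule tendsto_mult_right)
    show "AE \<xi> in lborel. norm (m n \<xi> * F \<xi>) \<le> C * norm (F \<xi>)" for n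
      using C by (intro AE_I2) (simp add: norm_mult mult_right_mono)
    show "integrable lborel (\<lambda>\<xi>. C * norm (F \<xi>))" using F by auto
    show "(\<lambda>\<xi>. m n \<xi> * F \<xi>) \<in> borel_measurable lborel" for n by measurable
    show "(\<lambda>\<xi>. l \<xi> * F \<xi>) \<in> borel_measurable lborel" by measurable
  qed
  obtain B where B: "\<And>t. t \<in> {a..b} \<Longrightarrow> (LINT \<xi>|lborel. norm (A t \<xi>)) \<le> B"
    by (rule L1_cont_bounded[OF A _ ab]) auto
  have "(\<lambda>n. integral {a..b} (\<lambda>\<tau>. LINT \<xi>|lborel. m n \<xi> * A \<tau> \<xi>)) \<longlonglongrightarrow> integral {a..b} (\<lambda>\<tau>. LINT \<xi>|lborel. l \<xi> * A \<tau> \<xi>)"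
  proof (rule dominated_convergence(2)[where h = "\<lambda>_. C * B"])
    show "(\<lambda>\<tau>. LINT \<xi>|lborel. m n \<xi> * A \<tau> \<xi>) integrable_on {a..b}" for n
      by (intro integrable_continuous_interval bdd_cont mb)
    fix \<tau> assume \<tau>: "\<tau> \<in> {a..b}"
    then have At: "integrable lborel (A \<tau>)" using L1_contD[OF A] ab by auto
    show "norm (LINT \<xi>|lborel. m n \<xi> * A \<tau> \<xi>) \<le> C * B" for n
    proof -
      have "norm (LINT \<xi>|lborel. m n \<xi> * A \<tau> \<xi>) \<le> (LINT \<xi>|lborel. norm (m n \<xi> * A \<tau> \<xi>))" by (rule integral_norm_bound)
      also have "\<dots> \<le> (LINT \<xi>|lborel. C * norm (A \<tau> \<xi>))"
      proof (rule integral_mono)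
        show "integrable lborel (\<lambda>\<xi>. norm (m n \<xi> * A \<tau> \<xi>))" using bdd_integrable[OF mb At] by (rule integrable_norm)
      qed (use At C in \<open>auto simp: norm_mult intro!: mult_right_mono\<close>)
      also have "\<dots> \<le> C * B" using B[OF \<tau>] C' by (simp add: mult_left_mono)
      finally show ?thesis .
    qed
    show "(\<lambda>n. LINT \<xi>|lborel. m n \<xi> * A \<tau> \<xi>) \<longlonglongrightarrow> (LINT \<xi>|lborel. l \<xi> * A \<tau> \<xi>)" by (rule e[OF At])
  qed auto
  then show ?thesis unfolding defect_def by (intro tendsto_diff e[OF W])
qed

end

lemma defect_AE_0:
  assumes W: "integrable lborel W" and A: "L1_cont S A" and ab: "{a..b} \<subseteq> S" and m: "m \<in> borel_measurable borel"
    and "AE \<xi> in lborel. m \<xi> = 0"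
  shows "defect W A a b m = 0"
proof -
  have e: "(LINT \<xi>|lborel. m \<xi> * F \<xi>) = 0" if "integrable lborel F" for F
  proof -
    have "(LINT \<xi>|lborel. m \<xi> * F \<xi>) = (LINT \<xi>::R3|lborel. 0)"
      by (rule integral_cong_AE) (use that assms(5) m in \<open>auto elim!: eventually_mono\<close>)
    then show ?thesis by simp
  qed
  have "integral {a..b} (\<lambda>\<tau>. LINT \<xi>|lborel. m \<xi> * A \<tau> \<xi>) = integral {a..b} (\<lambda>\<tau>. 0)"
    by (rule integral_cong) (use e L1_contD[OF A] ab in auto)
  then show ?thesis using e[OF W] by (simp add: defect_def)
qed

text \<open>For \<open>\<xi> \<cdot> m = 0\<close> one has \<open>|\<xi>|\<^sup>2 (m \<cdot> w) = \<Sum>\<^sub>j\<^sub>k m\<^sub>k \<xi>\<^sub>j (\<xi>\<^sub>j w\<^sub>k - \<xi>\<^sub>k w\<^sub>j)\<close>. Thus the test functions needed are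
  \<open>m\<^sub>k \<xi>\<^sub>j / |\<xi>|\<^sup>2\<close>; they are cut off to annuli, where \<open>functional_eq_0\<close> applies, and the annuli then
  exhaust the space.\<close>

lemma defect_div_free:
  fixes W :: "3 \<Rightarrow> R3 \<Rightarrow> complex" and A :: "3 \<Rightarrow> real \<Rightarrow> R3 \<Rightarrow> complex"
  assumes W: "\<And>k. integrable lborel (W k)" and A: "\<And>k. L1_cont S (A k)" and ab: "{a..b} \<subseteq> S"
    and curl: "\<And>j k \<phi>. schwartz \<phi> \<Longrightarrow> defect (W k) (A k) a b (\<lambda>\<xi>. of_real (\<xi> $ j) * \<phi> \<xi>) = defect (W j) (A j) a b (\<lambda>\<xi>. of_real (\<xi> $ k) * \<phi> \<xi>)"
    and m: "\<And>k. m k \<in> borel_measurable borel" "\<And>k \<xi>. norm (m k \<xi>) \<le> C"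
    and div: "AE \<xi> in lborel. (\<Sum>k\<in>UNIV. m k \<xi> * of_real (\<xi> $ k)) = 0"
  shows "(\<Sum>k\<in>UNIV. defect (W k) (A k) a b (m k)) = 0"
proof -
  note [measurable] = m(1)
  let ?d = "\<lambda>k. defect (W k) (A k) a b"
  note lin = defect_linear[OF W A ab] and sm = defect_sum[OF W A ab] and cv = defect_conv[OF W A ab] and z = defect_AE_0[OF W A ab]
  have crd: "norm (of_real (\<xi> $ j) * f \<xi>) \<le> r * r" "bdd (\<lambda>\<xi>. of_real (\<xi> $ j) * f \<xi>)" if f: "bsupp r f" for f r j \<xi>
  proof -
    have le: "norm (of_real (\<xi> $ j) * f \<xi>) \<le> r * r" for \<xi> :: R3
    proof (cases "norm \<xi> \<le> r")
      case True
      then have "\<bar>\<xi> $ j\<bar> \<le> r" "0 \<le> r" using component_le_norm_cart[of \<xi> j] norm_ge_zero[of \<xi>] by linarith+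
      then show ?thesis using f by (auto simp: norm_mult bsupp_def intro!: mult_mono)
    next
      case False
      then show ?thesis using f by (auto simp: bsupp_def)
    qed
    then show "norm (of_real (\<xi> $ j) * f \<xi>) \<le> r * r" by blast
    show "bdd (\<lambda>\<xi>. of_real (\<xi> $ j) * f \<xi>)" unfolding bdd_def using le f by (auto simp: bsupp_def)
  qed
  have curl': "?d k (\<lambda>\<xi>. of_real (\<xi> $ j) * f \<xi>) = ?d j (\<lambda>\<xi>. of_real (\<xi> $ k) * f \<xi>)" if f: "bsupp r f" for j k f r
  proof -
    have "?d k (\<lambda>\<xi>. of_real (\<xi> $ j) * f \<xi>) - ?d j (\<lambda>\<xi>. of_real (\<xi> $ k) * f \<xi>) = 0"
    proof (rule functional_eq_0[where L = "\<lambda>f. ?d k (\<lambda>\<xi>. of_real (\<xi> $ j) * f \<xi>) - ?d j (\<lambda>\<xi>. of_real (\<xi> $ k) * f \<xi>)", OF _ _ _ f])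
      fix f g c r assume f: "bsupp r f" and g: "bsupp r g"
      have "?d k (\<lambda>\<xi>. of_real (\<xi> $ j) * (f \<xi> + c * g \<xi>)) = ?d k (\<lambda>\<xi>. of_real (\<xi> $ j) * f \<xi>) + c * ?d k (\<lambda>\<xi>. of_real (\<xi> $ j) * g \<xi>)" for j k
      proof -
        have "?d k (\<lambda>\<xi>. of_real (\<xi> $ j) * f \<xi> + c * (of_real (\<xi> $ j) * g \<xi>)) = ?d k (\<lambda>\<xi>. of_real (\<xi> $ j) * f \<xi>) + c * ?d k (\<lambda>\<xi>. of_real (\<xi> $ j) * g \<xi>)"
          by (rule lin[OF crd(2)[OF f] crd(2)[OF g]])
        then show ?thesis by (simp add: algebra_simps)
      qed
      then show "?d k (\<lambda>\<xi>. of_real (\<xi> $ j) * (f \<xi> + c * g \<xi>)) - ?d j (\<lambda>\<xi>. of_real (\<xi> $ k) * (f \<xi> + c * g \<xi>)) =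
          ?d k (\<lambda>\<xi>. of_real (\<xi> $ j) * f \<xi>) - ?d j (\<lambda>\<xi>. of_real (\<xi> $ k) * f \<xi>) + c * (?d k (\<lambda>\<xi>. of_real (\<xi> $ j) * g \<xi>) - ?d j (\<lambda>\<xi>. of_real (\<xi> $ k) * g \<xi>))"
        by (simp add: algebra_simps)
    next
      fix F f r assume F: "\<And>n::nat. bsupp r (F n)" and lim: "\<And>x. (\<lambda>n. F n x) \<longlonglongrightarrow> f x"
      have [measurable]: "F n \<in> borel_measurable borel" for n using F by (simp add: bsupp_def)
      have [measurable]: "f \<in> borel_measurable borel" using lim by (rule borel_measurable_LIMSEQ_metric[of F, rotated]) simp
      have "(\<lambda>n. ?d k (\<lambda>\<xi>. of_real (\<xi> $ j) * F n \<xi>)) \<longlonglongrightarrow> ?d k (\<lambda>\<xi>. of_real (\<xi> $ j) * f \<xi>)" for j k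
        by (rule cv[OF _ _ crd(1)[OF F]]) (auto intro!: AE_I2 tendsto_mult_left lim)
      then show "(\<lambda>n. ?d k (\<lambda>\<xi>. of_real (\<xi> $ j) * F n \<xi>) - ?d j (\<lambda>\<xi>. of_real (\<xi> $ k) * F n \<xi>)) \<longlonglongrightarrow>
        ?d k (\<lambda>\<xi>. of_real (\<xi> $ j) * f \<xi>) - ?d j (\<lambda>\<xi>. of_real (\<xi> $ k) * f \<xi>)" by (intro tendsto_diff)
    qed (simp add: curl)
    then show ?thesis by simp
  qed
  have C0: "C \<ge> 0" using m(2)[of 0 0] norm_ge_zero order_trans by blast
  (* The annuli avoid both the singularity of the test functions at 0 and their slow decay. *)
  define I where "I n \<xi> = (indicator {\<xi>::R3. 1 / real (Suc n) \<le> norm \<xi> \<and> norm \<xi> \<le> real (Suc n)} \<xi> :: complex)" for n \<xi>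
  have I [measurable]: "I n \<in> borel_measurable borel" for n unfolding I_def by measurable
  have In: "norm (I n \<xi>) \<le> 1" for n \<xi> by (simp add: I_def indicator_def)
  define f where "f n k j \<xi> = I n \<xi> * m k \<xi> * (\<xi> $ j) / (norm \<xi>)\<^sup>2" for n k j \<xi>
  have fb: "bsupp ((C + 1) * real (Suc n)) (f n k j)" for n k j
    unfolding bsupp_def
  proof (intro conjI allI impI)
    show "f n k j \<in> borel_measurable borel" unfolding f_def by measurable
    fix \<xi> :: R3
    have "real (Suc n) \<le> (C + 1) * real (Suc n)" using C0 by (simp add: distrib_right)
    then show "f n k j \<xi> = 0" if "(C + 1) * real (Suc n) < norm \<xi>"
    proof -
      have "\<not> norm \<xi> \<le> real (Suc n)"
        using that \<open>real (Suc n) \<le> (C + 1) * real (Suc n)\<close> by linarith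
      then show ?thesis by (simp add: f_def I_def indicator_def)
    qed
    show "norm (f n k j \<xi>) \<le> (C + 1) * real (Suc n)"
    proof (cases "1 / real (Suc n) \<le> norm \<xi> \<and> norm \<xi> \<le> real (Suc n)")
      case True
      then have pos: "norm \<xi> > 0" by (metis divide_pos_pos of_nat_0_less_iff order_less_le_trans zero_less_Suc zero_less_one)
      have "norm (f n k j \<xi>) = norm (m k \<xi>) * (\<bar>\<xi> $ j\<bar> / (norm \<xi>)\<^sup>2)"
        using True by (simp add: f_def I_def norm_mult norm_divide norm_power)
      also have "\<dots> \<le> C * (norm \<xi> / (norm \<xi>)\<^sup>2)"
        using component_le_norm_cart[of \<xi> j] C0 by (intro mult_mono m divide_right_mono) auto
      also have "norm \<xi> / (norm \<xi>)\<^sup>2 = 1 / norm \<xi>" using pos by (simp add: power2_eq_square)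
      also have "1 / norm \<xi> \<le> real (Suc n)" using True pos by (simp add: field_simps)
      then have "C * (1 / norm \<xi>) \<le> (C + 1) * real (Suc n)" using C0 pos by (intro mult_mono) auto
      finally show ?thesis .
    qed (use C0 in \<open>auto simp: f_def I_def\<close>)
  qed
  have key: "(\<Sum>k\<in>UNIV. ?d k (\<lambda>\<xi>. I n \<xi> * m k \<xi>)) = 0" for n
  proof -
    have ne0: "\<xi> \<noteq> 0" if "I n \<xi> \<noteq> 0" for \<xi>
      using that by (auto simp: I_def indicator_def split: if_splits)
    have 1: "I n \<xi> * m k \<xi> = (\<Sum>j\<in>UNIV. of_real (\<xi> $ j) * f n k j \<xi>)" for k \<xi>
    proof (cases "I n \<xi> = 0")
      case False
      have "(\<Sum>j\<in>UNIV. complex_of_real (\<xi> $ j) * of_real (\<xi> $ j)) = of_real ((norm \<xi>)\<^sup>2)"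
        by (simp add: power2_norm_eq_inner inner_vec_def)
      then have "(\<Sum>j\<in>UNIV. of_real (\<xi> $ j) * f n k j \<xi>) = I n \<xi> * m k \<xi> * (of_real ((norm \<xi>)\<^sup>2) / of_real ((norm \<xi>)\<^sup>2))"
        by (simp add: f_def sum_distrib_left sum_divide_distrib mult_ac flip: sum_divide_distrib sum_distrib_left)
      then show ?thesis using ne0[OF False] by simp
    qed (simp add: f_def)
    have "(\<Sum>k\<in>UNIV. ?d k (\<lambda>\<xi>. I n \<xi> * m k \<xi>)) = (\<Sum>k\<in>UNIV. \<Sum>j\<in>UNIV. ?d k (\<lambda>\<xi>. of_real (\<xi> $ j) * f n k j \<xi>))"
      unfolding 1 by (intro sum.cong refl sm crd(2)[OF fb]) auto
    also have "\<dots> = (\<Sum>k\<in>UNIV. \<Sum>j\<in>UNIV. ?d j (\<lambda>\<xi>. of_real (\<xi> $ k) * f n k j \<xi>))"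
      by (intro sum.cong refl curl'[OF fb])
    also have "\<dots> = (\<Sum>j\<in>UNIV. \<Sum>k\<in>UNIV. ?d j (\<lambda>\<xi>. of_real (\<xi> $ k) * f n k j \<xi>))"
      by (rule sum.swap)
    also have "\<dots> = (\<Sum>j\<in>UNIV. ?d j (\<lambda>\<xi>. \<Sum>k\<in>UNIV. of_real (\<xi> $ k) * f n k j \<xi>))"
      by (intro sum.cong refl sm[symmetric] crd(2)[OF fb]) auto
    also have "\<dots> = (\<Sum>j\<in>(UNIV::3 set). 0)"
    proof (intro sum.cong refl z)
      fix j
      have [measurable]: "f n k j \<in> borel_measurable borel" for k using fb[of n k j] by (simp add: bsupp_def)
      show "(\<lambda>\<xi>. \<Sum>k\<in>UNIV. of_real (\<xi> $ k) * f n k j \<xi>) \<in> borel_measurable borel" by measurable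
      show "AE \<xi> in lborel. (\<Sum>k\<in>UNIV. of_real (\<xi> $ k) * f n k j \<xi>) = 0"
        using div
      proof (rule eventually_mono)
        fix \<xi> assume "(\<Sum>k\<in>UNIV. m k \<xi> * of_real (\<xi> $ k)) = 0"
        moreover have "(\<Sum>k\<in>UNIV. of_real (\<xi> $ k) * f n k j \<xi>) = (\<Sum>k\<in>UNIV. m k \<xi> * of_real (\<xi> $ k)) * (I n \<xi> * (\<xi> $ j) / (norm \<xi>)\<^sup>2)"
          unfolding sum_distrib_right by (intro sum.cong refl) (simp add: f_def)
        ultimately show "(\<Sum>k\<in>UNIV. of_real (\<xi> $ k) * f n k j \<xi>) = 0" by simp
      qed
    qed
    finally show ?thesis by simp
  qed
  have "(\<lambda>n. \<Sum>k\<in>UNIV. ?d k (\<lambda>\<xi>. I n \<xi> * m k \<xi>)) \<longlonglongrightarrow> (\<Sum>k\<in>UNIV. ?d k (m k))"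
  proof (intro tendsto_sum cv)
    show "norm (I n \<xi> * m k \<xi>) \<le> C" for n k \<xi>
      using mult_mono[OF In m(2)] by (simp add: norm_mult)
    have "(\<lambda>n. I n \<xi> * m k \<xi>) \<longlonglongrightarrow> m k \<xi>" if "\<xi> \<noteq> 0" for k \<xi>
    proof -
      obtain N1 where N1: "1 / norm \<xi> < real N1" using reals_Archimedean2 by blast
      obtain N2 where N2: "norm \<xi> < real N2" using reals_Archimedean2 by blast
      have "I n \<xi> * m k \<xi> = m k \<xi>" if "n \<ge> max N1 N2" for n
      proof -
        have "1 / norm \<xi> \<le> real (Suc n)" "norm \<xi> \<le> real (Suc n)" using N1 N2 that by auto
        then have "1 / real (Suc n) \<le> norm \<xi> \<and> norm \<xi> \<le> real (Suc n)" using \<open>\<xi> \<noteq> 0\<close> by (simp add: field_simps)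
        then show ?thesis by (simp add: I_def)
      qed
      then have "\<forall>\<^sub>F n in sequentially. m k \<xi> = I n \<xi> * m k \<xi>"
        unfolding eventually_sequentially by metis
      then show ?thesis by (rule Lim_transform_eventually[OF tendsto_const])
    qed
    moreover have "AE \<xi>::R3 in lborel. \<xi> \<noteq> 0" by (rule AE_lborel_singleton)
    ultimately show "AE \<xi> in lborel. (\<lambda>n. I n \<xi> * m k \<xi>) \<longlonglongrightarrow> m k \<xi>" for k
      by (auto elim!: eventually_mono)
  qed auto
  then show ?thesis unfolding key by (simp add: LIMSEQ_const_iff)
qed

lemma has_vector_derivative_of_increment:
  fixes f g :: "real \<Rightarrow> complex"
  assumes g: "continuous_on {0..<T} g"
    and inc: "\<And>a b. 0 \<le> a \<Longrightarrow> a \<le> b \<Longrightarrow> b < T \<Longrightarrow> f b - f a = integral {a..b} g"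
    and t: "t \<in> {0..<T}"
  shows "(f has_vector_derivative g t) (at t within {0..<T})"
proof -
  obtain c where c: "t < c" "c < T" using t dense[of t T] by auto
  have "((\<lambda>s. integral {0..s} g) has_vector_derivative g t) (at t within {0..c})"
    by (rule integral_has_vector_derivative) (use t c in \<open>auto intro: continuous_on_subset[OF g]\<close>)
  then have "((\<lambda>s. f 0 + integral {0..s} g) has_vector_derivative g t) (at t within {0..c})"
    using has_vector_derivative_add[OF has_vector_derivative_const] by fastforce
  moreover have "f 0 + integral {0..s} g = f s" if "s \<in> {0..c}" for s
    using inc[of 0 s] that c by (simp add: algebra_simps)
  moreover have "t \<in> {0..c}" using t c by auto
  ultimately have "(f has_vector_derivative g t) (at t within {0..c})"
    using has_vector_derivative_transform[of t "{0..c}" f "\<lambda>s. f 0 + integral {0..s} g" "g t"] by auto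
  moreover have "at t within {0..c} = at t within {0..<T}"
    by (rule at_within_nhd[of _ "{..<c}"]) (use c in auto)
  ultimately show ?thesis by simp
qed

text \<open>No bound is assumed on the gradient \<open>E\<close>. But the time integral of \<open>E = inv_ft G - u\<^sub>t\<close> over \<open>[a,b]\<close> is
  bounded, since \<open>u\<^sub>t\<close> integrates to \<open>u(b) - u(a)\<close>; as a bounded gradient it is weakly curl free, and
  divergence free symbols do not see it.\<close>

theorem evolution:
  fixes U G m :: "3 \<Rightarrow> _" and u ut E :: "real \<Rightarrow> R3 \<Rightarrow> R3" and q :: "real \<Rightarrow> R3 \<Rightarrow> real"
  assumes U: "\<And>k. L1_cont {0..<T} (U k)" and G: "\<And>k. L1_cont {0..<T} (G k)"
    and u: "\<And>t x k. t \<in> {0..<T} \<Longrightarrow> of_real (u t x $ k) = inv_ft (U k t) x"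
    and ut: "\<And>t x. t \<in> {0..<T} \<Longrightarrow> ((\<lambda>\<tau>. u \<tau> x) has_vector_derivative ut t x) (at t within {0..<T})"
    and utc: "continuous_on ({0..<T} \<times> UNIV) (\<lambda>(t, x). ut t x)"
    and q: "\<And>t x. t \<in> {0..<T} \<Longrightarrow> (q t has_derivative (\<lambda>d. d \<bullet> E t x)) (at x)"
    and E: "\<And>t x k. t \<in> {0..<T} \<Longrightarrow> of_real (E t x $ k) = inv_ft (G k t) x - of_real (ut t x $ k)"
    and m: "\<And>k. m k \<in> borel_measurable borel" "\<And>k \<xi>. norm (m k \<xi>) \<le> C"
    and div: "AE \<xi> in lborel. (\<Sum>k\<in>UNIV. m k \<xi> * of_real (\<xi> $ k)) = 0"
    and t: "t \<in> {0..<T}"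
  shows "((\<lambda>t. \<Sum>k\<in>UNIV. LINT \<xi>|lborel. m k \<xi> * U k t \<xi>) has_vector_derivative
    (\<Sum>k\<in>UNIV. LINT \<xi>|lborel. m k \<xi> * G k t \<xi>)) (at t within {0..<T})"
proof (rule has_vector_derivative_of_increment[OF _ _ t])
  have pc: "continuous_on {0..<T} (\<lambda>t. LINT \<xi>|lborel. m k \<xi> * G k t \<xi>)" for k
    by (rule continuous_on_L1_pairing[OF G m(1)]) (use m(2) in auto)
  then show "continuous_on {0..<T} (\<lambda>t. \<Sum>k\<in>UNIV. LINT \<xi>|lborel. m k \<xi> * G k t \<xi>)"
    by (intro continuous_on_sum)
  fix a b assume a: "0 \<le> a" and le: "a \<le> b" and b: "b < T"
  have ab: "{a..b} \<subseteq> {0..<T}" and aS: "a \<in> {0..<T}" and bS: "b \<in> {0..<T}" using a le b by auto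
  note Ua = L1_contD[OF U aS] and Ub = L1_contD[OF U bS]
  have mbdd: "bdd (m k)" for k using m unfolding bdd_def by blast
  define W where "W k \<xi> = U k b \<xi> - U k a \<xi>" for k \<xi>
  have W: "integrable lborel (W k)" for k unfolding W_def[abs_def] using Ua Ub by auto
  define Q where "Q x = integral {a..b} (\<lambda>\<tau>. E \<tau> x)" for x
  have Ec: "continuous_on ({a..b} \<times> UNIV) (\<lambda>(\<tau>, x). E \<tau> x)"
  proof -
    have "continuous_on ({0..<T} \<times> UNIV) (\<lambda>p. \<chi> k. Re (inv_ft (G k (fst p)) (snd p)) - ut (fst p) (snd p) $ k)"
      using continuous_on_inv_ft_joint[OF G] utc unfolding case_prod_unfold
      by (intro continuous_intros) 
    moreover have "(\<chi> k. Re (inv_ft (G k (fst p)) (snd p)) - ut (fst p) (snd p) $ k) = E (fst p) (snd p)"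
      if "p \<in> {0..<T} \<times> UNIV" for p :: "real \<times> R3"
    proof -
      have "E (fst p) (snd p) $ k = Re (inv_ft (G k (fst p)) (snd p) - of_real (ut (fst p) (snd p) $ k))" for k
        using E[of "fst p" "snd p" k] that by (metis Re_complex_of_real mem_Times_iff)
      then show ?thesis by (simp add: vec_eq_iff)
    qed
    ultimately have "continuous_on ({0..<T} \<times> UNIV) (\<lambda>p. E (fst p) (snd p))" by (rule continuous_on_eq)
    then show ?thesis unfolding case_prod_unfold by (rule continuous_on_subset) (use ab in auto)
  qed
  have c1: "continuous_on {a..b} (\<lambda>\<tau>. F \<tau> x)" if "continuous_on ({a..b} \<times> UNIV) (\<lambda>(\<tau>, x). F \<tau> x)"
    for F :: "real \<Rightarrow> R3 \<Rightarrow> 'b::topological_space" and x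
  proof -
    have "continuous_on {a..b} (\<lambda>\<tau>. (\<lambda>(\<tau>, x). F \<tau> x) (\<tau>, x))"
      by (rule continuous_on_compose2[OF that]) (auto intro!: continuous_intros)
    then show ?thesis by simp
  qed
  have Gc: "continuous_on {a..b} (\<lambda>\<tau>. inv_ft (G k \<tau>) x)" for k x
    by (rule c1, rule continuous_on_subset[OF continuous_on_inv_ft_joint[OF G]]) (use ab in auto)
  have utc': "continuous_on {a..b} (\<lambda>\<tau>. ut \<tau> x)" for x
    by (rule c1, rule continuous_on_subset[OF utc]) (use ab in auto)
  have bl: "bounded_linear (\<lambda>y::R3. complex_of_real (y $ k))" for k
    by (rule bounded_linear_compose[OF bounded_linear_of_real bounded_linear_vec_nth])
  have Qk: "of_real (Q x $ k) = integral {a..b} (\<lambda>\<tau>. inv_ft (G k \<tau>) x) - inv_ft (W k) x" for x k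
  proof -
    have "of_real (Q x $ k) = integral {a..b} (\<lambda>\<tau>. complex_of_real (E \<tau> x $ k))"
      unfolding Q_def using integral_linear[OF integrable_continuous_interval[OF c1[OF Ec]] bl] by (simp add: o_def)
    also have "\<dots> = integral {a..b} (\<lambda>\<tau>. inv_ft (G k \<tau>) x - of_real (ut \<tau> x $ k))"
      by (rule integral_cong) (use E ab in auto)
    also have "\<dots> = integral {a..b} (\<lambda>\<tau>. inv_ft (G k \<tau>) x) - integral {a..b} (\<lambda>\<tau>. of_real (ut \<tau> x $ k))"
      by (rule integral_diff) (intro integrable_continuous_interval Gc continuous_on_of_real continuous_on_component utc')+
    also have "((\<lambda>\<tau>. complex_of_real (ut \<tau> x $ k)) has_integral (complex_of_real (u b x $ k) - complex_of_real (u a x $ k))) {a..b}"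
    proof (rule fundamental_theorem_of_calculus[OF le])
      fix \<tau> assume "\<tau> \<in> {a..b}"
      then have "((\<lambda>\<tau>. u \<tau> x) has_vector_derivative ut \<tau> x) (at \<tau> within {a..b})"
        using has_vector_derivative_within_subset[OF ut[OF subsetD[OF ab]] ab] by blast
      then show "((\<lambda>\<tau>. complex_of_real (u \<tau> x $ k)) has_vector_derivative complex_of_real (ut \<tau> x $ k)) (at \<tau> within {a..b})"
        by (rule bounded_linear.has_vector_derivative[OF bl])
    qed
    then have "integral {a..b} (\<lambda>\<tau>. of_real (ut \<tau> x $ k)) = inv_ft (W k) x"
      unfolding W_def[abs_def] inv_ft_diff[OF Ub Ua] using u[OF aS] u[OF bS] by (simp add: integral_unique)
    finally show ?thesis .
  qed
  obtain B1 where B1: "\<And>k t. t \<in> {a..b} \<Longrightarrow> (LINT \<xi>|lborel. norm (G k t \<xi>)) \<le> B1 k"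
  proof -
    have "\<exists>B. \<forall>t\<in>{a..b}. (LINT \<xi>|lborel. norm (G k t \<xi>)) \<le> B" for k
    proof -
      obtain B where "\<And>t. t \<in> {a..b} \<Longrightarrow> (LINT \<xi>|lborel. norm (G k t \<xi>)) \<le> B"
        by (rule L1_cont_bounded[OF G[of k] _ ab]) auto
      then show ?thesis by blast
    qed
    then show ?thesis using that by metis
  qed
  define B where "B = (\<Sum>k\<in>UNIV. B1 k * (b - a) + (LINT \<xi>|lborel. norm (W k \<xi>)))"
  have QB: "norm (Q x) \<le> B" for x
  proof -
    have "\<bar>Q x $ k\<bar> \<le> B1 k * (b - a) + (LINT \<xi>|lborel. norm (W k \<xi>))" for k
    proof -
      have "\<bar>Q x $ k\<bar> = norm (complex_of_real (Q x $ k))" by simp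
      also have "\<dots> \<le> norm (integral {a..b} (\<lambda>\<tau>. inv_ft (G k \<tau>) x)) + norm (inv_ft (W k) x)"
        unfolding Qk by (rule norm_triangle_ineq4)
      also have "\<dots> \<le> B1 k * (b - a) + (LINT \<xi>|lborel. norm (W k \<xi>))"
      proof (intro add_mono norm_inv_ft_le W integral_bound[OF le Gc])
        fix \<tau> assume \<tau>: "\<tau> \<in> {a..b}"
        show "norm (inv_ft (G k \<tau>) x) \<le> B1 k"
          using norm_inv_ft_le[OF L1_contD[OF G subsetD[OF ab \<tau>]]] B1[OF \<tau>] by (rule order_trans)
      qed
      finally show ?thesis .
    qed
    then show ?thesis unfolding B_def by (intro order_trans[OF norm_le_l1_cart] sum_mono)
  qed
  have "\<exists>P. (\<forall>x. (P has_derivative (\<lambda>d. d \<bullet> Q x)) (at x)) \<and> (\<forall>x. \<bar>P x\<bar> \<le> B * norm x)"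
    using gradient_time_integral[OF q[OF subsetD[OF ab]] Ec QB[unfolded Q_def]] unfolding Q_def .
  then obtain P where P: "\<And>x. (P has_derivative (\<lambda>d. d \<bullet> Q x)) (at x)" "\<And>x. \<bar>P x\<bar> \<le> B * norm x" by blast
  have Qc: "continuous_on UNIV Q"
  proof -
    have "continuous_on (UNIV \<times> cbox a b) (\<lambda>(x, \<tau>). E \<tau> x)"
    proof -
      have "continuous_on (UNIV \<times> cbox a b) (\<lambda>p :: R3 \<times> real. (\<lambda>(\<tau>, x). E \<tau> x) (snd p, fst p))"
        by (rule continuous_on_compose2[OF Ec]) (auto intro!: continuous_intros)
      then show ?thesis by (simp add: case_prod_unfold)
    qed
    then have "continuous_on UNIV (\<lambda>x. integral (cbox a b) (\<lambda>\<tau>. E \<tau> x))" by (rule integral_continuous_on_param)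
    then show ?thesis unfolding Q_def[abs_def] by simp
  qed
  have Qpair: "(LINT x|lborel. of_real (Q x $ k) * ft \<psi> x) = - defect (W k) (G k) a b \<psi>" if \<psi>: "schwartz \<psi>" for \<psi> k
  proof -
    note fi = schwartz_integrable[OF schwartz_ft[OF \<psi>]]
    have [measurable]: "(\<lambda>x. Q x $ k) \<in> borel_measurable borel"
      by (intro borel_measurable_continuous_onI continuous_on_component Qc)
    note [measurable] = inv_ft_measurable[OF W]
    have i1: "integrable lborel (\<lambda>x. complex_of_real (Q x $ k) * ft \<psi> x)"
      by (rule integrable_bounded_mult[OF fi, where C = B])
        (use order_trans[OF component_le_norm_cart QB] in auto)
    have i2: "integrable lborel (\<lambda>x. inv_ft (W k) x * ft \<psi> x)"
      by (rule integrable_bounded_mult[OF fi _ AE_I2[OF norm_inv_ft_le[OF W]]]) simp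
    have "(LINT x|lborel. integral {a..b} (\<lambda>\<tau>. inv_ft (G k \<tau>) x) * ft \<psi> x) =
       (LINT x|lborel. of_real (Q x $ k) * ft \<psi> x + inv_ft (W k) x * ft \<psi> x)"
      by (simp add: Qk algebra_simps)
    also have "\<dots> = (LINT x|lborel. of_real (Q x $ k) * ft \<psi> x) + (LINT x|lborel. inv_ft (W k) x * ft \<psi> x)"
      using i1 i2 by simp
    also have "(LINT x|lborel. inv_ft (W k) x * ft \<psi> x) = (LINT \<xi>|lborel. \<psi> \<xi> * W k \<xi>)"
      using inv_ft_duality[OF W fi] by (simp add: inv_ft_ft[OF \<psi>] mult.commute)
    finally show ?thesis
      unfolding defect_def integral_time_swap[OF G ab \<psi>] by (simp add: mult.commute)
  qed
  have curl: "defect (W k) (G k) a b (\<lambda>\<xi>. of_real (\<xi> $ j) * \<phi> \<xi>) = defect (W j) (G j) a b (\<lambda>\<xi>. of_real (\<xi> $ k) * \<phi> \<xi>)"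
    if \<phi>: "schwartz \<phi>" for j k \<phi>
  proof -
    define \<theta> where "\<theta> = (\<lambda>\<xi>. \<i> * \<phi> \<xi>)"
    have s\<theta>: "schwartz \<theta>" unfolding \<theta>_def by (rule schwartz_cmult[OF \<phi>])
    have p1: "pd j (ft \<theta>) = ft (\<lambda>\<xi>. of_real (\<xi> $ j) * \<phi> \<xi>)" for j
    proof
      fix x
      have "- \<i> * c * (\<i> * z) = c * z" for c z by (simp add: algebra_simps)
      then have "(\<lambda>y. - \<i> * of_real (y $ j) * \<theta> y) = (\<lambda>\<xi>. of_real (\<xi> $ j) * \<phi> \<xi>)"
        unfolding \<theta>_def by blast
      then show "pd j (ft \<theta>) x = ft (\<lambda>\<xi>. of_real (\<xi> $ j) * \<phi> \<xi>) x" using pd_ft[OF s\<theta>, of j x] by simp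
    qed
    have s1: "schwartz (\<lambda>\<xi>. of_real (\<xi> $ j) * \<phi> \<xi>)" for j by (rule schwartz_coord[OF \<phi>])
    have p2: "pd k (pd j (ft \<theta>)) = pd j (pd k (ft \<theta>))"
      unfolding p1
    proof
      fix x
      have "(\<lambda>y. - \<i> * of_real (y $ k) * (of_real (y $ j) * \<phi> y)) = (\<lambda>y. - \<i> * of_real (y $ j) * (of_real (y $ k) * \<phi> y))"
        by (simp only: mult_ac)
      then show "pd k (ft (\<lambda>\<xi>. of_real (\<xi> $ j) * \<phi> \<xi>)) x = pd j (ft (\<lambda>\<xi>. of_real (\<xi> $ k) * \<phi> \<xi>)) x"
        unfolding pd_ft[OF s1] by simp
    qed
    have "(LINT x|lborel. of_real (Q x $ k) * pd j (ft \<theta>) x) = (LINT x|lborel. of_real (Q x $ j) * pd k (ft \<theta>) x)"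
      using weak_curl_free[OF P Qc QB schwartz_pd[OF schwartz_ft[OF s\<theta>]], of k j]
        weak_curl_free[OF P Qc QB schwartz_pd[OF schwartz_ft[OF s\<theta>]], of j k] p2 by simp
    then show ?thesis unfolding p1 Qpair[OF s1] by simp
  qed
  have "(\<Sum>k\<in>UNIV. defect (W k) (G k) a b (m k)) = 0"
    by (rule defect_div_free[OF W G ab curl m div])
  then have "(\<Sum>k\<in>UNIV. LINT \<xi>|lborel. m k \<xi> * W k \<xi>) = (\<Sum>k\<in>UNIV. integral {a..b} (\<lambda>\<tau>. LINT \<xi>|lborel. m k \<xi> * G k \<tau> \<xi>))"
    by (simp add: defect_def sum_subtractf)
  also have "\<dots> = integral {a..b} (\<lambda>\<tau>. \<Sum>k\<in>UNIV. LINT \<xi>|lborel. m k \<xi> * G k \<tau> \<xi>)"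
    by (rule integral_sum[symmetric]) (auto intro!: integrable_continuous_interval continuous_on_subset[OF pc ab])
  finally show "(\<Sum>k\<in>UNIV. LINT \<xi>|lborel. m k \<xi> * U k b \<xi>) - (\<Sum>k\<in>UNIV. LINT \<xi>|lborel. m k \<xi> * U k a \<xi>) =
      integral {a..b} (\<lambda>\<tau>. \<Sum>k\<in>UNIV. LINT \<xi>|lborel. m k \<xi> * G k \<tau> \<xi>)"
    using bdd_integrable[OF mbdd Ub] bdd_integrable[OF mbdd Ua]
    by (simp add: W_def right_diff_distrib sum_subtractf)
qed

section \<open>Components and derivatives\<close>

lemma real_inv_ft:
  fixes f :: "R3 \<Rightarrow> real"
  assumes f: "\<And>x. of_real (f x) = inv_ft A x" and A: "integrable lborel A" "integrable lborel (\<lambda>\<xi>. of_real (norm \<xi>) * A \<xi>)"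
  shows "f differentiable (at x)" "of_real (pd j f x) = inv_ft (\<lambda>\<xi>. \<i> * of_real (\<xi> $ j) * A \<xi>) x"
proof -
  have d: "inv_ft A differentiable (at x)" by (rule differentiable_inv_ft[OF A])
  have fe: "f = (\<lambda>x. Re (inv_ft A x))" using f by (metis Re_complex_of_real ext)
  have "(Re \<circ> inv_ft A) differentiable (at x)"
    by (rule differentiable_chain_at[OF d]) (rule bounded_linear_imp_differentiable[OF bounded_linear_Re])
  then show fd: "f differentiable (at x)" by (simp add: fe o_def)
  have "of_real (pd j f x) = pd j (\<lambda>x. complex_of_real (f x)) x"
    by (rule pd_linear[OF bounded_linear_of_real fd, symmetric])
  also have "(\<lambda>x. complex_of_real (f x)) = inv_ft A" using f by auto
  finally show "of_real (pd j f x) = inv_ft (\<lambda>\<xi>. \<i> * of_real (\<xi> $ j) * A \<xi>) x"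
    by (simp add: pd_inv_ft[OF A])
qed

lemma has_derivative_pd:
  fixes f :: "R3 \<Rightarrow> 'b::real_normed_vector"
  assumes "f differentiable (at x)"
  shows "(f has_derivative (\<lambda>d. \<Sum>k\<in>UNIV. d $ k *\<^sub>R pd k f x)) (at x)"
proof -
  obtain f' where f': "(f has_derivative f') (at x)" using assms by (auto simp: differentiable_def)
  interpret bounded_linear f' using f' by (rule has_derivative_bounded_linear)
  have "f' d = (\<Sum>k\<in>UNIV. d $ k *\<^sub>R pd k f x)" for d
  proof -
    have "d = (\<Sum>k\<in>UNIV. d $ k *\<^sub>R axis k 1)"
      using basis_expansion[of d] by (simp add: scalar_mult_eq_scaleR)
    then have "f' d = f' (\<Sum>k\<in>UNIV. d $ k *\<^sub>R axis k 1)" by simp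
    then show ?thesis by (simp add: sum scaleR pd_of_has_derivative[OF f'])
  qed
  then have "f' = (\<lambda>d. \<Sum>k\<in>UNIV. d $ k *\<^sub>R pd k f x)" by auto
  then show ?thesis using f' by simp
qed

lemma ccross_nth:
  "ccross a b $ 1 = a $ 2 * b $ 3 - a $ 3 * b $ 2"
  "ccross a b $ 2 = a $ 3 * b $ 1 - a $ 1 * b $ 3"
  "ccross a b $ 3 = a $ 1 * b $ 2 - a $ 2 * b $ 1"
  by (simp_all add: ccross_def)

lemma curl_nth:
  "curl w x $ 1 = pd 2 w x $ 3 - pd 3 w x $ 2"
  "curl w x $ 2 = pd 3 w x $ 1 - pd 1 w x $ 3"
  "curl w x $ 3 = pd 1 w x $ 2 - pd 2 w x $ 1"
  by (simp_all add: curl_def)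

section \<open>The distribution on the Fourier side\<close>

definition cvec :: "R3 \<Rightarrow> complex ^ 3" where
  "cvec \<xi> = (\<chi> i. complex_of_real (\<xi> $ i))"

lemma dist_pd_ft:
  assumes F: "is_fourier (component k h) F" and \<phi>: "schwartz \<phi>"
  shows "dist_pd j h (ft \<phi>) $ k = (LINT \<xi>|lborel. (\<i> * of_real (\<xi> $ j) * F \<xi>) * \<phi> \<xi>)"
proof -
  have "schwartz (\<lambda>y. - \<i> * (of_real (y $ j) * \<phi> y))" by (intro schwartz_cmult schwartz_coord \<phi>)
  then have s: "schwartz (\<lambda>y. - \<i> * of_real (y $ j) * \<phi> y)" by (simp add: mult.assoc)
  have "pd j (ft \<phi>) = ft (\<lambda>y. - \<i> * of_real (y $ j) * \<phi> y)" using pd_ft[OF \<phi>] by auto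
  then have "dist_pd j h (ft \<phi>) $ k = - component k h (ft (\<lambda>y. - \<i> * of_real (y $ j) * \<phi> y))"
    by (simp add: dist_pd_def component_def)
  also have "\<dots> = - (LINT \<xi>|lborel. F \<xi> * (- \<i> * of_real (\<xi> $ j) * \<phi> \<xi>))"
    using F s by (simp add: is_fourier_def distribution_of_def)
  also have "\<dots> = (LINT \<xi>|lborel. - (F \<xi> * (- \<i> * of_real (\<xi> $ j) * \<phi> \<xi>)))" by (rule integral_minus[symmetric])
  finally show ?thesis by (simp add: mult_ac)
qed

lemma temperate_coord_mult:
  assumes F: "temperate_function F" shows "temperate_function (\<lambda>\<xi>. c * of_real (\<xi> $ j) * F \<xi>)"
  unfolding temperate_function_def
proof (intro conjI allI impI)
  show "(\<lambda>\<xi>. c * of_real (\<xi> $ j) * F \<xi>) \<in> borel_measurable lborel" using temperate_measurable[OF F] by simp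
  fix \<phi> assume "schwartz \<phi>"
  then have "integrable lborel (\<lambda>x. F x * (c * (of_real (x $ j) * \<phi> x)))"
    using F schwartz_cmult[OF schwartz_coord] by (simp add: temperate_function_def)
  then show "integrable lborel (\<lambda>\<xi>. c * of_real (\<xi> $ j) * F \<xi> * \<phi> \<xi>)" by (simp add: mult_ac)
qed

lemma temperate_pairing_integrable: "temperate_function F \<Longrightarrow> schwartz \<phi> \<Longrightarrow> integrable lborel (\<lambda>\<xi>. F \<xi> * \<phi> \<xi>)"
  by (simp add: temperate_function_def)

lemma temperate_add: "temperate_function F \<Longrightarrow> temperate_function G \<Longrightarrow> temperate_function (\<lambda>\<xi>. F \<xi> + G \<xi>)"
  by (auto simp: temperate_function_def distrib_right)

lemma temperate_diff: "temperate_function F \<Longrightarrow> temperate_function G \<Longrightarrow> temperate_function (\<lambda>\<xi>. F \<xi> - G \<xi>)"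
  by (auto simp: temperate_function_def left_diff_distrib)

text \<open>Testing with \<open>ft \<phi>\<close> turns the derivatives into multiplications by \<open>i \<xi>\<^sub>j\<close>.\<close>

lemma fourier_div_free:
  assumes F: "\<And>k. is_fourier (component k h) (F k)" and div: "\<And>\<phi>. schwartz \<phi> \<Longrightarrow> dist_div h \<phi> = 0"
  shows "AE \<xi> in lborel. (\<Sum>k\<in>UNIV. F k \<xi> * of_real (\<xi> $ k)) = 0"
proof -
  have tF: "temperate_function (F k)" for k using F by (simp add: is_fourier_def)
  note t = temperate_coord_mult[OF tF]
  have "AE \<xi> in lborel. (\<Sum>k\<in>UNIV. \<i> * of_real (\<xi> $ k) * F k \<xi>) = 0"
  proof (rule temperate_eq_0)
    show "temperate_function (\<lambda>\<xi>. \<Sum>k\<in>UNIV. \<i> * of_real (\<xi> $ k) * F k \<xi>)"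
      unfolding sum_3 by (intro temperate_add t)
    fix \<phi> assume \<phi>: "schwartz \<phi>"
    have "(LINT \<xi>|lborel. (\<Sum>k\<in>UNIV. \<i> * of_real (\<xi> $ k) * F k \<xi>) * \<phi> \<xi>) = (\<Sum>k\<in>UNIV. LINT \<xi>|lborel. \<i> * of_real (\<xi> $ k) * F k \<xi> * \<phi> \<xi>)"
      unfolding sum_distrib_right by (intro Bochner_Integration.integral_sum temperate_pairing_integrable[OF t \<phi>])
    also have "\<dots> = dist_div h (ft \<phi>)" by (simp add: dist_div_def dist_pd_ft[OF F \<phi>])
    finally show "(LINT \<xi>|lborel. (\<Sum>k\<in>UNIV. \<i> * of_real (\<xi> $ k) * F k \<xi>) * \<phi> \<xi>) = 0"
      using div[OF schwartz_ft[OF \<phi>]] by simp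
  qed
  then show ?thesis
  proof (rule eventually_mono)
    fix \<xi> assume "(\<Sum>k\<in>UNIV. \<i> * of_real (\<xi> $ k) * F k \<xi>) = 0"
    then have "\<i> * (\<Sum>k\<in>UNIV. F k \<xi> * of_real (\<xi> $ k)) = 0" by (simp add: sum_distrib_left mult_ac)
    then show "(\<Sum>k\<in>UNIV. F k \<xi> * of_real (\<xi> $ k)) = 0" by simp
  qed
qed

lemma temperate_norm_mult:
  assumes F [measurable]: "F \<in> borel_measurable borel" and bd: "AE \<xi> in lborel. norm (F \<xi>) \<le> 1"
  shows "temperate_function (\<lambda>\<xi>. of_real (norm \<xi>) * F \<xi>)"
proof (rule temperate_growth[where C = 1 and k = 1])
  show "AE \<xi> in lborel. norm (of_real (norm \<xi>) * F \<xi>) \<le> 1 * (1 + norm \<xi>) ^ 1"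
    using bd
  proof (rule eventually_mono)
    fix \<xi> :: R3 assume "norm (F \<xi>) \<le> 1"
    then have "norm \<xi> * norm (F \<xi>) \<le> norm \<xi> * 1" by (intro mult_left_mono) auto
    then show "norm (of_real (norm \<xi>) * F \<xi>) \<le> 1 * (1 + norm \<xi>) ^ 1" by (simp add: norm_mult)
  qed
qed simp

lemma is_fourier_Lambda:
  assumes F: "is_fourier (component i h) F" and bd: "AE \<xi> in lborel. norm (F \<xi>) \<le> 1"
  shows "is_fourier (component i (dist_Lambda h)) (\<lambda>\<xi>. of_real (norm \<xi>) * F \<xi>)"
proof -
  let ?F = "fourier (component i h)"
  have ae: "AE \<xi> in lborel. ?F \<xi> = F \<xi>" by (rule is_fourier_imp_AE[OF F])
  note [measurable] = is_fourier_measurable[OF F] is_fourier_measurable[OF is_fourier_fourier[OF F]]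
  have "component i (dist_Lambda h) (ft \<phi>) = distribution_of (\<lambda>\<xi>. of_real (norm \<xi>) * F \<xi>) \<phi>" if \<phi>: "schwartz \<phi>" for \<phi>
  proof -
    note [measurable] = schwartz_measurable[OF \<phi>]
    have "inv_ft (ft \<phi>) = \<phi>" using inv_ft_ft[OF \<phi>] by auto
    then have "component i (dist_Lambda h) (ft \<phi>) = (LINT \<xi>|lborel. of_real (norm \<xi>) * ?F \<xi> * \<phi> \<xi>)"
      by (simp add: component_def dist_Lambda_def distribution_of_def)
    also have "\<dots> = (LINT \<xi>|lborel. of_real (norm \<xi>) * F \<xi> * \<phi> \<xi>)"
      by (rule integral_cong_AE) (use ae in \<open>auto elim!: eventually_mono\<close>)
    finally show ?thesis by (simp add: distribution_of_def)
  qed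
  then show ?thesis using temperate_norm_mult[OF _ bd] by (simp add: is_fourier_def)
qed

lemma fourier_curl:
  fixes F :: "3 \<Rightarrow> R3 \<Rightarrow> complex"
  assumes F: "\<And>k. is_fourier (component k h) (F k)" and bd: "\<And>k. AE \<xi> in lborel. norm (F k \<xi>) \<le> 1"
    and curl: "\<And>\<phi>. schwartz \<phi> \<Longrightarrow> dist_curl h \<phi> = dist_Lambda h \<phi>"
  shows "AE \<xi> in lborel. \<forall>k. \<i> * ccross (cvec \<xi>) (\<chi> l. F l \<xi>) $ k = norm \<xi> * F k \<xi>"
proof -
  have tF: "temperate_function (F k)" for k using F by (simp add: is_fourier_def)
  note t = temperate_coord_mult[OF tF] and L = is_fourier_Lambda[OF F bd]
  have key: "AE \<xi> in lborel. \<i> * of_real (\<xi> $ a) * F b \<xi> - \<i> * of_real (\<xi> $ b) * F a \<xi> = of_real (norm \<xi>) * F c \<xi>"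
    if c: "\<And>\<phi>. dist_curl h \<phi> $ c = dist_pd a h \<phi> $ b - dist_pd b h \<phi> $ a" for a b c
  proof (rule temperate_unique)
    show "temperate_function (\<lambda>\<xi>. \<i> * of_real (\<xi> $ a) * F b \<xi> - \<i> * of_real (\<xi> $ b) * F a \<xi>)" by (intro temperate_diff t)
    show "temperate_function (\<lambda>\<xi>. of_real (norm \<xi>) * F c \<xi>)" using L by (simp add: is_fourier_def)
    fix \<phi> assume \<phi>: "schwartz \<phi>"
    have "distribution_of (\<lambda>\<xi>. \<i> * of_real (\<xi> $ a) * F b \<xi> - \<i> * of_real (\<xi> $ b) * F a \<xi>) \<phi> = dist_curl h (ft \<phi>) $ c"
      unfolding distribution_of_def left_diff_distrib c dist_pd_ft[OF F \<phi>]
      by (intro Bochner_Integration.integral_diff temperate_pairing_integrable[OF t \<phi>])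
    also have "\<dots> = component c (dist_Lambda h) (ft \<phi>)" by (simp add: curl[OF schwartz_ft[OF \<phi>]] component_def)
    also have "\<dots> = distribution_of (\<lambda>\<xi>. of_real (norm \<xi>) * F c \<xi>) \<phi>" using L \<phi> by (simp add: is_fourier_def)
    finally show "distribution_of (\<lambda>\<xi>. \<i> * of_real (\<xi> $ a) * F b \<xi> - \<i> * of_real (\<xi> $ b) * F a \<xi>) \<phi> =
      distribution_of (\<lambda>\<xi>. of_real (norm \<xi>) * F c \<xi>) \<phi>" .
  qed
  have "dist_curl h \<phi> $ 1 = dist_pd 2 h \<phi> $ 3 - dist_pd 3 h \<phi> $ 2" "dist_curl h \<phi> $ 2 = dist_pd 3 h \<phi> $ 1 - dist_pd 1 h \<phi> $ 3"
    "dist_curl h \<phi> $ 3 = dist_pd 1 h \<phi> $ 2 - dist_pd 2 h \<phi> $ 1" for \<phi> by (simp_all add: dist_curl_def)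
  from key[OF this(1)] key[OF this(2)] key[OF this(3)] show ?thesis
    by eventually_elim (simp add: forall_3 ccross_nth cvec_def algebra_simps)
qed

lemma is_fourier_reflect:
  assumes F: "is_fourier (component i h) F"
  shows "is_fourier (component i (dist_reflect h)) (\<lambda>\<xi>. F (- \<xi>))"
  unfolding is_fourier_def
proof (intro conjI allI impI)
  have tF: "temperate_function F" using F by (simp add: is_fourier_def)
  note [measurable] = temperate_measurable[OF tF]
  show "temperate_function (\<lambda>\<xi>. F (- \<xi>))" unfolding temperate_function_def
  proof (intro conjI allI impI)
    fix \<phi> assume \<phi>: "schwartz \<phi>"
    note [measurable] = schwartz_measurable[OF \<phi>]
    have "integrable lborel (\<lambda>x. F x * \<phi> (- x))" by (rule temperate_pairing_integrable[OF tF schwartz_refl[OF \<phi>]])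
    then show "integrable lborel (\<lambda>\<xi>. F (- \<xi>) * \<phi> \<xi>)"
      using integrable_refl_iff[of "\<lambda>x. F x * \<phi> (- x)"] by simp
  qed simp
  fix \<phi> assume \<phi>: "schwartz \<phi>"
  note [measurable] = schwartz_measurable[OF \<phi>]
  have "(\<lambda>x. ft \<phi> (- x)) = ft (\<lambda>x. \<phi> (- x))"
  proof
    fix x show "ft \<phi> (- x) = ft (\<lambda>x. \<phi> (- x)) x"
      using integral_refl[of "\<lambda>y. cis (- (y \<bullet> (- x))) * \<phi> y"] by (simp add: ft_def)
  qed
  then have "component i (dist_reflect h) (ft \<phi>) = component i h (ft (\<lambda>x. \<phi> (- x)))"
    by (simp add: component_def dist_reflect_def)
  also have "\<dots> = (LINT x|lborel. F x * \<phi> (- x))" using F schwartz_refl[OF \<phi>] by (simp add: is_fourier_def distribution_of_def)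
  also have "\<dots> = (LINT x|lborel. F (- x) * \<phi> x)" using integral_refl[of "\<lambda>x. F x * \<phi> (- x)"] by simp
  finally show "component i (dist_reflect h) (ft \<phi>) = distribution_of (\<lambda>\<xi>. F (- \<xi>)) \<phi>" by (simp add: distribution_of_def)
qed

lemma cnj_measurable [measurable]: "cnj \<in> borel_measurable borel"
  by (intro borel_measurable_continuous_onI continuous_intros)

text \<open>Reality of \<open>S\<close> gives \<open>S (cnj \<psi>) = cnj (S \<psi>)\<close>, and conjugation of \<open>ft \<phi>\<close> corresponds to conjugation and
  reflection of \<open>\<phi>\<close>.\<close>

lemma fourier_real:
  assumes F: "is_fourier S F" and S: "tempered_distribution S" and r: "real_distribution S"
  shows "AE \<xi> in lborel. F (- \<xi>) = cnj (F \<xi>)"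
proof -
  have tF: "temperate_function F" using F by (simp add: is_fourier_def)
  note [measurable] = temperate_measurable[OF tF]
  have add: "S (\<lambda>x. \<phi> x + \<psi> x) = S \<phi> + S \<psi>" if "schwartz \<phi>" "schwartz \<psi>" for \<phi> \<psi>
    using S that unfolding tempered_distribution_def by blast
  have mul: "S (\<lambda>x. c * \<phi> x) = c * S \<phi>" if "schwartz \<phi>" for c \<phi>
    using S that unfolding tempered_distribution_def by blast
  have cnj: "S (\<lambda>x. cnj (\<psi> x)) = cnj (S \<psi>)" if \<psi>: "schwartz \<psi>" for \<psi>
  proof -
    let ?R = "\<lambda>x. complex_of_real (Re (\<psi> x))" and ?I = "\<lambda>x. complex_of_real (Im (\<psi> x))"
    note s = schwartz_Re[OF \<psi>] schwartz_Im[OF \<psi>]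
    have e: "S (\<lambda>x. ?R x + c * ?I x) = S ?R + c * S ?I" for c
      using add[OF s(1) schwartz_cmult[OF s(2)], of c] mul[OF s(2), of c] by simp
    have re: "S ?R \<in> \<real>" "S ?I \<in> \<real>" using r s unfolding real_distribution_def by auto
    have "\<psi> = (\<lambda>x. ?R x + \<i> * ?I x)" by (simp add: complex_eq fun_eq_iff)
    then have 1: "S \<psi> = S ?R + \<i> * S ?I" using e[of \<i>] by metis
    have "(\<lambda>x. cnj (\<psi> x)) = (\<lambda>x. ?R x + (- \<i>) * ?I x)" by (simp add: fun_eq_iff complex_eq_iff)
    then have 2: "S (\<lambda>x. cnj (\<psi> x)) = S ?R + (- \<i>) * S ?I" using e[of "- \<i>"] by metis
    show ?thesis unfolding 1 2 using re by (simp add: Reals_cnj_iff)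
  qed
  have t': "temperate_function (\<lambda>\<xi>. cnj (F (- \<xi>)))" unfolding temperate_function_def
  proof (intro conjI allI impI)
    fix \<phi> assume \<phi>: "schwartz \<phi>"
    note [measurable] = schwartz_measurable[OF \<phi>]
    have "integrable lborel (\<lambda>x. F x * cnj (\<phi> (- x)))"
      by (rule temperate_pairing_integrable[OF tF schwartz_cnj[OF schwartz_refl[OF \<phi>]]])
    then have "integrable lborel (\<lambda>x. cnj (F x * cnj (\<phi> (- x))))" by (rule integrable_bounded_linear[OF bounded_linear_cnj])
    then show "integrable lborel (\<lambda>\<xi>. cnj (F (- \<xi>)) * \<phi> \<xi>)"
      using integrable_refl_iff[of "\<lambda>x. cnj (F x) * \<phi> (- x)"] by simp
  qed measurable
  have "AE \<xi> in lborel. F \<xi> = cnj (F (- \<xi>))"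
  proof (rule temperate_unique[OF tF t'])
    fix \<phi> assume \<phi>: "schwartz \<phi>"
    note [measurable] = schwartz_measurable[OF \<phi>]
    note s = schwartz_cnj[OF schwartz_refl[OF \<phi>]]
    have "ft (\<lambda>x. cnj (\<phi> (- x))) = (\<lambda>x. cnj (ft \<phi> x))"
    proof
      fix x
      have "ft (\<lambda>x. cnj (\<phi> (- x))) x = (LINT y|lborel. cnj (cis (y \<bullet> x) * \<phi> (- y)))" by (simp add: ft_def cis_cnj)
      also have "\<dots> = cnj (LINT y|lborel. cis (y \<bullet> x) * \<phi> (- y))" by (rule Bochner_Integration.integral_cnj)
      also have "(LINT y|lborel. cis (y \<bullet> x) * \<phi> (- y)) = ft \<phi> x"
        using integral_refl[of "\<lambda>y. cis (y \<bullet> x) * \<phi> (- y)"] by (simp add: ft_def)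
      finally show "ft (\<lambda>x. cnj (\<phi> (- x))) x = cnj (ft \<phi> x)" .
    qed
    then have "cnj (S (ft \<phi>)) = S (ft (\<lambda>x. cnj (\<phi> (- x))))"
      using cnj[OF schwartz_ft[OF \<phi>]] by simp
    then have "cnj (S (ft \<phi>)) = (LINT x|lborel. F x * cnj (\<phi> (- x)))"
      using F s by (simp add: is_fourier_def distribution_of_def)
    then have "S (ft \<phi>) = (LINT x|lborel. cnj (F x * cnj (\<phi> (- x))))" by (metis complex_cnj_cnj Bochner_Integration.integral_cnj)
    also have "\<dots> = (LINT x|lborel. cnj (F (- x)) * \<phi> x)"
      using integral_refl[of "\<lambda>x. cnj (F x) * \<phi> (- x)"] by simp
    finally show "distribution_of F \<phi> = distribution_of (\<lambda>\<xi>. cnj (F (- \<xi>))) \<phi>"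
      using F \<phi> by (simp add: is_fourier_def distribution_of_def)
  qed
  then show ?thesis by (rule eventually_mono) simp
qed

section \<open>Pointwise algebra of helical vectors\<close>

text \<open>\<open>w\<close> is an eigenvector of the Hermitian operator \<open>i \<xi> \<times>\<close>.\<close>

lemma helical_adjoint:
  assumes "\<And>k. \<i> * ccross (cvec \<xi>) w $ k = norm \<xi> * w $ k"
  shows "(\<Sum>k\<in>UNIV. cnj (w $ k) * (\<i> * ccross (cvec \<xi>) z $ k)) = norm \<xi> * (\<Sum>k\<in>UNIV. cnj (w $ k) * z $ k)"
proof -
  have c: "norm \<xi> * cnj (w $ k) = - \<i> * ccross (cvec \<xi>) (\<chi> l. cnj (w $ l)) $ k" for k
  proof -
    have "norm \<xi> * cnj (w $ k) = cnj (norm \<xi> * w $ k)" by simp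
    also have "\<dots> = cnj (\<i> * ccross (cvec \<xi>) w $ k)" using assms[of k] by simp
    also have "\<dots> = - \<i> * ccross (cvec \<xi>) (\<chi> l. cnj (w $ l)) $ k"
      using exhaust_3[of k] by (auto simp: ccross_nth cvec_def)
    finally show ?thesis .
  qed
  have "norm \<xi> * (\<Sum>k\<in>UNIV. cnj (w $ k) * z $ k) = (\<Sum>k\<in>UNIV. (norm \<xi> * cnj (w $ k)) * z $ k)"
    by (simp add: sum_distrib_left mult.assoc)
  also have "\<dots> = (\<Sum>k\<in>UNIV. cnj (w $ k) * (\<i> * ccross (cvec \<xi>) z $ k))"
    unfolding c by (simp add: sum_3 ccross_nth cvec_def algebra_simps)
  finally show ?thesis by simp
qed

text \<open>The Lamb vector \<open>a \<times> curl a\<close> in terms of the derivatives \<open>D j = \<partial>\<^sub>j a\<close>.\<close>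

lemma lamb_form:
  fixes a :: R3 and D :: "3 \<Rightarrow> R3"
  assumes "\<omega> $ 1 = of_real (D 2 $ 3 - D 3 $ 2)" "\<omega> $ 2 = of_real (D 3 $ 1 - D 1 $ 3)" "\<omega> $ 3 = of_real (D 1 $ 2 - D 2 $ 1)"
  shows "ccross (cvec a) \<omega> $ k = of_real (\<Sum>j\<in>UNIV. a $ j * (D k $ j - D j $ k))"
  using exhaust_3[of k] by (auto simp: ccross_nth cvec_def sum_3 assms algebra_simps)

lemma inv_ft_refl:
  assumes "A \<in> borel_measurable borel"
  shows "inv_ft (\<lambda>\<xi>. A (- \<xi>)) x = inv_ft A (- x)"
  using integral_refl[of "\<lambda>\<xi>. cis (- (x \<bullet> \<xi>)) * A \<xi>"] assms by (simp add: inv_ft_def)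

section \<open>Smooth solutions on the Fourier side\<close>

definition uhat :: "(real \<Rightarrow> R3 \<Rightarrow> R3) \<Rightarrow> 3 \<Rightarrow> real \<Rightarrow> R3 \<Rightarrow> complex" where
  "uhat u k t = fourier (distribution_of (component k (complexify (u t))))"

text \<open>The transform of \<open>curl u\<close>, by \<open>curl_inv_ft\<close>.\<close>

definition curlhat :: "(real \<Rightarrow> R3 \<Rightarrow> R3) \<Rightarrow> 3 \<Rightarrow> real \<Rightarrow> R3 \<Rightarrow> complex" where
  "curlhat u k t \<xi> = \<i> * ccross (cvec \<xi>) (\<chi> l. uhat u l t \<xi>) $ k"

text \<open>The transform of \<open>u \<times> curl u\<close>, by \<open>lamb_inv_ft\<close>.\<close>

definition lambhat :: "(real \<Rightarrow> R3 \<Rightarrow> R3) \<Rightarrow> 3 \<Rightarrow> real \<Rightarrow> R3 \<Rightarrow> complex" where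
  "lambhat u k t \<xi> = (vector
     [fconv (uhat u 2 t) (curlhat u 3 t) \<xi> - fconv (uhat u 3 t) (curlhat u 2 t) \<xi>,
      fconv (uhat u 3 t) (curlhat u 1 t) \<xi> - fconv (uhat u 1 t) (curlhat u 3 t) \<xi>,
      fconv (uhat u 1 t) (curlhat u 2 t) \<xi> - fconv (uhat u 2 t) (curlhat u 1 t) \<xi>] :: complex ^ 3) $ k"

lemma bounded_linear_cvec: "bounded_linear cvec"
  by (rule linear_conv_bounded_linear[THEN iffD1], rule linearI) (simp_all add: cvec_def vec_eq_iff scaleR_conv_of_real[where 'a = complex])

lemma complexify_cvec: "complexify w = (\<lambda>x. cvec (w x))"
  by (simp add: complexify_def cvec_def fun_eq_iff)

lemma component_complexify: "component k (complexify w) = (\<lambda>x. of_real (w x $ k))"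
  by (simp add: component_def complexify_def fun_eq_iff)

lemma weight_bounds:
  "norm \<xi> \<le> 1 * (1 + norm \<xi>) ^ 2" "1 \<le> 1 * (1 + norm \<xi>) ^ 2" "norm \<xi> * norm \<xi> \<le> 1 * (1 + norm \<xi>) ^ 2"
  by (simp_all add: power2_eq_square algebra_simps)

lemma sum_laplace_symbol:
  fixes \<xi> :: R3
  shows "(\<Sum>j\<in>UNIV. \<i> * of_real (\<xi> $ j) * (\<i> * of_real (\<xi> $ j) * z)) = - ((of_real (norm \<xi>))\<^sup>2 * z)"
proof -
  have "(norm \<xi>)\<^sup>2 = \<xi> $ 1 * \<xi> $ 1 + \<xi> $ 2 * \<xi> $ 2 + \<xi> $ 3 * \<xi> $ 3"
    by (simp add: power2_norm_eq_inner inner_vec_def sum_3)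
  then have n: "(complex_of_real (norm \<xi>))\<^sup>2 = of_real (\<xi> $ 1) * of_real (\<xi> $ 1) + of_real (\<xi> $ 2) * of_real (\<xi> $ 2) + of_real (\<xi> $ 3) * of_real (\<xi> $ 3)"
    by (simp flip: of_real_power of_real_mult of_real_add)
  show ?thesis unfolding n by (simp add: sum_3 algebra_simps)
qed

lemma integrable_symbol:
  fixes A m :: "R3 \<Rightarrow> complex"
  assumes A: "integrable lborel (\<lambda>\<xi>. of_real ((1 + norm \<xi>) ^ 2) * A \<xi>)"
    and m: "m \<in> borel_measurable borel" "\<And>\<xi>. norm (m \<xi>) \<le> 1 * (1 + norm \<xi>) ^ 2"
  shows "integrable lborel (\<lambda>\<xi>. m \<xi> * A \<xi>)"
proof -
  have "L1_cont {0} (\<lambda>_ \<xi>. of_real ((1 + norm \<xi>) ^ 2) * A \<xi>)" using A by (simp add: L1_cont_def)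
  from L1_contD[OF L1_cont_weight[OF this m]] show ?thesis by blast
qed

lemma inv_ft_C2:
  fixes f :: "R3 \<Rightarrow> real"
  assumes f: "\<And>x. of_real (f x) = inv_ft A x"
    and A: "integrable lborel (\<lambda>\<xi>. of_real ((1 + norm \<xi>) ^ 2) * A \<xi>)"
  shows "f differentiable (at x)" "pd j f differentiable (at x)"
    and "of_real (pd j f x) = inv_ft (\<lambda>\<xi>. \<i> * of_real (\<xi> $ j) * A \<xi>) x"
    and "of_real (laplacian f x) = - inv_ft (\<lambda>\<xi>. (of_real (norm \<xi>))\<^sup>2 * A \<xi>) x"
proof -
  note sym = integrable_symbol[OF A]
  have 0: "integrable lborel A" using sym[of "\<lambda>_. 1"] weight_bounds(2) by simp
  have 1: "integrable lborel (\<lambda>\<xi>. of_real (norm \<xi>) * A \<xi>)"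
    by (rule sym) (use weight_bounds(1) in auto)
  have j: "integrable lborel (\<lambda>\<xi>. \<i> * of_real (\<xi> $ j) * A \<xi>)" for j
    by (rule sym) (use order_trans[OF component_le_norm_cart weight_bounds(1)] in \<open>auto simp: norm_mult\<close>)
  have j1: "integrable lborel (\<lambda>\<xi>. of_real (norm \<xi>) * (\<i> * of_real (\<xi> $ j) * A \<xi>))" for j
  proof -
    have "integrable lborel (\<lambda>\<xi>. (of_real (norm \<xi>) * (\<i> * of_real (\<xi> $ j))) * A \<xi>)"
    proof (rule sym)
      fix \<xi> :: R3
      have "norm \<xi> * \<bar>\<xi> $ j\<bar> \<le> norm \<xi> * norm \<xi>" by (intro mult_left_mono component_le_norm_cart) simp
      then show "norm (of_real (norm \<xi>) * (\<i> * of_real (\<xi> $ j))) \<le> 1 * (1 + norm \<xi>) ^ 2"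
        using weight_bounds(3)[of \<xi>] by (simp add: norm_mult)
    qed simp
    then show ?thesis by (simp only: mult.assoc)
  qed
  have jj: "integrable lborel (\<lambda>\<xi>. \<i> * of_real (\<xi> $ j) * (\<i> * of_real (\<xi> $ j) * A \<xi>))" for j
  proof -
    have "integrable lborel (\<lambda>\<xi>. (\<i> * of_real (\<xi> $ j) * (\<i> * of_real (\<xi> $ j))) * A \<xi>)"
    proof (rule sym)
      fix \<xi> :: R3
      have "\<bar>\<xi> $ j\<bar> * \<bar>\<xi> $ j\<bar> \<le> norm \<xi> * norm \<xi>" by (intro mult_mono component_le_norm_cart) auto
      then show "norm (\<i> * of_real (\<xi> $ j) * (\<i> * of_real (\<xi> $ j))) \<le> 1 * (1 + norm \<xi>) ^ 2"
        using weight_bounds(3)[of \<xi>] by (simp add: norm_mult)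
    qed simp
    then show ?thesis by (simp only: mult.assoc)
  qed
  note d1 = real_inv_ft[OF f 0 1]
  note d2 = real_inv_ft[OF d1(2) j j1]
  show "f differentiable (at x)" "pd j f differentiable (at x)"
    "of_real (pd j f x) = inv_ft (\<lambda>\<xi>. \<i> * of_real (\<xi> $ j) * A \<xi>) x"
    by (rule d1 d2)+
  have "of_real (laplacian f x) = (\<Sum>j\<in>UNIV. inv_ft (\<lambda>\<xi>. \<i> * of_real (\<xi> $ j) * (\<i> * of_real (\<xi> $ j) * A \<xi>)) x)"
    by (simp add: laplacian_def d2(2))
  also have "\<dots> = inv_ft (\<lambda>\<xi>. \<Sum>j\<in>UNIV. \<i> * of_real (\<xi> $ j) * (\<i> * of_real (\<xi> $ j) * A \<xi>)) x"
    by (rule inv_ft_sum[symmetric]) (rule jj)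
  also have "(\<lambda>\<xi>. \<Sum>j\<in>UNIV. \<i> * of_real (\<xi> $ j) * (\<i> * of_real (\<xi> $ j) * A \<xi>)) = (\<lambda>\<xi>. - ((of_real (norm \<xi>))\<^sup>2 * A \<xi>))"
    by (simp only: sum_laplace_symbol)
  finally show "of_real (laplacian f x) = - inv_ft (\<lambda>\<xi>. (of_real (norm \<xi>))\<^sup>2 * A \<xi>) x"
    by (simp add: inv_ft_uminus)
qed

context
  fixes \<nu> T :: real and u :: "real \<Rightarrow> R3 \<Rightarrow> R3" and p :: "real \<Rightarrow> R3 \<Rightarrow> real"
  assumes NS: "smooth_NS_solution \<nu> T u p"
begin

lemma st_deriv_differentiable: "t \<in> {0..<T} \<Longrightarrow> st_deriv T ds u t differentiable (at x)"
  using NS unfolding smooth_NS_solution_def smooth_spacetime_def by blast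

lemma u_differentiable: "t \<in> {0..<T} \<Longrightarrow> u t differentiable (at x)"
  using st_deriv_differentiable[of t "[]" x] by simp

lemma pd_u_differentiable: "t \<in> {0..<T} \<Longrightarrow> pd j (u t) differentiable (at x)"
  using st_deriv_differentiable[of t "[Some j]" x] by simp

lemma u_sobolev: "continuous_in_sobolev T 5 (\<lambda>t. component k (complexify (u t)))"
  using NS unfolding smooth_NS_solution_def by simp

lemma u_fourier:
  assumes "t \<in> {0..<T}"
  shows "temperate_function (component k (complexify (u t)))"
    and "is_fourier (distribution_of (component k (complexify (u t)))) (uhat u k t)"
  using u_sobolev[of k] assms is_fourier_fourier
  unfolding continuous_in_sobolev_def sobolev_def has_fourier_def uhat_def by blast+

lemma uhat_weighted: "L1_cont {0..<T} (\<lambda>t \<xi>. of_real ((1 + norm \<xi>) ^ 2) * uhat u k t \<xi>)"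
  unfolding uhat_def by (rule sobolev_L1_cont[OF u_sobolev])

lemma uhat_symbol:
  assumes "m \<in> borel_measurable borel" "\<And>\<xi>. norm (m \<xi>) \<le> 1 * (1 + norm \<xi>) ^ 2"
  shows "L1_cont {0..<T} (\<lambda>t \<xi>. m \<xi> * uhat u k t \<xi>)"
  by (rule L1_cont_weight[OF uhat_weighted assms])

lemma uhat_L1: "L1_cont {0..<T} (uhat u k)"
  using uhat_symbol[of "\<lambda>_. 1" k] weight_bounds(2) by simp

lemma uhat_grad: "L1_cont {0..<T} (\<lambda>t \<xi>. \<i> * of_real (\<xi> $ j) * uhat u k t \<xi>)"
  by (rule uhat_symbol) (use order_trans[OF component_le_norm_cart weight_bounds(1)] in \<open>auto simp: norm_mult\<close>)

lemma uhat_lap: "L1_cont {0..<T} (\<lambda>t \<xi>. (of_real (norm \<xi>))\<^sup>2 * uhat u k t \<xi>)"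
  by (rule uhat_symbol) (use weight_bounds(3) in \<open>auto simp: norm_mult power2_eq_square\<close>)

lemma curlhat_scaled:
  assumes [measurable]: "r \<in> borel_measurable borel" and r: "\<And>\<xi>. norm (r \<xi>) * norm \<xi> \<le> 1 * (1 + norm \<xi>) ^ 2"
  shows "L1_cont {0..<T} (\<lambda>t \<xi>. r \<xi> * curlhat u k t \<xi>)"
proof -
  have c: "L1_cont {0..<T} (\<lambda>t \<xi>. (r \<xi> * \<i> * of_real (\<xi> $ j)) * uhat u l t \<xi>)" for j l
  proof (rule uhat_symbol)
    fix \<xi> :: R3
    have "norm (r \<xi>) * \<bar>\<xi> $ j\<bar> \<le> norm (r \<xi>) * norm \<xi>" by (intro mult_left_mono component_le_norm_cart) simp
    then show "norm (r \<xi> * \<i> * of_real (\<xi> $ j)) \<le> 1 * (1 + norm \<xi>) ^ 2" using r[of \<xi>] by (simp add: norm_mult)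
  qed simp
  have d: "L1_cont {0..<T} (\<lambda>t \<xi>. (r \<xi> * \<i> * of_real (\<xi> $ a)) * uhat u b t \<xi> - (r \<xi> * \<i> * of_real (\<xi> $ b)) * uhat u a t \<xi>)" for a b
    by (rule L1_cont_diff[OF c c])
  consider "k = 1" | "k = 2" | "k = 3" using exhaust_3 by blast
  then show ?thesis
  proof cases
    case 1
    then show ?thesis using d[of 2 3] by (simp add: curlhat_def ccross_nth cvec_def algebra_simps)
  next
    case 2
    then show ?thesis using d[of 3 1] by (simp add: curlhat_def ccross_nth cvec_def algebra_simps)
  next
    case 3
    then show ?thesis using d[of 1 2] by (simp add: curlhat_def ccross_nth cvec_def algebra_simps)
  qed
qed

lemma curlhat_L1: "L1_cont {0..<T} (curlhat u k)"
proof -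
  have "L1_cont {0..<T} (\<lambda>t \<xi>. 1 * curlhat u k t \<xi>)" by (rule curlhat_scaled) (use weight_bounds(1) in auto)
  then show ?thesis by simp
qed

lemma lambhat_L1: "L1_cont {0..<T} (lambhat u k)"
proof -
  have d: "L1_cont {0..<T} (\<lambda>t \<xi>. fconv (uhat u a t) (curlhat u b t) \<xi> - fconv (uhat u b t) (curlhat u a t) \<xi>)" for a b
    by (intro L1_cont_diff L1_cont_fconv uhat_L1 curlhat_L1)
  consider "k = 1" | "k = 2" | "k = 3" using exhaust_3 by blast
  then show ?thesis
    by cases (use d[of 2 3] d[of 3 1] d[of 1 2] in \<open>simp_all add: lambhat_def[abs_def]\<close>)
qed

context
  fixes t :: real
  assumes t: "t \<in> {0..<T}"
begin

lemma u_inv_ft: "of_real (u t x $ k) = inv_ft (uhat u k t) x"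
proof -
  have c: "continuous_on UNIV (u t)"
    by (intro continuous_at_imp_continuous_on ballI differentiable_imp_continuous_within u_differentiable t)
  have "continuous_on UNIV (component k (complexify (u t)))"
    unfolding component_complexify by (intro continuous_on_of_real continuous_on_component c)
  from inv_ft_unique[OF this u_fourier(1)[OF t] L1_contD[OF uhat_L1 t] u_fourier(2)[OF t]]
  show ?thesis unfolding component_complexify by metis
qed

lemma pd_u_component: "pd j (\<lambda>x. u t x $ k) x = pd j (u t) x $ k"
  by (rule pd_linear[OF bounded_linear_vec_nth u_differentiable[OF t]])

lemma pd_u_inv_ft: "of_real (pd j (u t) x $ k) = inv_ft (\<lambda>\<xi>. \<i> * of_real (\<xi> $ j) * uhat u k t \<xi>) x"
  using inv_ft_C2(3)[OF u_inv_ft L1_contD[OF uhat_weighted t]] pd_u_component by metis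

lemma lap_u_inv_ft: "of_real (laplacian (u t) x $ k) = - inv_ft (\<lambda>\<xi>. (of_real (norm \<xi>))\<^sup>2 * uhat u k t \<xi>) x"
proof -
  have "pd j (pd j (u t)) x $ k = pd j (pd j (\<lambda>x. u t x $ k)) x" for j
    using pd_linear[OF bounded_linear_vec_nth pd_u_differentiable[OF t], of j j k x] by (simp add: pd_u_component[abs_def])
  then have "laplacian (u t) x $ k = laplacian (\<lambda>x. u t x $ k) x" by (simp add: laplacian_def)
  then show ?thesis using inv_ft_C2(4)[OF u_inv_ft L1_contD[OF uhat_weighted t]] by metis
qed

lemma curl_pd: "pd j (complexify (u t)) x $ k = of_real (pd j (u t) x $ k)"
  unfolding complexify_cvec pd_linear[OF bounded_linear_cvec u_differentiable[OF t]] by (simp add: cvec_def)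

lemma curl_inv_ft: "curl (complexify (u t)) x $ k = inv_ft (curlhat u k t) x"
proof -
  have d: "inv_ft (\<lambda>\<xi>. \<i> * of_real (\<xi> $ a) * uhat u b t \<xi> - \<i> * of_real (\<xi> $ b) * uhat u a t \<xi>) x = of_real (pd a (u t) x $ b) - of_real (pd b (u t) x $ a)" for a b
    by (simp add: inv_ft_diff[OF L1_contD[OF uhat_grad t] L1_contD[OF uhat_grad t]] pd_u_inv_ft)
  have w: "curlhat u 1 t = (\<lambda>\<xi>. \<i> * of_real (\<xi> $ 2) * uhat u 3 t \<xi> - \<i> * of_real (\<xi> $ 3) * uhat u 2 t \<xi>)"
    "curlhat u 2 t = (\<lambda>\<xi>. \<i> * of_real (\<xi> $ 3) * uhat u 1 t \<xi> - \<i> * of_real (\<xi> $ 1) * uhat u 3 t \<xi>)"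
    "curlhat u 3 t = (\<lambda>\<xi>. \<i> * of_real (\<xi> $ 1) * uhat u 2 t \<xi> - \<i> * of_real (\<xi> $ 2) * uhat u 1 t \<xi>)"
    by (simp_all add: curlhat_def ccross_nth cvec_def fun_eq_iff algebra_simps)
  show ?thesis using exhaust_3[of k] by (auto simp: curl_nth curl_pd w d)
qed

lemma lamb_inv_ft: "ccross (complexify (u t) x) (curl (complexify (u t)) x) $ k = inv_ft (lambhat u k t) x"
proof -
  have d: "inv_ft (\<lambda>\<xi>. fconv (uhat u a t) (curlhat u b t) \<xi> - fconv (uhat u b t) (curlhat u a t) \<xi>) x =
      complexify (u t) x $ a * curl (complexify (u t)) x $ b - complexify (u t) x $ b * curl (complexify (u t)) x $ a" for a b
  proof -
    note i = L1_contD[OF uhat_L1 t] L1_contD[OF curlhat_L1 t]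
    show ?thesis
      by (simp add: inv_ft_diff[OF integrable_fconv[OF i] integrable_fconv[OF i]] inv_ft_fconv[OF i] curl_inv_ft u_inv_ft[symmetric] complexify_def)
  qed
  have w: "lambhat u 1 t = (\<lambda>\<xi>. fconv (uhat u 2 t) (curlhat u 3 t) \<xi> - fconv (uhat u 3 t) (curlhat u 2 t) \<xi>)"
    "lambhat u 2 t = (\<lambda>\<xi>. fconv (uhat u 3 t) (curlhat u 1 t) \<xi> - fconv (uhat u 1 t) (curlhat u 3 t) \<xi>)"
    "lambhat u 3 t = (\<lambda>\<xi>. fconv (uhat u 1 t) (curlhat u 2 t) \<xi> - fconv (uhat u 2 t) (curlhat u 1 t) \<xi>)"
    by (simp_all add: lambhat_def fun_eq_iff)
  show ?thesis using exhaust_3[of k] by (auto simp: ccross_nth w d)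
qed

lemma u_time: "((\<lambda>\<tau>. u \<tau> x) has_vector_derivative time_deriv T u t x) (at t within {0..<T})"
proof -
  have "(\<lambda>\<tau>. st_deriv T [] u \<tau> x) differentiable (at t within {0..<T})"
    using NS t unfolding smooth_NS_solution_def smooth_spacetime_def by blast
  then show ?thesis unfolding time_deriv_def by (simp add: vector_derivative_works)
qed

text \<open>The pressure enters in the Bernoulli form \<open>q = p + |u|\<^sup>2 / 2\<close>, which turns the convective term
  into the Lamb vector \<open>u \<times> curl u\<close>.\<close>

lemma bernoulli_gradient:
  fixes x :: R3
  defines "E \<equiv> grad (p t) x + (\<chi> k. \<Sum>j\<in>UNIV. u t x $ j * pd k (u t) x $ j)"
  shows "((\<lambda>x. p t x + (u t x \<bullet> u t x) / 2) has_derivative (\<lambda>d. d \<bullet> E)) (at x)"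
    and "of_real (E $ k) = inv_ft (\<lambda>\<xi>. - (of_real \<nu> * ((of_real (norm \<xi>))\<^sup>2 * uhat u k t \<xi>)) + lambhat u k t \<xi>) x - of_real (time_deriv T u t x $ k)"
proof -
  have pd: "p t differentiable (at x)"
    and eq: "time_deriv T u t x + (\<Sum>j\<in>UNIV. (u t x $ j) *\<^sub>R pd j (u t) x) + grad (p t) x = \<nu> *\<^sub>R laplacian (u t) x"
    using NS t unfolding smooth_NS_solution_def by blast+
  note du = has_derivative_pd[OF u_differentiable[OF t], of x] and dp = has_derivative_pd[OF pd]
  have "((\<lambda>x. p t x + (u t x \<bullet> u t x) / 2) has_derivative
     (\<lambda>d. (\<Sum>k\<in>UNIV. d $ k *\<^sub>R pd k (p t) x) + (u t x \<bullet> (\<Sum>k\<in>UNIV. d $ k *\<^sub>R pd k (u t) x) + (\<Sum>k\<in>UNIV. d $ k *\<^sub>R pd k (u t) x) \<bullet> u t x) / 2)) (at x)"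
    by (intro has_derivative_add dp bounded_linear.has_derivative[OF bounded_linear_divide] has_derivative_inner du)
  moreover have "(\<Sum>k\<in>UNIV. d $ k *\<^sub>R pd k (p t) x) + (u t x \<bullet> (\<Sum>k\<in>UNIV. d $ k *\<^sub>R pd k (u t) x) + (\<Sum>k\<in>UNIV. d $ k *\<^sub>R pd k (u t) x) \<bullet> u t x) / 2 = d \<bullet> E" for d
    by (simp add: E_def inner_commute[of _ "u t x"] inner_sum_right, simp add: inner_vec_def grad_def sum_3 algebra_simps)
  ultimately show "((\<lambda>x. p t x + (u t x \<bullet> u t x) / 2) has_derivative (\<lambda>d. d \<bullet> E)) (at x)" by simp
  have "ccross (cvec (u t x)) (curl (complexify (u t)) x) $ k = of_real (\<Sum>j\<in>UNIV. u t x $ j * (pd k (u t) x $ j - pd j (u t) x $ k))"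
    by (rule lamb_form) (simp_all add: curl_nth curl_pd)
  then have lamb: "inv_ft (lambhat u k t) x = of_real (\<Sum>j\<in>UNIV. u t x $ j * (pd k (u t) x $ j - pd j (u t) x $ k))"
    unfolding lamb_inv_ft[symmetric] by (simp add: complexify_cvec)
  have "time_deriv T u t x $ k + (\<Sum>j\<in>UNIV. u t x $ j * pd j (u t) x $ k) + grad (p t) x $ k = \<nu> * laplacian (u t) x $ k"
    using arg_cong[OF eq, of "\<lambda>y. y $ k"] by simp
  then have "E $ k = \<nu> * laplacian (u t) x $ k + (\<Sum>j\<in>UNIV. u t x $ j * (pd k (u t) x $ j - pd j (u t) x $ k)) - time_deriv T u t x $ k"
    by (simp add: E_def right_diff_distrib sum_subtractf)
  then have "complex_of_real (E $ k) = of_real \<nu> * of_real (laplacian (u t) x $ k) + inv_ft (lambhat u k t) x - of_real (time_deriv T u t x $ k)"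
    unfolding lamb by simp
  also have "of_real \<nu> * of_real (laplacian (u t) x $ k) + inv_ft (lambhat u k t) x =
     inv_ft (\<lambda>\<xi>. (- of_real \<nu>) * ((of_real (norm \<xi>))\<^sup>2 * uhat u k t \<xi>) + lambhat u k t \<xi>) x"
    unfolding lap_u_inv_ft
    by (subst inv_ft_add)
      (auto simp only: inv_ft_cmult inv_ft_uminus mult_minus_left mult_minus_right
        intro!: integrable_mult_right L1_contD[OF uhat_lap t] L1_contD[OF lambhat_L1 t] integrable_minus)
  finally show "of_real (E $ k) = inv_ft (\<lambda>\<xi>. - (of_real \<nu> * ((of_real (norm \<xi>))\<^sup>2 * uhat u k t \<xi>)) + lambhat u k t \<xi>) x - of_real (time_deriv T u t x $ k)"
    by simp
qed

end

lemma NS_evolution: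
  fixes m :: "3 \<Rightarrow> R3 \<Rightarrow> complex"
  assumes m: "\<And>k. m k \<in> borel_measurable borel" "\<And>k \<xi>. norm (m k \<xi>) \<le> C"
    and div: "AE \<xi> in lborel. (\<Sum>k\<in>UNIV. m k \<xi> * of_real (\<xi> $ k)) = 0"
    and t: "t \<in> {0..<T}"
  shows "((\<lambda>t. \<Sum>k\<in>UNIV. LINT \<xi>|lborel. m k \<xi> * uhat u k t \<xi>) has_vector_derivative
    (\<Sum>k\<in>UNIV. LINT \<xi>|lborel. m k \<xi> * (- (of_real \<nu> * ((of_real (norm \<xi>))\<^sup>2 * uhat u k t \<xi>)) + lambhat u k t \<xi>))) (at t within {0..<T})"
proof (rule evolution[where q = "\<lambda>t x. p t x + (u t x \<bullet> u t x) / 2" and ut = "time_deriv T u" and u = u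
      and E = "\<lambda>t x. grad (p t) x + (\<chi> k. \<Sum>j\<in>UNIV. u t x $ j * pd k (u t) x $ j)"
      and G = "\<lambda>k t \<xi>. - (of_real \<nu> * ((of_real (norm \<xi>))\<^sup>2 * uhat u k t \<xi>)) + lambhat u k t \<xi>", OF uhat_L1 _ _ _ _ _ _ m div t])
  show "L1_cont {0..<T} (\<lambda>t \<xi>. - (of_real \<nu> * ((of_real (norm \<xi>))\<^sup>2 * uhat u k t \<xi>)) + lambhat u k t \<xi>)" for k
    by (intro L1_cont_add L1_cont_uminus lambhat_L1 L1_cont_bounded_mult[OF uhat_lap, where C = "\<bar>\<nu>\<bar>"]) auto
  have "continuous_on ({0..<T} \<times> UNIV) (\<lambda>(t, x). st_deriv T [None] u t x)"
    using NS unfolding smooth_NS_solution_def smooth_spacetime_def by blast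
  then show "continuous_on ({0..<T} \<times> UNIV) (\<lambda>(t, x). time_deriv T u t x)" by simp
qed (use u_inv_ft u_time bernoulli_gradient in auto)

end

section \<open>The symbol of the kernel and the profile\<close>

text \<open>The transform of \<open>h\<close> has norm \<open>1\<close> only almost everywhere; it is set to \<open>0\<close> on the exceptional set, so
  that \<open>H\<close> is bounded at every point.\<close>

lemma symbol_exists:
  assumes h_dist: "\<And>i. tempered_distribution (component i h)"
    and h_real: "\<And>i. real_distribution (component i h)"
    and h_fun: "\<And>i. has_fourier (component i h)"
    and h_unit: "AE \<xi> in lborel. norm (\<chi> i. fourier (component i h) \<xi>) = 1"
    and h_curl: "\<And>\<phi>. schwartz \<phi> \<Longrightarrow> dist_curl h \<phi> = dist_Lambda h \<phi>"
    and h_div: "\<And>\<phi>. schwartz \<phi> \<Longrightarrow> dist_div h \<phi> = 0"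
  obtains H :: "3 \<Rightarrow> R3 \<Rightarrow> complex" where
    "\<And>i. is_fourier (component i h) (H i)" "\<And>i \<xi>. norm (H i \<xi>) \<le> 1"
    "AE \<xi> in lborel. (\<Sum>i\<in>UNIV. cnj (H i \<xi>) * H i \<xi>) = 1"
    "AE \<xi> in lborel. (\<Sum>i\<in>UNIV. H i \<xi> * of_real (\<xi> $ i)) = 0"
    "AE \<xi> in lborel. \<forall>i. \<i> * ccross (cvec \<xi>) (\<chi> l. H l \<xi>) $ i = norm \<xi> * H i \<xi>"
    "AE \<xi> in lborel. \<forall>i. H i (- \<xi>) = cnj (H i \<xi>)"
proof -
  define F where "F i = fourier (component i h)" for i
  have F: "is_fourier (component i h) (F i)" for i
    using h_fun[of i] is_fourier_fourier unfolding F_def has_fourier_def by blast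
  note [measurable] = is_fourier_measurable[OF F]
  define N where "N \<xi> = (\<Sum>i\<in>UNIV. (norm (F i \<xi>))\<^sup>2)" for \<xi>
  define H where "H i \<xi> = (if N \<xi> = 1 then F i \<xi> else 0)" for i \<xi>
  have N: "AE \<xi> in lborel. N \<xi> = 1"
    using h_unit by (rule eventually_mono) (simp add: N_def F_def norm_vec_def L2_set_def)
  have [measurable]: "N \<in> borel_measurable borel" unfolding N_def[abs_def] by measurable
  have Hm: "H i \<in> borel_measurable borel" for i unfolding H_def[abs_def] by measurable
  have HF: "is_fourier (component i h) (H i)" for i
    by (rule is_fourier_cong[OF F _ Hm]) (use N in \<open>auto simp: H_def elim!: eventually_mono\<close>)
  have Hb: "norm (H i \<xi>) \<le> 1" for i \<xi>
  proof (cases "N \<xi> = 1")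
    case True
    have "(norm (F i \<xi>))\<^sup>2 \<le> N \<xi>" unfolding N_def by (rule member_le_sum) auto
    then show ?thesis using True by (simp add: H_def abs_square_le_1)
  qed (simp add: H_def)
  have unit: "AE \<xi> in lborel. (\<Sum>i\<in>UNIV. cnj (H i \<xi>) * H i \<xi>) = 1"
    using N
  proof (rule eventually_mono)
    fix \<xi> assume 1: "N \<xi> = 1"
    have "(\<Sum>i\<in>UNIV. cnj (H i \<xi>) * H i \<xi>) = of_real (N \<xi>)"
    proof -
      have "cnj (F i \<xi>) * F i \<xi> = of_real ((norm (F i \<xi>))\<^sup>2)" for i
        using complex_norm_square[of "F i \<xi>"] by (metis mult.commute of_real_power)
      then have "(\<Sum>i\<in>UNIV. cnj (F i \<xi>) * F i \<xi>) = of_real (N \<xi>)" by (simp only: N_def of_real_sum)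
      then show ?thesis using 1 by (simp add: H_def)
    qed
    then show "(\<Sum>i\<in>UNIV. cnj (H i \<xi>) * H i \<xi>) = 1" using 1 by simp
  qed
  have "AE \<xi> in lborel. H i (- \<xi>) = cnj (H i \<xi>)" for i
    by (rule fourier_real[OF HF h_dist h_real])
  then have "AE \<xi> in lborel. \<forall>i. H i (- \<xi>) = cnj (H i \<xi>)" by (simp add: AE_all_countable)
  then show ?thesis
    using that[OF HF Hb unit fourier_div_free[OF HF h_div] fourier_curl[OF HF _ h_curl]] Hb by blast
qed

lemma component_u_pm:
  fixes U W :: "R3 \<Rightarrow> complex"
  assumes c: "\<And>x. curl (complexify w) x $ k = inv_ft W x" and W: "integrable lborel W"
    and w: "\<And>x. of_real (w x $ k) = inv_ft U x" and U: "integrable lborel U"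
    and R: "integrable lborel (\<lambda>\<xi>. (1 / norm \<xi>) * W \<xi>)"
  shows "component k (u_plus w) = inv_ft (\<lambda>\<xi>. (1/2) * (U \<xi> + (1 / norm \<xi>) * W \<xi>))"
    and "component k (u_minus w) = inv_ft (\<lambda>\<xi>. (1/2) * (U \<xi> - (1 / norm \<xi>) * W \<xi>))"
proof -
  have "component k (curl (complexify w)) = inv_ft W" using c by (simp add: component_def fun_eq_iff)
  then have L: "Lambda_inv (curl (complexify w)) x $ k = inv_ft (\<lambda>\<xi>. (1 / norm \<xi>) * W \<xi>) x" for x
    unfolding Lambda_inv_def using multiplier_eq[OF temperate_inv_ft[OF W] is_fourier_inv_ft[OF W] _ R] by simp
  show "component k (u_plus w) = inv_ft (\<lambda>\<xi>. (1/2) * (U \<xi> + (1 / norm \<xi>) * W \<xi>))"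
    unfolding inv_ft_cmult[abs_def] inv_ft_add[OF U R]
    by (simp add: component_def u_plus_def L complexify_def w fun_eq_iff scaleR_conv_of_real[where 'a = complex])
  show "component k (u_minus w) = inv_ft (\<lambda>\<xi>. (1/2) * (U \<xi> - (1 / norm \<xi>) * W \<xi>))"
    unfolding inv_ft_cmult[abs_def] inv_ft_diff[OF U R]
    by (simp add: component_def u_minus_def L complexify_def w fun_eq_iff scaleR_conv_of_real[where 'a = complex])
qed

lemma AE_neq_0: "AE \<xi>::R3 in lborel. \<xi> \<noteq> 0"
  by (rule AE_lborel_singleton)

text \<open>The profile \<open>X\<close> of \<open>f\<close> satisfies \<open>H X = (U + i \<xi> \<times> U / |\<xi>|) / 2\<close>. In the inner product with the unit
  vector \<open>H\<close> both terms on the right contribute \<open>cnj H \<cdot> U / 2\<close>, the second one by \<open>helical_adjoint\<close>.\<close>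

lemma profile_fourier:
  fixes H U :: "3 \<Rightarrow> R3 \<Rightarrow> complex"
  assumes H: "\<And>i. is_fourier (component i h) (H i)"
    and unit: "AE \<xi> in lborel. (\<Sum>i\<in>UNIV. cnj (H i \<xi>) * H i \<xi>) = 1"
    and hel: "AE \<xi> in lborel. \<forall>i. \<i> * ccross (cvec \<xi>) (\<chi> l. H l \<xi>) $ i = norm \<xi> * H i \<xi>"
    and P: "\<And>i. is_fourier (distribution_of (component i w)) (\<lambda>\<xi>. (1/2) * (U i \<xi> + (1 / norm \<xi>) * (\<i> * ccross (cvec \<xi>) (\<chi> l. U l \<xi>) $ i)))"
    and U [measurable]: "\<And>i. U i \<in> borel_measurable borel"
    and conv: "\<And>i. is_conv f (component i h) (component i w)"
  defines "Y \<equiv> \<lambda>\<xi>. \<Sum>i\<in>UNIV. cnj (H i \<xi>) * U i \<xi>"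
  shows "temperate_function f" "is_fourier (distribution_of f) Y"
    and "AE \<xi> in lborel. \<forall>i. (1/2) * (U i \<xi> + (1 / norm \<xi>) * (\<i> * ccross (cvec \<xi>) (\<chi> l. U l \<xi>) $ i)) = H i \<xi> * Y \<xi>"
proof -
  note [measurable] = is_fourier_measurable[OF H]
  have c: "is_multiplier (fourier (component i h)) f (component i w)" for i using conv by (simp add: is_conv_def)
  show "temperate_function f" using c by (simp add: is_multiplier_def)
  define X where "X = fourier (distribution_of f)"
  have X: "is_fourier (distribution_of f) X"
    using c is_fourier_fourier unfolding is_multiplier_def has_fourier_def X_def by blast
  define Q where "Q i \<xi> = (1/2) * (U i \<xi> + (1 / norm \<xi>) * (\<i> * ccross (cvec \<xi>) (\<chi> l. U l \<xi>) $ i))" for i \<xi>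
  have "AE \<xi> in lborel. H i \<xi> * X \<xi> = Q i \<xi>" for i
  proof -
    have "is_fourier (distribution_of (component i w)) (\<lambda>\<xi>. fourier (component i h) \<xi> * X \<xi>)"
      using c by (simp add: is_multiplier_def X_def)
    from is_fourier_unique[OF this P] is_fourier_imp_AE[OF H, of i]
    show ?thesis by eventually_elim (simp add: Q_def)
  qed
  then have e: "AE \<xi> in lborel. \<forall>i. H i \<xi> * X \<xi> = Q i \<xi>" by (simp add: AE_all_countable)
  have XY: "AE \<xi> in lborel. X \<xi> = Y \<xi>"
    using e unit hel AE_neq_0
  proof eventually_elim
    case (elim \<xi>)
    have "X \<xi> = (\<Sum>i\<in>UNIV. cnj (H i \<xi>) * H i \<xi>) * X \<xi>" using elim(2) by simp
    also have "\<dots> = (\<Sum>i\<in>UNIV. cnj (H i \<xi>) * Q i \<xi>)" using elim(1) by (simp add: sum_distrib_right mult.assoc)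
    also have "\<dots> = (1/2) * (Y \<xi> + (1 / norm \<xi>) * (\<Sum>i\<in>UNIV. cnj (H i \<xi>) * (\<i> * ccross (cvec \<xi>) (\<chi> l. U l \<xi>) $ i)))"
      by (simp add: Q_def Y_def sum_3 algebra_simps)
    also have "(\<Sum>i\<in>UNIV. cnj (H i \<xi>) * (\<i> * ccross (cvec \<xi>) (\<chi> l. U l \<xi>) $ i)) = norm \<xi> * Y \<xi>"
      using helical_adjoint[of \<xi> "\<chi> l. H l \<xi>" "\<chi> l. U l \<xi>"] elim(3) by (simp add: Y_def)
    also have "(1/2) * (Y \<xi> + (1 / norm \<xi>) * (norm \<xi> * Y \<xi>)) = Y \<xi>" using elim(4) by simp
    finally show ?case .
  qed
  have "Y \<in> borel_measurable borel" unfolding Y_def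
    using measurable_compose[OF is_fourier_measurable[OF H] cnj_measurable] by (intro borel_measurable_sum borel_measurable_times U) auto
  then show "is_fourier (distribution_of f) Y" by (rule is_fourier_cong[OF X XY])
  show "AE \<xi> in lborel. \<forall>i. (1/2) * (U i \<xi> + (1 / norm \<xi>) * (\<i> * ccross (cvec \<xi>) (\<chi> l. U l \<xi>) $ i)) = H i \<xi> * Y \<xi>"
    using e XY by eventually_elim (simp add: Q_def)
qed

lemma vector_derivative_within_T:
  assumes "(f has_vector_derivative D) (at t within {0..<T})" "t \<in> {0..<T}"
  shows "vector_derivative f (at t within {0..<T}) = D"
proof (rule vector_derivative_within[OF _ assms(1)])
  have "t islimpt {t<..<T}" using assms(2) by (intro islimpt_greaterThanLessThan1) auto
  then have "t islimpt {0..<T}" by (rule islimpt_subset) (use assms(2) in auto)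
  then show "at t within {0..<T} \<noteq> bot" by (simp add: trivial_limit_within)
qed

section \<open>The scalar equation\<close>

theorem mainTheorem3:
  fixes \<nu> T :: real
    and h :: "(R3 \<Rightarrow> complex) \<Rightarrow> complex ^ 3"
    and u :: "real \<Rightarrow> R3 \<Rightarrow> R3"
    and p :: "real \<Rightarrow> R3 \<Rightarrow> real"
    and v :: "real \<Rightarrow> R3 \<Rightarrow> real"
  defines "V \<equiv> \<lambda>t x. complex_of_real (v t x)"
    and "Vr \<equiv> \<lambda>t x. complex_of_real (v t (- x))"
    and "hr \<equiv> dist_reflect h"
  assumes "\<nu> > 0" and "T > 0"
    and h_dist: "\<And>i. tempered_distribution (component i h)"
    and h_real: "\<And>i. real_distribution (component i h)"
    and h_fun: "\<And>i. has_fourier (component i h)"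
    and h_unit: "AE \<xi> in lborel. norm (\<chi> i. fourier (component i h) \<xi>) = 1"
    and h_curl: "\<And>\<phi>. schwartz \<phi> \<Longrightarrow> dist_curl h \<phi> = dist_Lambda h \<phi>"
    and h_div: "\<And>\<phi>. schwartz \<phi> \<Longrightarrow> dist_div h \<phi> = 0"
    and NS: "smooth_NS_solution \<nu> T u p"
    and self_dual: "\<And>t x. t \<in> {0..<T} \<Longrightarrow> u_minus (u t) x = - u_plus (u t) (- x)"
    and v_cont: "\<And>t. t \<in> {0..<T} \<Longrightarrow> continuous_on UNIV (v t)"
    and v_conv: "\<And>t i. t \<in> {0..<T} \<Longrightarrow>
                   is_conv (V t) (component i h) (component i (u_plus (u t)))"
  shows "\<forall>t\<in>{0..<T}. \<forall>x.
           (\<lambda>\<tau>. v \<tau> x) differentiable (at t within {0..<T}) \<and>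
           v t differentiable (at x) \<and> (\<forall>j. pd j (v t) differentiable (at x)) \<and>
           complex_of_real (time_deriv T v t x - \<nu> * laplacian (v t) x) =
             (\<Sum>i\<in>UNIV. conv
                (component i (\<lambda>y. ccross
                   (vconv (V t) h y - vconv (Vr t) hr y)
                   (vconv (V t) (dist_Lambda h) y + vconv (Vr t) (dist_Lambda hr) y)))
                (component i hr) x)"
proof (intro ballI allI)
  fix t x assume t: "t \<in> {0..<T}"
  obtain H :: "3 \<Rightarrow> R3 \<Rightarrow> complex" where H: "\<And>i. is_fourier (component i h) (H i)" and Hb: "\<And>i \<xi>. norm (H i \<xi>) \<le> 1"
    and unit: "AE \<xi> in lborel. (\<Sum>i\<in>UNIV. cnj (H i \<xi>) * H i \<xi>) = 1"
    and Hdiv: "AE \<xi> in lborel. (\<Sum>i\<in>UNIV. H i \<xi> * of_real (\<xi> $ i)) = 0"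
    and hel: "AE \<xi> in lborel. \<forall>i. \<i> * ccross (cvec \<xi>) (\<chi> l. H l \<xi>) $ i = norm \<xi> * H i \<xi>"
    and refl: "AE \<xi> in lborel. \<forall>i. H i (- \<xi>) = cnj (H i \<xi>)"
    using symbol_exists[OF h_dist h_real h_fun h_unit h_curl h_div] by blast
  note Hm [measurable] = is_fourier_measurable[OF H]
  have Hcm [measurable]: "(\<lambda>\<xi>. cnj (H i \<xi>)) \<in> borel_measurable borel" for i
    using measurable_compose[OF Hm cnj_measurable] .
  let ?U = "uhat u" and ?W = "curlhat u" and ?N = "lambhat u"
  define Y where "Y \<tau> \<xi> = (\<Sum>k\<in>UNIV. cnj (H k \<xi>) * ?U k \<tau> \<xi>)" for \<tau> \<xi>
  have Yw: "L1_cont {0..<T} (\<lambda>\<tau> \<xi>. of_real ((1 + norm \<xi>) ^ 2) * Y \<tau> \<xi>)"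
  proof -
    have "L1_cont {0..<T} (\<lambda>\<tau> \<xi>. \<Sum>k\<in>UNIV. cnj (H k \<xi>) * (of_real ((1 + norm \<xi>) ^ 2) * ?U k \<tau> \<xi>))"
      by (intro L1_cont_sum L1_cont_bounded_mult[OF uhat_weighted[OF NS], where C = 1]) (use Hb in auto)
    then show ?thesis by (simp only: Y_def sum_distrib_left mult.left_commute)
  qed
  have Ysym: "integrable lborel (\<lambda>\<xi>. m \<xi> * Y \<tau> \<xi>)"
    if "m \<in> borel_measurable borel" "\<And>\<xi>. norm (m \<xi>) \<le> 1 * (1 + norm \<xi>) ^ 2" "\<tau> \<in> {0..<T}" for m \<tau>
    using L1_contD[OF L1_cont_weight[OF Yw that(1,2)] that(3)] .
  have Y: "integrable lborel (Y \<tau>)" if "\<tau> \<in> {0..<T}" for \<tau>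
    using Ysym[of "\<lambda>_. 1", OF _ _ that] weight_bounds(2) by simp
  note Ui = L1_contD[OF uhat_L1[OF NS]] and Wi = L1_contD[OF curlhat_L1[OF NS]] and Ni = L1_contD[OF lambhat_L1[OF NS]]

  \<comment> \<open>\<open>Qp\<close> and \<open>Qm\<close> are the transforms of \<open>u\<^sub>+\<close> and \<open>u\<^sub>-\<close>. The division by \<open>|\<xi>|\<close> is harmless because \<open>curlhat\<close>
    carries a factor \<open>\<xi>\<close>.\<close>
  have Ri: "integrable lborel (\<lambda>\<xi>. (1 / norm \<xi>) * ?W k \<tau> \<xi>)" if "\<tau> \<in> {0..<T}" for k \<tau>
  proof (rule L1_contD[OF curlhat_scaled[OF NS] that])
    show "norm (complex_of_real (1 / norm \<xi>)) * norm \<xi> \<le> 1 * (1 + norm \<xi>) ^ 2" for \<xi> :: R3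
      using weight_bounds(2)[of \<xi>] by (cases "\<xi> = 0") (auto simp: norm_divide)
  qed measurable
  define Qp where "Qp k \<tau> \<xi> = (1/2) * (?U k \<tau> \<xi> + (1 / norm \<xi>) * ?W k \<tau> \<xi>)" for k \<tau> \<xi>
  define Qm where "Qm k \<tau> \<xi> = (1/2) * (?U k \<tau> \<xi> - (1 / norm \<xi>) * ?W k \<tau> \<xi>)" for k \<tau> \<xi>
  have Qpi: "integrable lborel (Qp k \<tau>)" and Qmi: "integrable lborel (Qm k \<tau>)" if "\<tau> \<in> {0..<T}" for k \<tau>
    unfolding Qp_def[abs_def] Qm_def[abs_def] using Ui[OF that] Ri[OF that] by (auto simp del: of_real_divide)
  have up: "component k (u_plus (u \<tau>)) = inv_ft (Qp k \<tau>)" and um: "component k (u_minus (u \<tau>)) = inv_ft (Qm k \<tau>)" if "\<tau> \<in> {0..<T}" for k \<tau>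
    using component_u_pm[OF curl_inv_ft[OF NS that] Wi[OF that] u_inv_ft[OF NS that] Ui[OF that] Ri[OF that]]
    by (simp_all add: Qp_def[abs_def] Qm_def[abs_def])
  have prof: "temperate_function (V \<tau>)" "is_fourier (distribution_of (V \<tau>)) (Y \<tau>)"
    "AE \<xi> in lborel. \<forall>i. Qp i \<tau> \<xi> = H i \<xi> * Y \<tau> \<xi>" if \<tau>: "\<tau> \<in> {0..<T}" for \<tau>
  proof -
    have P: "is_fourier (distribution_of (component i (u_plus (u \<tau>)))) (\<lambda>\<xi>. (1/2) * (?U i \<tau> \<xi> + (1 / norm \<xi>) * (\<i> * ccross (cvec \<xi>) (\<chi> l. ?U l \<tau> \<xi>) $ i)))" for i
      using is_fourier_inv_ft[OF Qpi[OF \<tau>, of i]] unfolding up[OF \<tau>, symmetric] by (simp add: Qp_def[abs_def] curlhat_def)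
    have Um: "?U i \<tau> \<in> borel_measurable borel" for i using Ui[OF \<tau>] by auto
    from profile_fourier[OF H unit hel P Um v_conv[OF \<tau>]]
    show "temperate_function (V \<tau>)" "is_fourier (distribution_of (V \<tau>)) (Y \<tau>)"
      "AE \<xi> in lborel. \<forall>i. Qp i \<tau> \<xi> = H i \<xi> * Y \<tau> \<xi>"
      by (simp_all add: Y_def[abs_def] Qp_def curlhat_def)
  qed
  have vY: "of_real (v \<tau> x) = inv_ft (Y \<tau>) x" if "\<tau> \<in> {0..<T}" for \<tau> x
  proof -
    have "V \<tau> = inv_ft (Y \<tau>)"
      by (rule inv_ft_unique[OF _ prof(1)[OF that] Y[OF that] prof(2)[OF that]])
        (auto simp: V_def intro!: continuous_on_of_real v_cont that)
    then show ?thesis unfolding V_def by metis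
  qed

  have Y1: "integrable lborel (\<lambda>\<xi>. of_real (norm \<xi>) * Y t \<xi>)"
    by (rule Ysym[OF _ _ t]) (use weight_bounds(1) in auto)
  have Y2: "integrable lborel (\<lambda>\<xi>. (of_real (norm \<xi>))\<^sup>2 * Y t \<xi>)"
    by (rule Ysym[OF _ _ t]) (use weight_bounds(3) in \<open>auto simp: norm_mult power2_eq_square\<close>)
  note vC2 = inv_ft_C2[OF vY[OF t] L1_contD[OF Yw t]]

  \<comment> \<open>Self-duality expresses \<open>Qm\<close> by the reflected profile \<open>Z\<close>, so \<open>u = u\<^sub>+ + u\<^sub>-\<close> and \<open>curl u = \<Lambda> (u\<^sub>+ - u\<^sub>-)\<close> become the two
    factors of the cross product.\<close>
  have self: "AE \<xi> in lborel. \<forall>i. Qm i t \<xi> = - Qp i t (- \<xi>)"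
  proof -
    have "AE \<xi> in lborel. Qm i t \<xi> = - Qp i t (- \<xi>)" for i
    proof -
      have m: "Qp i t \<in> borel_measurable borel" using Qpi[OF t] by auto
      have i: "integrable lborel (\<lambda>\<xi>. - Qp i t (- \<xi>))" using Qpi[OF t] integrable_refl_iff[OF m] by simp
      have "inv_ft (Qm i t) = inv_ft (\<lambda>\<xi>. - Qp i t (- \<xi>))"
      proof
        fix y
        have "inv_ft (Qm i t) y = component i (u_minus (u t)) y" by (simp add: um[OF t])
        also have "\<dots> = - component i (u_plus (u t)) (- y)" using self_dual[OF t, of y] by (simp add: component_def)
        also have "\<dots> = inv_ft (\<lambda>\<xi>. - Qp i t (- \<xi>)) y" by (simp add: up[OF t] inv_ft_uminus inv_ft_refl[OF m])
        finally show "inv_ft (Qm i t) y = inv_ft (\<lambda>\<xi>. - Qp i t (- \<xi>)) y" .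
      qed
      then have "is_fourier (distribution_of (inv_ft (Qm i t))) (\<lambda>\<xi>. - Qp i t (- \<xi>))"
        using is_fourier_inv_ft[OF i] by simp
      with is_fourier_inv_ft[OF Qmi[OF t, of i]] show ?thesis by (rule is_fourier_unique)
    qed
    then show ?thesis by (simp add: AE_all_countable)
  qed
  define Z where "Z \<xi> = Y t (- \<xi>)" for \<xi>
  have Ym [measurable]: "Y t \<in> borel_measurable borel" using Y[OF t] by auto
  have Zi: "integrable lborel Z" unfolding Z_def[abs_def] using integrable_refl_iff[OF Ym] Y[OF t] by simp
  have Z1: "integrable lborel (\<lambda>\<xi>. of_real (norm \<xi>) * Z \<xi>)"
    using integrable_refl_iff[of "\<lambda>\<xi>. of_real (norm \<xi>) * Y t \<xi>"] Y1 by (simp add: Z_def)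
  have QmZ: "AE \<xi> in lborel. \<forall>i. Qm i t \<xi> = - (H i (- \<xi>) * Z \<xi>)"
    using self AE_refl[OF prof(3)[OF t]] by eventually_elim (simp add: Z_def)
  have Vt: "V t = inv_ft (Y t)" using vY[OF t] by (auto simp: V_def)
  have Vrt: "Vr t = inv_ft Z"
    unfolding Z_def[abs_def] using vY[OF t] by (auto simp: Vr_def inv_ft_refl[OF Ym])
  have HY: "integrable lborel (\<lambda>\<xi>. H i \<xi> * A \<xi>)" "integrable lborel (\<lambda>\<xi>. H i (- \<xi>) * A \<xi>)" if "integrable lborel A" for i A
    by (rule integrable_bounded_mult[OF that, where C = 1]; use Hb in simp)+
  have hr: "is_fourier (component i hr) (\<lambda>\<xi>. H i (- \<xi>))" for i
    unfolding hr_def by (rule is_fourier_reflect[OF H])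
  have c1: "conv (V t) (component i h) = inv_ft (\<lambda>\<xi>. H i \<xi> * Y t \<xi>)" for i
    unfolding Vt by (rule conv_eq[OF temperate_inv_ft[OF Y[OF t]] is_fourier_inv_ft[OF Y[OF t]] H HY(1)[OF Y[OF t]]])
  have c2: "conv (Vr t) (component i hr) = inv_ft (\<lambda>\<xi>. H i (- \<xi>) * Z \<xi>)" for i
    unfolding Vrt by (rule conv_eq[OF temperate_inv_ft[OF Zi] is_fourier_inv_ft[OF Zi] hr HY(2)[OF Zi]])
  have L1: "integrable lborel (\<lambda>\<xi>. of_real (norm \<xi>) * H i \<xi> * Y t \<xi>)" for i
    using HY(1)[OF Y1, of i] by (simp only: mult_ac)
  have L2: "integrable lborel (\<lambda>\<xi>. of_real (norm \<xi>) * H i (- \<xi>) * Z \<xi>)" for i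
    using HY(2)[OF Z1, of i] by (simp only: mult_ac)
  have c3: "conv (V t) (component i (dist_Lambda h)) = inv_ft (\<lambda>\<xi>. of_real (norm \<xi>) * H i \<xi> * Y t \<xi>)" for i
    unfolding Vt by (rule conv_eq[OF temperate_inv_ft[OF Y[OF t]] is_fourier_inv_ft[OF Y[OF t]] is_fourier_Lambda[OF H] L1]) (use Hb in auto)
  have c4: "conv (Vr t) (component i (dist_Lambda hr)) = inv_ft (\<lambda>\<xi>. of_real (norm \<xi>) * H i (- \<xi>) * Z \<xi>)" for i
    unfolding Vrt by (rule conv_eq[OF temperate_inv_ft[OF Zi] is_fourier_inv_ft[OF Zi] is_fourier_Lambda[OF hr] L2]) (use Hb in auto)
  have Um: "?U i t \<in> borel_measurable borel" "?W i t \<in> borel_measurable borel" for i using Ui[OF t] Wi[OF t] by auto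
  note [measurable] = Um borel_measurable_integrable[OF Zi]
  have vel: "vconv (V t) h y - vconv (Vr t) hr y = complexify (u t) y" for y
  proof -
    have "conv (V t) (component i h) y - conv (Vr t) (component i hr) y = inv_ft (?U i t) y" for i
    proof -
      have "conv (V t) (component i h) y - conv (Vr t) (component i hr) y = inv_ft (\<lambda>\<xi>. H i \<xi> * Y t \<xi> - H i (- \<xi>) * Z \<xi>) y"
        unfolding c1 c2 by (rule inv_ft_diff[OF HY(1)[OF Y[OF t]] HY(2)[OF Zi], symmetric])
      also have "\<dots> = inv_ft (?U i t) y"
      proof (rule inv_ft_cong_AE)
        show "AE \<xi> in lborel. H i \<xi> * Y t \<xi> - H i (- \<xi>) * Z \<xi> = ?U i t \<xi>"
          using prof(3)[OF t] QmZ
        proof eventually_elim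
          case (elim \<xi>)
          have "H i \<xi> * Y t \<xi> - H i (- \<xi>) * Z \<xi> = Qp i t \<xi> + Qm i t \<xi>" using elim by simp
          then show ?case by (simp add: Qp_def Qm_def field_simps)
        qed
      qed measurable
      finally show ?thesis .
    qed
    then show ?thesis by (simp add: vec_eq_iff vconv_def complexify_def u_inv_ft[OF NS t])
  qed
  have vort: "vconv (V t) (dist_Lambda h) y + vconv (Vr t) (dist_Lambda hr) y = curl (complexify (u t)) y" for y
  proof -
    have "conv (V t) (component i (dist_Lambda h)) y + conv (Vr t) (component i (dist_Lambda hr)) y = inv_ft (?W i t) y" for i
    proof -
      have "conv (V t) (component i (dist_Lambda h)) y + conv (Vr t) (component i (dist_Lambda hr)) y =
          inv_ft (\<lambda>\<xi>. of_real (norm \<xi>) * H i \<xi> * Y t \<xi> + of_real (norm \<xi>) * H i (- \<xi>) * Z \<xi>) y"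
        unfolding c3 c4 by (rule inv_ft_add[OF L1 L2, symmetric])
      also have "\<dots> = inv_ft (?W i t) y"
      proof (rule inv_ft_cong_AE)
        show "AE \<xi> in lborel. of_real (norm \<xi>) * H i \<xi> * Y t \<xi> + of_real (norm \<xi>) * H i (- \<xi>) * Z \<xi> = ?W i t \<xi>"
          using prof(3)[OF t] QmZ AE_neq_0
        proof eventually_elim
          case (elim \<xi>)
          have "of_real (norm \<xi>) * H i \<xi> * Y t \<xi> + of_real (norm \<xi>) * H i (- \<xi>) * Z \<xi> = of_real (norm \<xi>) * (Qp i t \<xi> - Qm i t \<xi>)"
            using elim by (simp add: algebra_simps)
          also have "Qp i t \<xi> - Qm i t \<xi> = ?W i t \<xi> / norm \<xi>" by (simp add: Qp_def Qm_def field_simps)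
          finally show ?case using elim(3) by simp
        qed
      qed measurable
      finally show ?thesis .
    qed
    then show ?thesis by (simp add: vec_eq_iff vconv_def curl_inv_ft[OF NS t])
  qed
  have HN: "integrable lborel (\<lambda>\<xi>. cnj (H k \<xi>) * ?N k t \<xi>)" for k
    by (rule integrable_bounded_mult[OF Ni[OF t], where C = 1]) (use Hb in auto)
  have rhs: "conv (component i (\<lambda>y. ccross (vconv (V t) h y - vconv (Vr t) hr y)
        (vconv (V t) (dist_Lambda h) y + vconv (Vr t) (dist_Lambda hr) y))) (component i hr) x =
      inv_ft (\<lambda>\<xi>. cnj (H i \<xi>) * ?N i t \<xi>) x" for i
  proof -
    have "component i (\<lambda>y. ccross (vconv (V t) h y - vconv (Vr t) hr y)
        (vconv (V t) (dist_Lambda h) y + vconv (Vr t) (dist_Lambda hr) y)) = inv_ft (?N i t)"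
      unfolding vel vort by (simp add: component_def lamb_inv_ft[OF NS t] fun_eq_iff)
    moreover have "conv (inv_ft (?N i t)) (component i hr) = inv_ft (\<lambda>\<xi>. H i (- \<xi>) * ?N i t \<xi>)"
      by (rule conv_eq[OF temperate_inv_ft[OF Ni[OF t]] is_fourier_inv_ft[OF Ni[OF t]] hr HY(2)[OF Ni[OF t]]])
    moreover have "inv_ft (\<lambda>\<xi>. H i (- \<xi>) * ?N i t \<xi>) x = inv_ft (\<lambda>\<xi>. cnj (H i \<xi>) * ?N i t \<xi>) x"
      by (rule inv_ft_cong_AE)
        (use refl Ni[OF t] HN HY(2)[OF Ni[OF t]] in \<open>auto elim!: eventually_mono\<close>)
    ultimately show ?thesis by simp
  qed

  \<comment> \<open>With these symbols \<open>m\<close> the pairing with \<open>U(\<tau>)\<close> is \<open>(2 \<pi>)\<^sup>3 v(\<tau>,x)\<close>, and they are divergence free.\<close>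
  define m where "m k \<xi> = cis (x \<bullet> \<xi>) * cnj (H k \<xi>)" for k \<xi>
  define G where "G k \<xi> = - (of_real \<nu> * ((of_real (norm \<xi>))\<^sup>2 * ?U k t \<xi>)) + ?N k t \<xi>" for k \<xi>
  have mm [measurable]: "m k \<in> borel_measurable borel" for k unfolding m_def by measurable
  have mb: "norm (m k \<xi>) \<le> 1" for k \<xi> using Hb by (simp add: m_def norm_mult)
  have mdiv: "AE \<xi> in lborel. (\<Sum>k\<in>UNIV. m k \<xi> * of_real (\<xi> $ k)) = 0"
    using Hdiv
  proof (rule eventually_mono)
    fix \<xi> assume "(\<Sum>i\<in>UNIV. H i \<xi> * of_real (\<xi> $ i)) = 0"
    then have "cnj (\<Sum>i\<in>UNIV. H i \<xi> * of_real (\<xi> $ i)) = 0" by simp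
    then have "cis (x \<bullet> \<xi>) * (\<Sum>i\<in>UNIV. cnj (H i \<xi>) * of_real (\<xi> $ i)) = 0" by (simp add: cnj_sum)
    then show "(\<Sum>k\<in>UNIV. m k \<xi> * of_real (\<xi> $ k)) = 0" by (simp add: m_def sum_distrib_left mult.assoc)
  qed
  have pair: "(\<Sum>k\<in>UNIV. LINT \<xi>|lborel. m k \<xi> * A k \<xi>) / (2 * pi) ^ 3 = inv_ft (\<lambda>\<xi>. \<Sum>k\<in>UNIV. cnj (H k \<xi>) * A k \<xi>) x"
    if A: "\<And>k. integrable lborel (A k)" for A
  proof -
    have i: "integrable lborel (\<lambda>\<xi>. m k \<xi> * A k \<xi>)" for k
      by (rule integrable_bounded_mult[OF A, where C = 1]) (use mb in auto)
    have "(\<Sum>k\<in>UNIV. LINT \<xi>|lborel. m k \<xi> * A k \<xi>) = (LINT \<xi>|lborel. (\<Sum>k\<in>UNIV. m k \<xi> * A k \<xi>))"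
      by (rule Bochner_Integration.integral_sum[symmetric]) (rule i)
    then show ?thesis by (simp add: inv_ft_def m_def sum_distrib_left mult.assoc)
  qed
  have Gi: "integrable lborel (G k)" for k unfolding G_def[abs_def]
    using L1_contD[OF uhat_lap[OF NS] t] Ni[OF t] by auto
  define D where "D = inv_ft (\<lambda>\<xi>. \<Sum>k\<in>UNIV. cnj (H k \<xi>) * G k \<xi>) x"
  have "((\<lambda>\<tau>. (\<Sum>k\<in>UNIV. LINT \<xi>|lborel. m k \<xi> * ?U k \<tau> \<xi>) / (2 * pi) ^ 3) has_vector_derivative D) (at t within {0..<T})"
  proof -
    have "D = (\<Sum>k\<in>UNIV. LINT \<xi>|lborel. m k \<xi> * G k \<xi>) / (2 * pi) ^ 3" using pair[OF Gi] by (simp add: D_def)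
    then show ?thesis unfolding G_def
      using bounded_linear.has_vector_derivative[OF bounded_linear_divide NS_evolution[OF NS mm mb mdiv t]] by simp
  qed
  moreover have "of_real (v \<tau> x) = (\<Sum>k\<in>UNIV. LINT \<xi>|lborel. m k \<xi> * ?U k \<tau> \<xi>) / (2 * pi) ^ 3" if "\<tau> \<in> {0..<T}" for \<tau>
    unfolding pair[OF Ui[OF that]] using vY[OF that] by (simp add: Y_def[abs_def])
  ultimately have dV: "((\<lambda>\<tau>. complex_of_real (v \<tau> x)) has_vector_derivative D) (at t within {0..<T})"
    using has_vector_derivative_transform[OF t] by (metis (no_types, lifting))
  from bounded_linear.has_vector_derivative[OF bounded_linear_Re dV]
  have dv: "((\<lambda>\<tau>. v \<tau> x) has_vector_derivative Re D) (at t within {0..<T})" by simp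
  have td: "time_deriv T v t x = Re D"
    unfolding time_deriv_def by (rule vector_derivative_within_T[OF dv t])
  have "((\<lambda>\<tau>. complex_of_real (v \<tau> x)) has_vector_derivative complex_of_real (Re D)) (at t within {0..<T})"
    by (rule bounded_linear.has_vector_derivative[OF bounded_linear_of_real dv])
  then have "of_real (Re D) = D"
    using vector_derivative_within_T[OF dV t] vector_derivative_within_T[OF _ t] by metis
  then have tD: "of_real (time_deriv T v t x) = D" by (simp add: td)
  have "D = inv_ft (\<lambda>\<xi>. (- of_real \<nu>) * ((of_real (norm \<xi>))\<^sup>2 * Y t \<xi>) + (\<Sum>k\<in>UNIV. cnj (H k \<xi>) * ?N k t \<xi>)) x"
    unfolding D_def
    by (rule arg_cong[of _ _ "\<lambda>f. inv_ft f x"]) (simp add: G_def Y_def fun_eq_iff sum_3 algebra_simps)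
  also have "\<dots> = (- of_real \<nu>) * inv_ft (\<lambda>\<xi>. (of_real (norm \<xi>))\<^sup>2 * Y t \<xi>) x + (\<Sum>k\<in>UNIV. inv_ft (\<lambda>\<xi>. cnj (H k \<xi>) * ?N k t \<xi>) x)"
    using inv_ft_add[OF integrable_mult_right[OF Y2, of "- of_real \<nu>"], of "\<lambda>\<xi>. \<Sum>k\<in>UNIV. cnj (H k \<xi>) * ?N k t \<xi>"]
      inv_ft_sum[of UNIV "\<lambda>k \<xi>. cnj (H k \<xi>) * ?N k t \<xi>"] HN by (auto simp: inv_ft_cmult inv_ft_uminus)
  finally have D: "D = of_real \<nu> * of_real (laplacian (v t) x) + (\<Sum>k\<in>UNIV. inv_ft (\<lambda>\<xi>. cnj (H k \<xi>) * ?N k t \<xi>) x)"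
    by (simp add: vC2(4))
  have "complex_of_real (time_deriv T v t x - \<nu> * laplacian (v t) x) = (\<Sum>i\<in>UNIV. inv_ft (\<lambda>\<xi>. cnj (H i \<xi>) * ?N i t \<xi>) x)"
    using tD D by simp
  moreover have "(\<lambda>\<tau>. v \<tau> x) differentiable (at t within {0..<T})"
    using dv by (auto simp: has_vector_derivative_def differentiable_def)
  ultimately show "(\<lambda>\<tau>. v \<tau> x) differentiable (at t within {0..<T}) \<and>
           v t differentiable (at x) \<and> (\<forall>j. pd j (v t) differentiable (at x)) \<and>
           complex_of_real (time_deriv T v t x - \<nu> * laplacian (v t) x) =
             (\<Sum>i\<in>UNIV. conv
                (component i (\<lambda>y. ccross
                   (vconv (V t) h y - vconv (Vr t) hr y)
                   (vconv (V t) (dist_Lambda h) y + vconv (Vr t) (dist_Lambda hr) y)))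
                (component i hr) x)"
    using vC2(1,2) by (simp add: rhs)
qed

end
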